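(* Let $n\ge 3$ and let $w=(1,1,w_3,\dots,w_n)\in(0,1]^n$. Then the moduli space $\Delta_{0,w}$ has the homotopy type \[ \Delta_{0,w}\simeq S^{n-4}\vee\bigvee_{i=1}^{r} S^{d_i} \] for some integer $r\ge 0$ and some list of integers $0\le d_i\le n-4$.
   Context: For a weight vector $w=(w_1,\dots,w_n)\in(0,1]^n$ with $\sum_i w_i>2$: a $w$-stable $n$-marked tree is a finite tree $T$ with a marking function $m_T:\{1,\dots,n\}\to V(T)$ such that every vertex $v$ has $w$-weighted valency (number of edges at $v$ plus $\sum_{i:\,m_T(i)=v} w_i$) strictly greater than $2$. A $w$-stable tropical curve of genus $0$ is such a tree with a positive real length on each edge, considered up to marking-preserving isomorphism. $\Delta_{0,w}$ is the space of such curves of total edge length $1$; it is a simplicial complex with one simplex $\{\ell\in\mathbf{R}_{\ge0}^{E(T)}:\sum_e\ell_e=1\}$ for each $w$-stable tree $T$, where the face on which some edge lengths vanish is identified with the simplex of the tree obtained by contracting those edges (markings carried along). The sphere $S^{-1}$ is the empty set. *)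

theory Defs
  imports "HOL-Analysis.Analysis"
begin

section \<open>Quotient spaces, wedge sums and spheres\<close>

definition glue_rel :: "'a topology \<Rightarrow> ('a \<Rightarrow> 'a \<Rightarrow> bool) \<Rightarrow> ('a \<times> 'a) set" where
  "glue_rel X r =
     {(x, y). equivclp (\<lambda>x y. x \<in> topspace X \<and> y \<in> topspace X \<and> r x y) x y}"

definition glue :: "'a topology \<Rightarrow> ('a \<Rightarrow> 'a \<Rightarrow> bool) \<Rightarrow> 'a set topology" where
  "glue X r =
     topology (\<lambda>U. U \<subseteq> topspace X // glue_rel X r \<and> openin X (\<Union>U))"

lemma equiv_glue_rel: "equiv UNIV (glue_rel X r)"
proof (rule equivI)
  show "refl (glue_rel X r)"
    by (simp add: refl_on_def glue_rel_def)
  show "sym (glue_rel X r)"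
    by (auto simp: glue_rel_def intro!: symI intro: equivclp_sym)
  show "trans (glue_rel X r)"
    by (rule transI) (simp add: glue_rel_def, rule equivclp_trans)
qed simp

lemma glue_rel_topspace:
  assumes "(x, y) \<in> glue_rel X r" "x \<in> topspace X"
  shows "y \<in> topspace X"
proof -
  have "equivclp (\<lambda>x y. x \<in> topspace X \<and> y \<in> topspace X \<and> r x y) x y"
    using assms(1) by (simp add: glue_rel_def)
  then show ?thesis
    by (induction rule: equivclp_induct) (use assms(2) in blast)+
qed

lemma openin_glue:
  "openin (glue X r) U \<longleftrightarrow> U \<subseteq> topspace X // glue_rel X r \<and> openin X (\<Union>U)"
proof -
  have inter: "\<Union>(S \<inter> T) = \<Union>S \<inter> \<Union>T"
    if "S \<subseteq> topspace X // glue_rel X r" "T \<subseteq> topspace X // glue_rel X r" for S T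
  proof -
    have "C = D" if CD: "C \<in> S" "D \<in> T" and "x \<in> C" "x \<in> D" for C D x
    proof -
      have "C \<in> topspace X // glue_rel X r" "D \<in> topspace X // glue_rel X r"
        using CD \<open>S \<subseteq> _\<close> \<open>T \<subseteq> _\<close> by (simp_all add: subset_iff)
      then have "C \<in> UNIV // glue_rel X r" "D \<in> UNIV // glue_rel X r"
        by (auto simp: quotient_def)
      then show ?thesis
        using quotient_disj[OF equiv_glue_rel] \<open>x \<in> C\<close> \<open>x \<in> D\<close> by (metis disjoint_iff)
    qed
    then show ?thesis
      by blast
  qed
  have "istopology (\<lambda>U. U \<subseteq> topspace X // glue_rel X r \<and> openin X (\<Union>U))"
    unfolding istopology_def
  proof (intro conjI allI impI)
    fix S T assume S: "S \<subseteq> topspace X // glue_rel X r \<and> openin X (\<Union>S)"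
      and T: "T \<subseteq> topspace X // glue_rel X r \<and> openin X (\<Union>T)"
    show "S \<inter> T \<subseteq> topspace X // glue_rel X r"
      using S by blast
    have "\<Union>(S \<inter> T) = \<Union>S \<inter> \<Union>T"
      using S T by (intro inter) simp_all
    then show "openin X (\<Union>(S \<inter> T))"
      using S T openin_Int by metis
  next
    fix K assume K: "\<forall>S\<in>K. S \<subseteq> topspace X // glue_rel X r \<and> openin X (\<Union>S)"
    then show "\<Union>K \<subseteq> topspace X // glue_rel X r"
      by blast
    have "\<Union>(\<Union>K) = \<Union>((\<lambda>S. \<Union>S) ` K)"
      by blast
    also have "openin X \<dots>"
      using K by (intro openin_Union) auto
    finally show "openin X (\<Union>(\<Union>K))" .
  qed
  then show ?thesis
    by (simp add: glue_def)
qed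

lemma topspace_glue: "topspace (glue X r) = topspace X // glue_rel X r"
proof -
  have "\<Union>(topspace X // glue_rel X r) = topspace X"
  proof (intro equalityI subsetI)
    fix y assume "y \<in> \<Union>(topspace X // glue_rel X r)"
    then show "y \<in> topspace X"
      by (auto simp: quotient_def dest: glue_rel_topspace)
  next
    fix x assume "x \<in> topspace X"
    then show "x \<in> \<Union>(topspace X // glue_rel X r)"
      by (meson UnionI UNIV_I equiv_class_self equiv_glue_rel quotientI)
  qed
  then have "openin (glue X r) (topspace X // glue_rel X r)"
    by (simp add: openin_glue)
  then show ?thesis
    by (metis openin_glue openin_subset openin_topspace subset_antisym)
qed

lemma quotient_map_glue: "quotient_map X (glue X r) (\<lambda>x. glue_rel X r `` {x})"
  unfolding quotient_map_def
proof (intro conjI allI impI)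
  show "(\<lambda>x. glue_rel X r `` {x}) ` topspace X = topspace (glue X r)"
    by (auto simp: topspace_glue quotient_def)
next
  fix U assume "U \<subseteq> topspace (glue X r)"
  then have U: "U \<subseteq> topspace X // glue_rel X r"
    by (simp add: topspace_glue)
  have "{x \<in> topspace X. glue_rel X r `` {x} \<in> U} = \<Union>U"
  proof (intro equalityI subsetI)
    fix x assume "x \<in> {x \<in> topspace X. glue_rel X r `` {x} \<in> U}"
    then show "x \<in> \<Union>U"
      using equiv_class_self[OF equiv_glue_rel[of X r] UNIV_I, of x] by blast
  next
    fix y assume "y \<in> \<Union>U"
    then obtain C where C: "C \<in> U" "y \<in> C" by blast
    then obtain x where x: "x \<in> topspace X" "C = glue_rel X r `` {x}"
      using U by (auto simp: quotient_def)
    then have "(x, y) \<in> glue_rel X r" using C by blast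
    moreover from this have "glue_rel X r `` {x} = glue_rel X r `` {y}"
      by (rule equiv_class_eq[OF equiv_glue_rel])
    moreover from \<open>(x, y) \<in> glue_rel X r\<close> have "y \<in> topspace X"
      using x(1) by (rule glue_rel_topspace)
    ultimately show "y \<in> {x \<in> topspace X. glue_rel X r `` {x} \<in> U}"
      using C(1) x(2) by simp
  qed
  then show "openin X {x \<in> topspace X. glue_rel X r `` {x} \<in> U} = openin (glue X r) U"
    using U by (simp add: openin_glue)
qed

definition wedge_sum ::
  "'i set \<Rightarrow> ('i \<Rightarrow> 'a topology) \<Rightarrow> ('i \<Rightarrow> 'a) \<Rightarrow> ('i \<times> 'a) set topology" where
  "wedge_sum I X p = glue (sum_topology X I) (\<lambda>(i, x) (j, y). x = p i \<and> y = p j)"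

text \<open>Spheres are indexed by integers in order to include the empty sphere of dimension \<open>-1\<close>.\<close>

definition std_sphere :: "int \<Rightarrow> (nat \<Rightarrow> real) topology" where
  "std_sphere d = (if d < 0 then trivial_topology else nsphere (nat d))"

definition sphere_pole :: "nat \<Rightarrow> real" where
  "sphere_pole = (\<lambda>k. if k = 0 then 1 else 0)"

text \<open>The pole is a point of every sphere of dimension at least 0. The empty sphere has no
  base point; \<open>wedge_of_spheres [-1]\<close> is empty, as it should be.\<close>

definition wedge_of_spheres :: "int list \<Rightarrow> (nat \<times> (nat \<Rightarrow> real)) set topology" where
  "wedge_of_spheres ds =
     wedge_sum {..<length ds} (\<lambda>i. std_sphere (ds ! i)) (\<lambda>i. sphere_pole)"


section \<open>Weighted stable marked trees\<close>

text \<open>Vertices are taken from \<^typ>\<open>nat\<close>, which loses nothing as trees are finite and will only be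
  considered up to isomorphism. Edges are two-element sets of vertices. Only the values of the
  marking on \<open>{1..n}\<close> are relevant.\<close>

datatype marked_tree =
  Marked_Tree (verts: "nat set") (edges: "nat set set") (mark: "nat \<Rightarrow> nat")

definition edge_connected :: "nat set set \<Rightarrow> nat \<Rightarrow> nat \<Rightarrow> bool" where
  "edge_connected E = (\<lambda>u v. {u, v} \<in> E)\<^sup>*\<^sup>*"

definition is_cycle :: "nat set set \<Rightarrow> nat list \<Rightarrow> bool" where
  "is_cycle E c \<longleftrightarrow>
     3 \<le> length c \<and> distinct c \<and>
     (\<forall>i<length c. {c ! i, c ! (Suc i mod length c)} \<in> E)"

definition finite_tree :: "nat set \<Rightarrow> nat set set \<Rightarrow> bool" where
  "finite_tree V E \<longleftrightarrow>
     finite V \<and> V \<noteq> {} \<and> (\<forall>e\<in>E. e \<subseteq> V \<and> card e = 2) \<and>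
     (\<forall>u\<in>V. \<forall>v\<in>V. edge_connected E u v) \<and> (\<nexists>c. is_cycle E c)"

definition weighted_valency :: "nat \<Rightarrow> (nat \<Rightarrow> real) \<Rightarrow> marked_tree \<Rightarrow> nat \<Rightarrow> real" where
  "weighted_valency n w T v =
     real (card {e \<in> edges T. v \<in> e}) + (\<Sum>i | i \<in> {1..n} \<and> mark T i = v. w i)"

definition stable_tree :: "nat \<Rightarrow> (nat \<Rightarrow> real) \<Rightarrow> marked_tree \<Rightarrow> bool" where
  "stable_tree n w T \<longleftrightarrow>
     finite_tree (verts T) (edges T) \<and>
     (\<forall>i\<in>{1..n}. mark T i \<in> verts T) \<and>
     (\<forall>v\<in>verts T. weighted_valency n w T v > 2)"

text \<open>The map \<open>f\<close> on vertices exhibits \<open>T'\<close> as the tree obtained from \<open>T\<close> by contracting the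
  edges in \<open>F\<close>. For \<open>F = {}\<close> this says that \<open>f\<close> is an isomorphism of marked trees.\<close>

definition contraction ::
  "nat \<Rightarrow> nat set set \<Rightarrow> (nat \<Rightarrow> nat) \<Rightarrow> marked_tree \<Rightarrow> marked_tree \<Rightarrow> bool" where
  "contraction n F f T T' \<longleftrightarrow>
     F \<subseteq> edges T \<and>
     verts T' = f ` verts T \<and>
     (\<forall>u\<in>verts T. \<forall>v\<in>verts T. f u = f v \<longleftrightarrow> edge_connected F u v) \<and>
     edges T' = (\<lambda>e. f ` e) ` (edges T - F) \<and>
     (\<forall>i\<in>{1..n}. mark T' i = f (mark T i))"


section \<open>The moduli space\<close>

definition length_simplex :: "marked_tree \<Rightarrow> (nat set \<Rightarrow> real) topology" where
  "length_simplex T =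
     subtopology (powertop_real (edges T))
       {l. (\<forall>e\<in>edges T. 0 \<le> l e) \<and> (\<Sum>e\<in>edges T. l e) = 1}"

definition length_contraction ::
  "nat \<Rightarrow> marked_tree \<times> (nat set \<Rightarrow> real) \<Rightarrow> marked_tree \<times> (nat set \<Rightarrow> real) \<Rightarrow> bool" where
  "length_contraction n = (\<lambda>(T, l) (T', l').
     \<exists>F f. contraction n F f T T' \<and> (\<forall>e\<in>F. l e = 0) \<and>
           (\<forall>e\<in>edges T - F. l' (f ` e) = l e))"

text \<open>One simplex for every stable tree; isomorphic trees have their simplices identified (the case
  \<open>F = {}\<close> of a contraction), and so are the faces where some lengths vanish with the simplices of
  the contracted trees. Every point has a representative with positive lengths, unique up
  to isomorphism of marked metric trees.\<close>

definition Delta0 ::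
  "nat \<Rightarrow> (nat \<Rightarrow> real) \<Rightarrow> (marked_tree \<times> (nat set \<Rightarrow> real)) set topology" where
  "Delta0 n w =
     glue (sum_topology length_simplex {T. stable_tree n w T}) (length_contraction n)"

end

theory Submission
  imports Defs
begin

text \<open>
Root a stable tree at the mark 2 and record, for every edge, its cluster, the set of marks which
the edge separates from 2. This identifies \<open>\<Delta>\<^sub>0\<^sub>,\<^sub>w\<close> with the complex of laminar families (any two
members nested or disjoint) of proper subsets of \<open>{1..n} - {2}\<close> of weight above 1.

Let \<open>y\<close> be a lightest mark besides the heavy marks 1 and 2. Call a cluster \<open>B\<close> with \<open>y \<in> B\<close>, \<open>1 \<notin> B\<close>
critical if \<open>B - {y}\<close> is no cluster. The critical clusters and the largest cluster without \<open>y\<close> are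
pairwise incompatible, because \<open>y\<close> is lightest, and without them the complex is collapsible: move \<open>y\<close>
along the tree to the mark 1. The link of each of them is a complex of the same kind for
fewer marks, namely with \<open>y\<close> omitted, or with \<open>B\<close> fused to a single mark. By induction the whole
complex is the union of a collapsible subcomplex and of some facets with boundary in the subcomplex,
one of them of dimension \<open>n - 4\<close>, and therefore it is a wedge of spheres.
\<close>

section \<open>Collapsible complexes and laminar families\<close>

text \<open>The induction forces a statement wider than the theorem: a fused mark weighs more than
  1, so marks give way to blocks of arbitrary positive weight, of which only one, \<open>h\<close>,
  must weigh at least 1. What survives of the bound \<open>w i \<le> 1\<close> is the rule that a
  block is no cluster. Mark 2 is heavy for another reason: stability on its side of an edge then
  excludes the cluster of all the other marks. Incompatibility matters because a laminar family
  contains at most one of the special clusters. Their links therefore lie in the collapsible part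
  and can be coned off independently: the collapsible part of a link yields a cone that keeps the
  base collapsible, and every facet left over in a link yields one new facet. For \<open>m\<close>
  blocks the largest facets have \<open>m - 2\<close> members, as many as a binary tree with
  \<open>m\<close> leaves has inner vertices besides the root; \<open>m = n - 1\<close> gives
  dimension \<open>n - 4\<close>. A collapsible subcomplex is contractible, so collapsing it to a
  point is a homotopy equivalence, and every facet left over becomes a sphere.\<close>

definition simplicial_complex :: "'v set set \<Rightarrow> bool" where
  "simplicial_complex K \<longleftrightarrow> finite K \<and> (\<forall>\<sigma>\<in>K. finite \<sigma>) \<and> (\<forall>\<sigma>\<in>K. \<forall>\<tau>. \<tau> \<subseteq> \<sigma> \<longrightarrow> \<tau> \<in> K)"

lemma simplicial_complexD:
  assumes "simplicial_complex K"
  shows "finite K" "\<sigma> \<in> K \<Longrightarrow> finite \<sigma>" "\<sigma> \<in> K \<Longrightarrow> \<tau> \<subseteq> \<sigma> \<Longrightarrow> \<tau> \<in> K"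
  using assms unfolding simplicial_complex_def by blast+

text \<open>Collapses are read backwards, as expansions, because the proof builds complexes by
  adding faces. The start is the void complex: the first expansion has \<open>\<tau> = {}\<close>
  and creates a vertex together with the empty face. Freeness of \<open>\<tau>\<close> is implied,
  since a complex \<open>K\<close> without \<open>\<tau>\<close> contains no coface of it.\<close>

inductive collapsible :: "'v set set \<Rightarrow> bool" where
  void: "collapsible {}"
| expand: "\<lbrakk>collapsible K; simplicial_complex (insert \<tau> (insert (insert v \<tau>) K));
            v \<notin> \<tau>; \<tau> \<notin> K; insert v \<tau> \<notin> K\<rbrakk>
           \<Longrightarrow> collapsible (insert \<tau> (insert (insert v \<tau>) K))"

lemma collapsible_imp_simplicial_complex: "collapsible K \<Longrightarrow> simplicial_complex K"
  by (induction rule: collapsible.induct) (auto simp: simplicial_complex_def)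

lemma subset_insert_cases:
  assumes "\<tau> \<subseteq> insert a \<sigma>"
  obtains "a \<notin> \<tau>" "\<tau> \<subseteq> \<sigma>" | \<rho> where "\<tau> = insert a \<rho>" "\<rho> \<subseteq> \<sigma>" "a \<notin> \<rho>"
proof (cases "a \<in> \<tau>")
  case True
  have "\<tau> = insert a (\<tau> - {a})" "\<tau> - {a} \<subseteq> \<sigma>" "a \<notin> \<tau> - {a}" using True assms by auto
  then show ?thesis using that(2) by blast
next
  case False
  then show ?thesis using that(1) assms by blast
qed

lemma simplicial_complex_attach_cone:
  assumes D: "simplicial_complex D" and L: "simplicial_complex L" and "L \<subseteq> D"
  shows "simplicial_complex (D \<union> insert a ` L)"
  unfolding simplicial_complex_def
proof (intro conjI ballI allI impI)
  show "finite (D \<union> insert a ` L)"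
    using D L by (simp add: simplicial_complex_def)
  show "finite \<sigma>" if "\<sigma> \<in> D \<union> insert a ` L" for \<sigma>
    using that D L by (auto simp: simplicial_complex_def)
  show "\<tau> \<in> D \<union> insert a ` L" if \<sigma>: "\<sigma> \<in> D \<union> insert a ` L" and "\<tau> \<subseteq> \<sigma>" for \<sigma> \<tau>
  proof (cases "\<sigma> \<in> D")
    case True
    then show ?thesis using simplicial_complexD(3)[OF D] \<open>\<tau> \<subseteq> \<sigma>\<close> by blast
  next
    case False
    then obtain \<rho> where \<rho>: "\<rho> \<in> L" "\<sigma> = insert a \<rho>" using \<sigma> by blast
    from \<open>\<tau> \<subseteq> \<sigma>\<close> \<rho>(2) have "\<tau> \<subseteq> insert a \<rho>" by simp
    then show ?thesis
      by (cases rule: subset_insert_cases)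
        (use \<rho>(1) simplicial_complexD(3)[OF L] \<open>L \<subseteq> D\<close> in blast)+
  qed
qed

text \<open>Each expansion of \<open>L\<close> by \<open>\<tau>\<close> and
  \<open>insert v \<tau>\<close> lifts to one of the union by \<open>insert a \<tau>\<close> and
  \<open>insert v (insert a \<tau>)\<close>. The lift for \<open>\<tau> = {}\<close> brings in the
  vertex \<open>a\<close> with an edge to \<open>v\<close>; a void \<open>L\<close> attaches
  nothing.\<close>

lemma collapsible_attach_cone:
  assumes "collapsible L" "collapsible D" "L \<subseteq> D" "\<forall>\<sigma>\<in>D. a \<notin> \<sigma>"
  shows "collapsible (D \<union> insert a ` L)"
  using assms
proof (induction rule: collapsible.induct)
  case void
  then show ?case by simp
next
  case (expand L \<tau> v)
  let ?L' = "insert \<tau> (insert (insert v \<tau>) L)"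
  let ?D = "D \<union> insert a ` L"
  have IH: "collapsible ?D"
    using expand by simp
  have a: "a \<notin> \<tau>" "a \<notin> insert v \<tau>" and aL: "\<forall>\<sigma>\<in>L. a \<notin> \<sigma>"
    using expand.prems by auto
  have eq: "D \<union> insert a ` ?L' = insert (insert a \<tau>) (insert (insert v (insert a \<tau>)) ?D)"
    by (auto simp: insert_commute)
  have "simplicial_complex (D \<union> insert a ` ?L')"
    by (rule simplicial_complex_attach_cone)
      (use expand collapsible_imp_simplicial_complex in blast)+
  moreover have "insert a \<tau> \<notin> ?D" "insert v (insert a \<tau>) \<notin> ?D"
    using expand a aL by (auto simp: insert_commute dest!: insert_ident[THEN iffD1, rotated 2])
  ultimately show ?case
    unfolding eq using a expand.hyps by (intro collapsible.expand IH) auto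
qed

text \<open>The faces of \<open>D\<close> enter in an order refining inclusion, each paired with its
  join with \<open>a\<close>. Here all expansions go in the direction of the apex, so
  \<open>D\<close> may be any complex.\<close>

lemma collapsible_cone:
  assumes "simplicial_complex D" "\<forall>\<sigma>\<in>D. a \<notin> \<sigma>"
  shows "collapsible (D \<union> insert a ` D)"
  using assms
proof (induction "card D" arbitrary: D)
  case 0
  then have "D = {}" by (simp add: simplicial_complex_def)
  then show ?case by (simp add: collapsible.void)
next
  case (Suc k)
  have fin: "finite D" using Suc.prems by (simp add: simplicial_complex_def)
  moreover have "D \<noteq> {}" using Suc.hyps(2) by auto
  ultimately obtain \<tau> where \<tau>: "\<tau> \<in> D" "\<And>\<sigma>. \<sigma> \<in> D \<Longrightarrow> \<tau> \<subseteq> \<sigma> \<Longrightarrow> \<sigma> = \<tau>"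
    using finite_has_maximal[of D] by blast
  let ?D = "D - {\<tau>}"
  have sc: "simplicial_complex ?D"
    using Suc.prems(1) \<tau> unfolding simplicial_complex_def by auto
  have IH: "collapsible (?D \<union> insert a ` ?D)"
    by (rule Suc.hyps(1)) (use Suc.hyps(2) fin \<tau>(1) sc Suc.prems in auto)
  have eq: "D \<union> insert a ` D = insert \<tau> (insert (insert a \<tau>) (?D \<union> insert a ` ?D))"
    using \<tau>(1) by blast
  have "simplicial_complex (D \<union> insert a ` D)"
    using Suc.prems by (intro simplicial_complex_attach_cone) auto
  moreover have "a \<notin> \<tau>" using Suc.prems \<tau> by blast
  moreover have "insert a \<tau> \<notin> ?D \<union> insert a ` ?D"
    using Suc.prems(2) \<tau>(1) by (auto dest!: insert_ident[THEN iffD1, rotated 2])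
  moreover have "\<tau> \<notin> ?D \<union> insert a ` ?D"
    using \<open>a \<notin> \<tau>\<close> by blast
  ultimately show ?case
    unfolding eq using IH by (intro collapsible.expand) auto
qed

section \<open>Laminar families as a flag complex\<close>

definition compat :: "'a set \<Rightarrow> 'a set \<Rightarrow> bool" where
  "compat A B \<longleftrightarrow> A \<subseteq> B \<or> B \<subseteq> A \<or> A \<inter> B = {}"

lemma compat_sym: "compat A B \<Longrightarrow> compat B A"
  by (auto simp: compat_def)

definition laminar_families :: "'a set set \<Rightarrow> 'a set set set" where
  "laminar_families V = {\<sigma>. \<sigma> \<subseteq> V \<and> (\<forall>A\<in>\<sigma>. \<forall>B\<in>\<sigma>. compat A B)}"

text \<open>Compatibility is a relation between two sets, so laminar families form a flag complex: a
  link is again a complex of laminar families, and it is enough to name its vertices.\<close>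

definition link_verts :: "'a set set \<Rightarrow> 'a set \<Rightarrow> 'a set set" where
  "link_verts V a = {v\<in>V. v \<noteq> a \<and> compat v a}"

lemma laminar_families_mono: "V \<subseteq> W \<Longrightarrow> laminar_families V \<subseteq> laminar_families W"
  by (auto simp: laminar_families_def)

lemma simplicial_complex_laminar_families:
  "finite V \<Longrightarrow> simplicial_complex (laminar_families V)"
  unfolding simplicial_complex_def laminar_families_def
  by (auto intro: finite_subset)

lemma laminar_families_insert:
  "laminar_families (insert a V) =
     laminar_families V \<union> insert a ` laminar_families (link_verts V a)"
proof (intro equalityI subsetI)
  fix \<sigma> assume \<sigma>: "\<sigma> \<in> laminar_families (insert a V)"
  show "\<sigma> \<in> laminar_families V \<union> insert a ` laminar_families (link_verts V a)"
  proof (cases "a \<in> \<sigma>")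
    case True
    then have "\<sigma> - {a} \<in> laminar_families (link_verts V a)"
      using \<sigma> by (auto simp: laminar_families_def link_verts_def)
    then show ?thesis using True by (metis UnCI image_eqI insert_Diff)
  next
    case False
    then show ?thesis using \<sigma> by (auto simp: laminar_families_def)
  qed
next
  fix \<sigma> assume "\<sigma> \<in> laminar_families V \<union> insert a ` laminar_families (link_verts V a)"
  then show "\<sigma> \<in> laminar_families (insert a V)"
    by (auto simp: laminar_families_def link_verts_def compat_def)
qed

text \<open>In a flag complex a vertex compatible with all the others is the apex of a cone.\<close>

lemma collapsible_laminar_families_cone:
  assumes "finite V" "a \<in> V" "\<And>v. v \<in> V \<Longrightarrow> compat v a"
  shows "collapsible (laminar_families V)"
proof -
  have link: "link_verts (V - {a}) a = V - {a}"
    using assms(3) by (auto simp: link_verts_def)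
  have eq: "laminar_families V =
      laminar_families (V - {a}) \<union> insert a ` laminar_families (V - {a})"
    using laminar_families_insert[of a "V - {a}"] unfolding link insert_Diff[OF assms(2)] .
  show ?thesis
    unfolding eq
  proof (rule collapsible_cone)
    show "simplicial_complex (laminar_families (V - {a}))"
      by (simp add: simplicial_complex_laminar_families assms(1))
  qed (auto simp: laminar_families_def)
qed

text \<open>The vertices of \<open>U\<close> are added to \<open>V\<close> by increasing
  \<open>f\<close>. When \<open>a\<close> enters, its link has only vertices from \<open>V\<close>
  and vertices \<open>u\<close> of \<open>U\<close> with \<open>f u \<le> f a\<close>, all
  compatible with \<open>b\<close>; so the link is a cone with apex \<open>b\<close>, and a cone
  over it may be attached. The induction strips off the vertex that enters last.\<close>

lemma collapsible_laminar_families_dominated: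
  fixes f :: "'a set \<Rightarrow> nat"
  assumes V: "finite V" "collapsible (laminar_families V)"
    and U: "finite U" "V \<inter> U = {}"
    and dom: "\<And>a. a \<in> U \<Longrightarrow> \<exists>b\<in>V. compat b a \<and>
                (\<forall>v\<in>V. compat v a \<longrightarrow> compat v b) \<and>
                (\<forall>u\<in>U. u \<noteq> a \<longrightarrow> f u \<le> f a \<longrightarrow> compat u a \<longrightarrow> compat u b)"
  shows "collapsible (laminar_families (V \<union> U))"
  using U dom
proof (induction "card U" arbitrary: U)
  case 0
  then show ?case using V by simp
next
  case (Suc k)
  then have "U \<noteq> {}" by auto
  then have "Max (f ` U) \<in> f ` U" using Suc.prems by simp
  then obtain a where "a \<in> U" and fa: "f a = Max (f ` U)" by (metis imageE)
  then have a: "a \<in> U" "\<And>u. u \<in> U \<Longrightarrow> f u \<le> f a"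
    using Suc.prems(1) by simp_all
  let ?W = "V \<union> (U - {a})"
  have IH: "collapsible (laminar_families ?W)"
  proof (rule Suc.hyps(1))
    show "k = card (U - {a})" using Suc.hyps(2) Suc.prems(1) a by simp
    show "\<exists>b\<in>V. compat b a' \<and> (\<forall>v\<in>V. compat v a' \<longrightarrow> compat v b) \<and>
       (\<forall>u\<in>U - {a}. u \<noteq> a' \<longrightarrow> f u \<le> f a' \<longrightarrow> compat u a' \<longrightarrow> compat u b)" if "a' \<in> U - {a}" for a'
    proof -
      have "a' \<in> U" using that by simp
      from Suc.prems(3)[OF this] obtain b where "b \<in> V" "compat b a'"
        "\<forall>v\<in>V. compat v a' \<longrightarrow> compat v b"
        "\<forall>u\<in>U. u \<noteq> a' \<longrightarrow> f u \<le> f a' \<longrightarrow> compat u a' \<longrightarrow> compat u b" by auto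
      then show ?thesis by (intro bexI[of _ b]) auto
    qed
  qed (use Suc.prems in auto)
  obtain b where b: "b \<in> V" "compat b a" "\<forall>v\<in>V. compat v a \<longrightarrow> compat v b"
    "\<forall>u\<in>U. u \<noteq> a \<longrightarrow> compat u a \<longrightarrow> compat u b"
    using Suc.prems(3)[OF a(1)] a(2) by auto
  have fin: "finite ?W" using V Suc.prems by simp
  have "a \<notin> V" using Suc.prems a by blast
  have "collapsible (laminar_families (link_verts ?W a))"
  proof (rule collapsible_laminar_families_cone)
    show "finite (link_verts ?W a)" using fin by (simp add: link_verts_def)
    show "b \<in> link_verts ?W a" using b(1,2) \<open>a \<notin> V\<close> by (auto simp: link_verts_def)
    show "compat v b" if "v \<in> link_verts ?W a" for v
      using that b(3,4) by (auto simp: link_verts_def)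
  qed
  moreover have "laminar_families (link_verts ?W a) \<subseteq> laminar_families ?W"
    by (rule laminar_families_mono) (auto simp: link_verts_def)
  moreover have "\<forall>\<sigma>\<in>laminar_families ?W. a \<notin> \<sigma>"
    using \<open>a \<notin> V\<close> by (auto simp: laminar_families_def)
  ultimately have "collapsible (laminar_families (insert a ?W))"
    unfolding laminar_families_insert by (intro collapsible_attach_cone[OF _ IH])
  moreover have "insert a ?W = V \<union> U" using a by blast
  ultimately show ?case by (simp only:)
qed

text \<open>The void complex \<open>C = {}\<close>, without even the empty face, is allowed. It occurs at the base of the
  induction, where \<open>X = {{}}\<close>: coning off turns the empty simplex into a vertex.\<close>

definition near_collapsible :: "'v set set \<Rightarrow> 'v set set \<Rightarrow> 'v set set \<Rightarrow> bool" where
  "near_collapsible K C X \<longleftrightarrow> collapsible C \<and> K = C \<union> X \<and> C \<inter> X = {} \<and>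
     (\<forall>\<sigma>\<in>X. \<forall>\<tau>. \<tau> \<subset> \<sigma> \<longrightarrow> \<tau> \<in> C)"

lemma laminar_families_independent:
  assumes "V = V' \<union> P" "V' \<inter> P = {}" and indep: "\<And>a b. \<lbrakk>a \<in> P; b \<in> P; a \<noteq> b\<rbrakk> \<Longrightarrow> \<not> compat a b"
  shows "laminar_families V =
     laminar_families V' \<union> (\<Union>a\<in>P. insert a ` laminar_families (link_verts V a))"
proof (intro equalityI subsetI)
  fix \<sigma> assume \<sigma>: "\<sigma> \<in> laminar_families V"
  show "\<sigma> \<in> laminar_families V' \<union> (\<Union>a\<in>P. insert a ` laminar_families (link_verts V a))"
  proof (cases "\<sigma> \<inter> P = {}")
    case True
    then show ?thesis using \<sigma> assms(1) by (auto simp: laminar_families_def)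
  next
    case False
    then obtain a where a: "a \<in> \<sigma>" "a \<in> P" by blast
    have "\<sigma> - {a} \<in> laminar_families (link_verts V a)"
      using \<sigma> a by (auto simp: laminar_families_def link_verts_def)
    moreover have "\<sigma> = insert a (\<sigma> - {a})" using a by blast
    ultimately show ?thesis using a(2) by blast
  qed
next
  fix \<sigma> assume "\<sigma> \<in> laminar_families V' \<union> (\<Union>a\<in>P. insert a ` laminar_families (link_verts V a))"
  then show "\<sigma> \<in> laminar_families V"
    using assms(1) by (auto simp: laminar_families_def link_verts_def compat_def)
qed

text \<open>No two members of \<open>P\<close> are compatible, so their links lie in
  \<open>laminar_families V'\<close> and the cones over them can be attached one at a time. The part
  over \<open>C a\<close> extends the collapsible subcomplex; the part over \<open>X a\<close> is
  left as new cells.\<close>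

lemma near_collapsible_laminar_families:
  assumes "V = V' \<union> P" "V' \<inter> P = {}" "finite V"
    and indep: "\<And>a b. \<lbrakk>a \<in> P; b \<in> P; a \<noteq> b\<rbrakk> \<Longrightarrow> \<not> compat a b"
    and coll: "collapsible (laminar_families V')"
    and link: "\<And>a. a \<in> P \<Longrightarrow> near_collapsible (laminar_families (link_verts V a)) (C a) (X a)"
  shows "near_collapsible (laminar_families V)
           (laminar_families V' \<union> (\<Union>a\<in>P. insert a ` C a)) (\<Union>a\<in>P. insert a ` X a)"
  unfolding near_collapsible_def
proof (intro conjI ballI allI impI)
  have link_sub: "link_verts V a \<subseteq> V'" if "a \<in> P" for a
    using indep[of _ a] that assms(1) by (auto simp: link_verts_def)
  have CX: "C a \<union> X a = laminar_families (link_verts V a)" if "a \<in> P" for a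
    using link[OF that] by (simp add: near_collapsible_def)
  then have sub: "C a \<union> X a \<subseteq> laminar_families V'" if "a \<in> P" for a
    using laminar_families_mono[OF link_sub[OF that]] that by simp
  have notin: "b \<notin> \<sigma>" if "b \<in> P" "\<sigma> \<in> laminar_families V'" for b \<sigma>
    using that assms(2) by (auto simp: laminar_families_def)
  have "finite P" using assms by simp
  have "Q \<subseteq> P \<Longrightarrow> collapsible (laminar_families V' \<union> (\<Union>a\<in>Q. insert a ` C a))" if "finite Q" for Q
    using that
  proof (induction Q rule: finite_induct)
    case empty
    then show ?case using coll by simp
  next
    case (insert b Q)
    let ?D = "laminar_families V' \<union> (\<Union>a\<in>Q. insert a ` C a)"
    have "collapsible (?D \<union> insert b ` C b)"
    proof (rule collapsible_attach_cone)
      show "collapsible (C b)" using link insert by (simp add: near_collapsible_def)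
      show "collapsible ?D" using insert by simp
      show "C b \<subseteq> ?D" using sub[of b] insert by blast
      show "\<forall>\<sigma>\<in>?D. b \<notin> \<sigma>"
        using notin[of b] sub insert by blast
    qed
    then show ?case by (simp add: Un_assoc Un_commute Un_left_commute)
  qed
  then show "collapsible (laminar_families V' \<union> (\<Union>a\<in>P. insert a ` C a))"
    using \<open>finite P\<close> by blast
  show "laminar_families V = laminar_families V' \<union> (\<Union>a\<in>P. insert a ` C a) \<union> (\<Union>a\<in>P. insert a ` X a)"
  proof -
    have "(\<Union>a\<in>P. insert a ` laminar_families (link_verts V a)) = (\<Union>a\<in>P. insert a ` C a \<union> insert a ` X a)"
      by (intro SUP_cong refl) (simp add: CX flip: image_Un)
    also have "\<dots> = (\<Union>a\<in>P. insert a ` C a) \<union> (\<Union>a\<in>P. insert a ` X a)"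
      by (rule UN_Un_distrib)
    finally show ?thesis
      by (simp add: laminar_families_independent[OF assms(1,2) indep] Un_assoc)
  qed
  \<comment> \<open>Each side has exactly one member in \<open>P\<close>, so the apex and the base
    can be read off.\<close>
  have "insert a \<sigma> \<noteq> insert b \<tau>" if ab: "a \<in> P" "b \<in> P" "\<sigma> \<in> C a" "\<tau> \<in> X b" for a b \<sigma> \<tau>
  proof
    assume eq: "insert a \<sigma> = insert b \<tau>"
    have st: "\<sigma> \<in> laminar_families V'" "\<tau> \<in> laminar_families V'" using ab sub by blast+
    have ab': "a = b" using eq notin[of a \<tau>] ab(1,2) st by blast
    then have "\<sigma> = \<tau>" using eq notin[of a \<tau>] notin[of a \<sigma>] ab(1) st by (metis insert_ident)
    then show False using link[OF ab(1)] ab ab' by (auto simp: near_collapsible_def)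
  qed
  moreover have "insert a \<sigma> \<notin> laminar_families V'" if "a \<in> P" for a \<sigma>
    using notin[OF that, of "insert a \<sigma>"] by blast
  ultimately have "\<rho> \<notin> (\<Union>a\<in>P. insert a ` X a)"
    if "\<rho> \<in> laminar_families V' \<union> (\<Union>a\<in>P. insert a ` C a)" for \<rho>
    using that by (elim UnE UN_E imageE) (auto simp: image_iff)
  then show "(laminar_families V' \<union> (\<Union>a\<in>P. insert a ` C a)) \<inter> (\<Union>a\<in>P. insert a ` X a) = {}"
    by (simp add: disjoint_iff)
  fix \<sigma> \<tau> assume "\<sigma> \<in> (\<Union>a\<in>P. insert a ` X a)" and "\<tau> \<subset> \<sigma>"
  then obtain a \<rho> where a: "a \<in> P" "\<rho> \<in> X a" "\<sigma> = insert a \<rho>" by blast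
  \<comment> \<open>A proper face of the cell \<open>insert a \<rho>\<close> either misses
    \<open>a\<close> and lies in \<open>laminar_families V'\<close>, or contains \<open>a\<close>
    and lies over a proper face of \<open>\<rho>\<close>, which belongs to
    \<open>C a\<close>.\<close>
  have "\<tau> \<subseteq> insert a \<rho>" using \<open>\<tau> \<subset> \<sigma>\<close> a by blast
  then show "\<tau> \<in> laminar_families V' \<union> (\<Union>a\<in>P. insert a ` C a)"
  proof (cases rule: subset_insert_cases)
    case 1
    moreover have "\<rho> \<in> laminar_families V'" using sub[OF a(1)] a(2) by blast
    ultimately have "\<tau> \<in> laminar_families V'"
      using 1(2) unfolding laminar_families_def by blast
    then show ?thesis by simp
  next
    case (2 \<rho>')
    then have "\<rho>' \<subset> \<rho>" using \<open>\<tau> \<subset> \<sigma>\<close> a by blast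
    then have "\<rho>' \<in> C a" using link[OF a(1)] a(2) by (auto simp: near_collapsible_def)
    then show ?thesis using a(1) 2 by blast
  qed
qed

section \<open>Clusters of blocks\<close>

text \<open>With blocks instead of single marks, the link of a cluster is described by fusing the cluster
  to one block, without renaming anything.\<close>

definition blocks :: "nat set set \<Rightarrow> bool" where
  "blocks M \<longleftrightarrow> finite M \<and> (\<forall>b\<in>M. finite b \<and> b \<noteq> {}) \<and> disjoint M"

text \<open>Fused blocks weigh more than 1 and are kept out by \<open>A \<notin> M\<close>, as they
  should be: in the link of a cluster, this cluster is no vertex. The condition
  \<open>A \<noteq> \<Union>M\<close> reflects the mark at the root.\<close>

definition clusters :: "nat set set \<Rightarrow> (nat \<Rightarrow> real) \<Rightarrow> nat set set" where
  "clusters M w = {A. A \<subseteq> \<Union>M \<and> (\<forall>b\<in>M. b \<subseteq> A \<or> b \<inter> A = {}) \<and> A \<notin> M \<and> A \<noteq> \<Union>M \<and> 1 < sum w A}"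

lemma blocksD:
  assumes "blocks M"
  shows "finite M" "finite (\<Union>M)" "b \<in> M \<Longrightarrow> b \<noteq> {}" "b \<in> M \<Longrightarrow> finite b"
    "b \<in> M \<Longrightarrow> c \<in> M \<Longrightarrow> b \<noteq> c \<Longrightarrow> b \<inter> c = {}"
  using assms by (auto simp: blocks_def disjoint_def)

lemma clustersD:
  assumes "A \<in> clusters M w"
  shows "A \<subseteq> \<Union>M" "b \<in> M \<Longrightarrow> b \<subseteq> A \<or> b \<inter> A = {}" "A \<notin> M" "A \<noteq> \<Union>M" "1 < sum w A" "A \<noteq> {}"
  using assms by (auto simp: clusters_def)

lemma finite_clusters: "blocks M \<Longrightarrow> finite (clusters M w)"
  by (rule finite_subset[of _ "Pow (\<Union>M)"]) (auto simp: clusters_def dest: blocksD(2))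

text \<open>A cluster containing \<open>y\<close> and compatible with the complement of
  \<open>y\<close> would have to be \<open>y\<close> itself or everything, and neither is a
  cluster.\<close>

lemma link_verts_Diff_block:
  assumes M: "blocks M" and y: "y \<in> M"
  shows "link_verts (clusters M w) (\<Union>M - y) = clusters (M - {y}) w"
proof -
  have U: "\<Union>(M - {y}) = \<Union>M - y"
    using blocksD(5)[OF M _ y] by blast
  have ne: "y \<noteq> {}" using blocksD[OF M] y by blast
  show ?thesis
  proof (intro equalityI subsetI)
    fix v assume "v \<in> link_verts (clusters M w) (\<Union>M - y)"
    then have v: "v \<in> clusters M w" "v \<noteq> \<Union>M - y" "compat v (\<Union>M - y)"
      by (auto simp: link_verts_def)
    have "y \<inter> v = {}"
    proof (rule ccontr)
      assume "y \<inter> v \<noteq> {}"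
      then have "y \<subseteq> v" using clustersD(2)[OF v(1) y] by blast
      then have "v = y \<or> v = \<Union>M"
        using v(3) clustersD(1)[OF v(1)] ne unfolding compat_def by blast
      then show False using clustersD[OF v(1)] y by blast
    qed
    then show "v \<in> clusters (M - {y}) w"
      using v clustersD[OF v(1)] unfolding clusters_def U by blast
  next
    fix v assume v: "v \<in> clusters (M - {y}) w"
    note vD = clustersD[OF v, unfolded U]
    have "v \<notin> M" using vD(1,3,6) by blast
    moreover have "\<forall>b\<in>M. b \<subseteq> v \<or> b \<inter> v = {}"
    proof
      fix b assume "b \<in> M"
      show "b \<subseteq> v \<or> b \<inter> v = {}"
        using vD(2)[of b] vD(1) \<open>b \<in> M\<close> by (cases "b = y") auto
    qed
    moreover have "v \<noteq> \<Union>M" using vD(1) y ne by blast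
    ultimately show "v \<in> link_verts (clusters M w) (\<Union>M - y)"
      using vD(1,4,5) unfolding link_verts_def clusters_def compat_def by blast
  qed
qed

text \<open>With no cluster inside \<open>B\<close>, a cluster compatible with \<open>B\<close>
  contains it or avoids it, so \<open>B\<close> behaves as one block. That blocks are no clusters
  takes out \<open>B\<close> itself, as the link does.\<close>

lemma link_verts_minimal_cluster:
  assumes M: "blocks M" and B: "B \<in> clusters M w"
    and minimal: "\<And>v. v \<in> clusters M w \<Longrightarrow> \<not> v \<subset> B"
  defines "M' \<equiv> insert B {b \<in> M. b \<inter> B = {}}"
  shows "link_verts (clusters M w) B = clusters M' w" "\<Union>M' = \<Union>M"
proof -
  note BD = clustersD[OF B]
  show U: "\<Union>M' = \<Union>M"
  proof
    show "\<Union>M' \<subseteq> \<Union>M" using BD(1) unfolding M'_def by blast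
    show "\<Union>M \<subseteq> \<Union>M'" using BD(2) unfolding M'_def by blast
  qed
  show "link_verts (clusters M w) B = clusters M' w"
  proof (intro equalityI subsetI)
    fix v assume "v \<in> link_verts (clusters M w) B"
    then have v: "v \<in> clusters M w" "v \<noteq> B" "compat v B"
      by (auto simp: link_verts_def)
    have "B \<subseteq> v \<or> B \<inter> v = {}"
      using v minimal[OF v(1)] unfolding compat_def by blast
    then show "v \<in> clusters M' w"
      using clustersD[OF v(1)] v(2) unfolding clusters_def mem_Collect_eq U unfolding M'_def by blast
  next
    fix v assume v: "v \<in> clusters M' w"
    note vD = clustersD[OF v, unfolded U]
    have B_v: "B \<subseteq> v \<or> B \<inter> v = {}" and "v \<noteq> B"
      using vD(2)[of B] vD(3) unfolding M'_def by blast+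
    have "v \<notin> M"
      using vD(3,6) BD(2)[of v] B_v \<open>v \<noteq> B\<close> unfolding M'_def by blast
    moreover have "\<forall>b\<in>M. b \<subseteq> v \<or> b \<inter> v = {}"
    proof
      fix b assume b: "b \<in> M"
      show "b \<subseteq> v \<or> b \<inter> v = {}"
        using vD(2)[of b] BD(2)[OF b] b B_v unfolding M'_def by blast
    qed
    ultimately show "v \<in> link_verts (clusters M w) B"
      using vD(1,4,5) B_v \<open>v \<noteq> B\<close> unfolding link_verts_def clusters_def compat_def by blast
  qed
qed

text \<open>A cluster is no block, hence a union of at least two blocks. The main induction runs on
  the number of blocks.\<close>

lemma blocks_fuse:
  assumes M: "blocks M" and B: "B \<in> clusters M w"
  defines "M' \<equiv> insert B {b \<in> M. b \<inter> B = {}}"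
  shows "blocks M'" "card M' < card M"
proof -
  note BD = clustersD[OF B]
  have "finite B" using BD(1) blocksD(2)[OF M] finite_subset by blast
  then show "blocks M'"
    using M BD(6) unfolding blocks_def M'_def disjoint_def by auto
  obtain i where i: "i \<in> B" using BD(6) by blast
  then obtain b where b: "b \<in> M" "i \<in> b" using BD(1) by blast
  then have "b \<subset> B" using BD(2)[OF b(1)] BD(3) i by blast
  then obtain j where j: "j \<in> B" "j \<notin> b" by blast
  then obtain c where c: "c \<in> M" "j \<in> c" using BD(1) by blast
  have "{b \<in> M. b \<inter> B = {}} \<subseteq> M - {b, c}" using b c i j by blast
  then have "card {b \<in> M. b \<inter> B = {}} \<le> card (M - {b, c})"
    using blocksD(1)[OF M] by (intro card_mono) auto
  also have "card (M - {b, c}) = card M - 2"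
  proof -
    have "card {b, c} = 2" using c j by (auto simp: card_2_iff)
    then show ?thesis using b c by (subst card_Diff_subset) auto
  qed
  finally have "card {b \<in> M. b \<inter> B = {}} \<le> card M - 2" .
  moreover have "2 \<le> card M"
  proof -
    have "card {b, c} = 2" using c j by (auto simp: card_2_iff)
    then show ?thesis using card_mono[OF blocksD(1)[OF M], of "{b, c}"] b c by simp
  qed
  ultimately show "card M' < card M"
    unfolding M'_def using card_insert_le_m1[of "card M - 1" "{b \<in> M. b \<inter> B = {}}" B] by linarith
qed

text \<open>A larger set is still heavy enough; the only danger is to reach
  \<open>\<Union>M\<close>, which happens for \<open>A = \<Union>M - y\<close>.\<close>

lemma clusters_Un_block:
  assumes M: "blocks M" and w: "\<forall>i\<in>\<Union>M. 0 < w i"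
    and A: "A \<in> clusters M w" and y: "y \<in> M" "\<not> y \<subseteq> A" "A \<noteq> \<Union>M - y"
  shows "A \<union> y \<in> clusters M w"
proof -
  note AD = clustersD[OF A]
  have disj: "y \<inter> A = {}" using AD(2) y by blast
  have "b \<subseteq> A \<union> y \<or> b \<inter> (A \<union> y) = {}" if "b \<in> M" for b
    using AD(2)[OF that] blocksD(5)[OF M that y(1)] by blast
  moreover have "A \<union> y \<notin> M"
  proof
    assume "A \<union> y \<in> M"
    then have "A \<union> y = y" using blocksD(5)[OF M _ y(1)] blocksD(3)[OF M y(1)] by blast
    then show False using AD(6) disj by blast
  qed
  moreover have "A \<union> y \<noteq> \<Union>M" using y disj by blast
  moreover have "sum w A \<le> sum w (A \<union> y)"
  proof (rule sum_mono2)
    have sub: "A \<union> y \<subseteq> \<Union>M" using AD(1) y(1) by blast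
    then show "finite (A \<union> y)" using blocksD(2)[OF M] finite_subset by blast
    show "0 \<le> w b" if "b \<in> A \<union> y - A" for b
      using that sub w by (meson DiffD1 less_imp_le subsetD)
  qed simp
  then have "1 < sum w (A \<union> y)" using AD(5) by linarith
  moreover have "A \<union> y \<subseteq> \<Union>M" using AD(1) y(1) by blast
  ultimately show ?thesis unfolding clusters_def by blast
qed

text \<open>The last hypothesis holds because \<open>y\<close> is lightest: exchanging \<open>y\<close> in \<open>B\<close> for a block of \<open>B'\<close>
  does not decrease the weight.\<close>

lemma clusters_Diff_lightest:
  assumes M: "blocks M" and w: "\<forall>i\<in>\<Union>M. 0 < w i"
    and B: "B \<in> clusters M w" "y \<subseteq> B" and B': "B' \<in> clusters M w" "B \<subset> B'"
    and y: "y \<in> M" and light: "\<And>b. b \<in> M \<Longrightarrow> b \<subseteq> B' \<Longrightarrow> sum w y \<le> sum w b"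
  shows "B' - y \<in> clusters M w"
proof -
  note BD = clustersD[OF B(1)] and B'D = clustersD[OF B'(1)]
  have fin: "finite B'" using B'D(1) blocksD(2)[OF M] finite_subset by blast
  obtain i where i: "i \<in> B'" "i \<notin> B" using B'(2) by blast
  then obtain z where z: "z \<in> M" "i \<in> z" using B'D(1) by blast
  have zB': "z \<subseteq> B'" and zB: "z \<inter> B = {}"
    using B'D(2)[OF z(1)] BD(2)[OF z(1)] i z(2) by blast+
  have "sum w B = sum w (B - y) + sum w y"
    using fin B(2) B'(2) by (metis finite_subset psubset_imp_subset sum.subset_diff)
  also have "\<dots> \<le> sum w (B - y) + sum w z" using light[OF z(1) zB'] by simp
  also have "\<dots> = sum w ((B - y) \<union> z)"
    using fin zB B'(2) blocksD(4)[OF M z(1)]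
    by (intro sum.union_disjoint[symmetric]) (auto intro: finite_subset)
  also have "\<dots> \<le> sum w (B' - y)"
  proof (rule sum_mono2)
    show "(B - y) \<union> z \<subseteq> B' - y" using B'(2) B(2) zB zB' by blast
    show "0 \<le> w b" if "b \<in> B' - y - ((B - y) \<union> z)" for b
      using that B'D(1) w by (meson DiffD1 less_imp_le subsetD)
  qed (use fin in simp)
  finally have "1 < sum w (B' - y)" using BD(5) by linarith
  moreover have "b \<subseteq> B' - y \<or> b \<inter> (B' - y) = {}" if "b \<in> M" for b
    using B'D(2)[OF that] blocksD(5)[OF M that y] by blast
  \<comment> \<open>If \<open>B' - y\<close> were a block it would be \<open>z\<close>. As
    \<open>B\<close> avoids \<open>z\<close>, this leaves \<open>B = y\<close>, which is no
    cluster.\<close>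
  moreover have "B' - y \<notin> M"
  proof
    assume "B' - y \<in> M"
    moreover have "i \<in> B' - y" using i B(2) by blast
    ultimately have "z = B' - y" using z blocksD(5)[OF M z(1)] by blast
    moreover have "B \<noteq> y" using BD(3) y by blast
    ultimately show False using zB B(2) B'(2) by blast
  qed
  moreover have "B' - y \<noteq> \<Union>M" using y blocksD(3)[OF M y] by blast
  ultimately show ?thesis using B'D(1) unfolding clusters_def by blast
qed

text \<open>The clusters not separating \<open>h\<close> from \<open>y\<close> form a cone with apex
  \<open>h \<union> y\<close>. A cluster \<open>a\<close> separating them is dominated by the set
  with \<open>y\<close> moved to the side of \<open>h\<close>, which is \<open>a \<union> y\<close>
  if \<open>h\<close> lies in \<open>a\<close> and \<open>a - y\<close> otherwise. The clusters left
  out of the complex are those for which this set is no cluster.\<close>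

lemma collapsible_noncritical:
  assumes M: "blocks M" and w: "\<forall>i\<in>\<Union>M. 0 < w i" and h: "h \<in> M" "1 \<le> sum w h"
    and y: "y \<in> M" "y \<noteq> h" and M3: "3 \<le> card M"
  shows "collapsible (laminar_families {A \<in> clusters M w. A \<noteq> \<Union>M - y \<and>
           (y \<subseteq> A \<longrightarrow> \<not> h \<subseteq> A \<longrightarrow> A - y \<in> clusters M w)})"
    (is "collapsible (laminar_families ?V')")
proof -
  define V where "V = clusters M w"
  define V2 where "V2 = {A \<in> V. h \<subseteq> A \<longleftrightarrow> y \<subseteq> A}"
  define U1 where "U1 = {A \<in> V. h \<subseteq> A \<and> \<not> y \<subseteq> A \<and> A \<noteq> \<Union>M - y}"
  define U2 where "U2 = {A \<in> V. y \<subseteq> A \<and> \<not> h \<subseteq> A \<and> A - y \<in> V}"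
  have finV: "finite V" unfolding V_def by (rule finite_clusters[OF M])
  have hy: "h \<inter> y = {}" and hne: "h \<noteq> {}" and yne: "y \<noteq> {}"
    using blocksD[OF M] h y by blast+
  have in_h: "h \<subseteq> A \<or> h \<inter> A = {}" and in_y: "y \<subseteq> A \<or> y \<inter> A = {}" if "A \<in> V" for A
    using clustersD(2)[OF that[unfolded V_def]] h(1) y(1) by simp_all
  have fin: "finite A" if "A \<in> V" for A
    using clustersD(1)[OF that[unfolded V_def]] blocksD(2)[OF M] finite_subset by blast

  \<comment> \<open>The heaviness of \<open>h\<close> enters here: any positive weight lifts it
    above 1. A third block keeps \<open>h \<union> y\<close> from being everything.\<close>
  have hy_V: "h \<union> y \<in> V"
  proof -
    obtain z where z: "z \<in> M" "z \<noteq> h" "z \<noteq> y"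
    proof -
      have "\<not> M \<subseteq> {h, y}"
        using card_mono[of "{h, y}" M] M3 y(2) by auto
      then show ?thesis using that by blast
    qed
    have "b \<subseteq> h \<union> y \<or> b \<inter> (h \<union> y) = {}" if "b \<in> M" for b
      using blocksD(5)[OF M that h(1)] blocksD(5)[OF M that y(1)] by blast
    moreover have "h \<union> y \<notin> M"
    proof
      assume a: "h \<union> y \<in> M"
      then have "h \<union> y = h" using blocksD(5)[OF M a h(1)] hne by blast
      then show False using hy yne by blast
    qed
    moreover have "h \<union> y \<noteq> \<Union>M"
      using blocksD(5)[OF M z(1) h(1) z(2)] blocksD(5)[OF M z(1) y(1) z(3)] blocksD(3)[OF M z(1)] z(1)
      by blast
    moreover have "1 < sum w (h \<union> y)"
    proof -
      have "0 < sum w y"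
        using w y blocksD[OF M] by (intro sum_pos) auto
      then show ?thesis
        using h(2) sum.union_disjoint[of h y w] hy blocksD(4)[OF M] h(1) y(1) by simp
    qed
    ultimately show ?thesis using h(1) y(1) unfolding V_def clusters_def by blast
  qed

  have V2: "collapsible (laminar_families V2)"
  proof (rule collapsible_laminar_families_cone)
    show "finite V2" using finV by (simp add: V2_def)
    show "h \<union> y \<in> V2" using hy_V by (simp add: V2_def)
    show "compat v (h \<union> y)" if "v \<in> V2" for v
      using that in_h in_y unfolding V2_def compat_def by blast
  qed
  \<comment> \<open>Small clusters enter first. Members of \<open>U1\<close> share \<open>h\<close>,
    so compatible ones are nested, and an earlier \<open>u\<close> lies inside \<open>a\<close> and
    thus inside \<open>a \<union> y\<close>.\<close>
  have V1: "collapsible (laminar_families (V2 \<union> U1))"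
  proof (rule collapsible_laminar_families_dominated[where f = card, OF _ V2])
    fix a assume "a \<in> U1"
    then have a: "a \<in> V" "h \<subseteq> a" "\<not> y \<subseteq> a" "a \<noteq> \<Union>M - y" by (auto simp: U1_def)
    have ya: "y \<inter> a = {}" using in_y a by blast
    have "a \<union> y \<in> V"
      using clusters_Un_block[OF M w _ y(1)] a unfolding V_def by blast
    then have b: "a \<union> y \<in> V2" using a by (auto simp: V2_def)
    moreover have "compat v (a \<union> y)" if "v \<in> V2" "compat v a" for v
    proof (cases "h \<subseteq> v")
      case True
      then show ?thesis using that ya a(2) hne yne unfolding V2_def compat_def by blast
    next
      case False
      then have "y \<inter> v = {}" using that in_y unfolding V2_def by blast
      then show ?thesis using that(2) False a(2) unfolding compat_def by blast
    qed
    moreover have "compat u (a \<union> y)" if "u \<in> U1" "card u \<le> card a" "compat u a" for u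
    proof -
      have "h \<subseteq> u" "u \<in> V" using that by (auto simp: U1_def)
      then have "u \<subseteq> a \<or> a \<subseteq> u" using that(3) a(2) hne unfolding compat_def by blast
      then have "u \<subseteq> a"
        using card_seteq[OF fin[OF \<open>u \<in> V\<close>], of a] that(2) by blast
      then show ?thesis by (auto simp: compat_def)
    qed
    ultimately show "\<exists>b\<in>V2. compat b a \<and> (\<forall>v\<in>V2. compat v a \<longrightarrow> compat v b) \<and>
        (\<forall>u\<in>U1. u \<noteq> a \<longrightarrow> card u \<le> card a \<longrightarrow> compat u a \<longrightarrow> compat u b)"
      by (intro bexI[OF _ b]) (auto simp: compat_def)
  qed (use finV in \<open>auto simp: V2_def U1_def\<close>)
  \<comment> \<open>Now large clusters enter first: members of \<open>U2\<close> share
    \<open>y\<close>, and an earlier \<open>u\<close> contains \<open>a\<close>. The subtraction of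
    cardinalities is exact because clusters are subsets of \<open>\<Union>M\<close>.\<close>
  have "collapsible (laminar_families ((V2 \<union> U1) \<union> U2))"
  proof (rule collapsible_laminar_families_dominated[where f = "\<lambda>A. card (\<Union>M) - card A", OF _ V1])
    fix a assume "a \<in> U2"
    then have a: "a \<in> V" "y \<subseteq> a" "\<not> h \<subseteq> a" "a - y \<in> V" by (auto simp: U2_def)
    have "h \<inter> a = {}" using in_h a by blast
    then have b: "a - y \<in> V2 \<union> U1" using a yne hne by (auto simp: V2_def)
    moreover have "compat v (a - y)" if v: "v \<in> V2 \<union> U1" "compat v a" for v
    proof -
      have vy: "v \<in> V" "h \<subseteq> v \<or> y \<inter> v = {}" using that in_y by (auto simp: V2_def U1_def)
      show ?thesis
        using v(2) vy(2) a(3) unfolding compat_def by blast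
    qed
    moreover have "compat u (a - y)"
      if "u \<in> U2" "card (\<Union>M) - card u \<le> card (\<Union>M) - card a" "compat u a" for u
    proof -
      have u: "y \<subseteq> u" "u \<in> V" using that by (auto simp: U2_def)
      then have "u \<subseteq> a \<or> a \<subseteq> u" using that(3) a(2) yne unfolding compat_def by blast
      moreover have "card a \<le> card u"
      proof -
        have "card a \<le> card (\<Union>M)" using a(1) clustersD(1) unfolding V_def
          by (intro card_mono blocksD(2)[OF M]) blast
        then show ?thesis using that(2) by linarith
      qed
      ultimately have "a \<subseteq> u"
        using card_seteq[OF fin[OF a(1)], of u] by blast
      then show ?thesis by (auto simp: compat_def)
    qed
    ultimately show "\<exists>b\<in>V2 \<union> U1. compat b a \<and> (\<forall>v\<in>V2 \<union> U1. compat v a \<longrightarrow> compat v b) \<and>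
        (\<forall>u\<in>U2. u \<noteq> a \<longrightarrow> card (\<Union>M) - card u \<le> card (\<Union>M) - card a \<longrightarrow> compat u a \<longrightarrow> compat u b)"
      by (intro bexI[OF _ b]) (auto simp: compat_def)
  qed (use finV in \<open>auto simp: V2_def U1_def U2_def\<close>)
  moreover have "?V' = (V2 \<union> U1) \<union> U2"
  proof -
    have "h \<subseteq> \<Union>M - y" "\<not> y \<subseteq> \<Union>M - y" using h(1) hy yne by blast+
    then have "\<Union>M - y \<notin> V2 \<union> U2" unfolding V2_def U2_def by simp
    moreover have "A \<in> V2 \<or> A \<in> U1 \<or> A \<in> U2 \<longleftrightarrow>
        A \<in> V \<and> A \<noteq> \<Union>M - y \<and> (y \<subseteq> A \<longrightarrow> \<not> h \<subseteq> A \<longrightarrow> A - y \<in> V)"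
      if "\<Union>M - y \<notin> V2 \<union> U2" for A
      using that unfolding V2_def U1_def U2_def Un_iff mem_Collect_eq by metis
    ultimately show ?thesis
      unfolding V_def[symmetric] set_eq_iff Un_iff mem_Collect_eq by (simp only: disj_assoc simp_thms)
  qed
  ultimately show ?thesis by (simp only:)
qed

text \<open>The claims on cardinalities carry the dimensions of the spheres. The exact value is
  inherited through the link of \<open>\<Union>M - y\<close>, where just one block is lost; fusing
  may lose more and passes on only the bound. The last claim excludes a void \<open>C\<close>, which
  could not be collapsed to a base point.\<close>

theorem near_collapsible_clusters:
  assumes "blocks M" "\<forall>i\<in>\<Union>M. 0 < w i" "h \<in> M" "1 \<le> sum w h" "2 \<le> card M"
  shows "\<exists>C X. near_collapsible (laminar_families (clusters M w)) C X \<and>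
           (\<forall>\<sigma>\<in>X. card \<sigma> \<le> card M - 2) \<and> (\<exists>\<sigma>\<in>X. card \<sigma> = card M - 2) \<and> (3 \<le> card M \<longrightarrow> C \<noteq> {})"
  using assms
proof (induction "card M" arbitrary: M rule: less_induct)
  case less
  note M = \<open>blocks M\<close> and w = less.prems(2) and h = less.prems(3,4)
  define V where "V = clusters M w"
  have finM: "finite M" using blocksD(1)[OF M] .
  show ?case
  proof (cases "card M = 2")
    case True
    \<comment> \<open>Two blocks leave no room for a proper cluster. The complex \<open>{{}}\<close>
      is the sphere of dimension -1, and its only cell is the empty face.\<close>
    then obtain y where y: "M = {h, y}" "h \<noteq> y"
      using h(1) by (auto simp: card_2_iff)
    have "clusters M w = {}"
    proof (rule equals0I)
      fix A assume A: "A \<in> clusters M w"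
      have "h \<subseteq> A \<or> h \<inter> A = {}" "y \<subseteq> A \<or> y \<inter> A = {}"
        using clustersD(2)[OF A] y by blast+
      moreover have "A \<subseteq> h \<union> y" using clustersD(1)[OF A] y by simp
      ultimately have "A = {} \<or> A = h \<or> A = y \<or> A = h \<union> y" by blast
      then show False using clustersD[OF A] y by auto
    qed
    then have "laminar_families (clusters M w) = {{}}"
      by (auto simp: laminar_families_def)
    then have "near_collapsible (laminar_families (clusters M w)) {} {{}}"
      by (auto simp: near_collapsible_def collapsible.void)
    then show ?thesis using True by (intro exI[of _ "{}"] exI[of _ "{{}}"]) auto
  next
    case False
    then have M3: "3 \<le> card M" using less.prems(5) by simp
    have "M - {h} \<noteq> {}"
    proof
      assume "M - {h} = {}"
      then have "card M \<le> card {h}" by (intro card_mono) auto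
      then show False using M3 by simp
    qed
    \<comment> \<open>\<open>y\<close> competes only with the blocks other than \<open>h\<close>,
      which suffices because critical clusters avoid \<open>h\<close>.\<close>
    then obtain y where y: "y \<in> M" "y \<noteq> h"
      and light: "\<And>b. b \<in> M \<Longrightarrow> b \<noteq> h \<Longrightarrow> sum w y \<le> sum w b"
      using ex_is_arg_min_if_finite[of "M - {h}" "sum w"] finM
      by (auto simp: is_arg_min_linorder)
    define crit where "crit = {B \<in> V. y \<subseteq> B \<and> \<not> h \<subseteq> B \<and> B - y \<notin> V}"
    define P where "P = insert (\<Union>M - y) crit"
    define V' where "V' = {A \<in> V. A \<noteq> \<Union>M - y \<and> (y \<subseteq> A \<longrightarrow> \<not> h \<subseteq> A \<longrightarrow> A - y \<in> V)}"
    have hne: "h \<noteq> {}" and yne: "y \<noteq> {}" and hy: "h \<inter> y = {}"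
      using blocksD[OF M] h y by blast+
    have a0: "\<Union>M - y \<in> V"
    proof -
      obtain z where z: "z \<in> M" "z \<noteq> h" "z \<noteq> y"
      proof -
        have "\<not> M \<subseteq> {h, y}"
          using card_mono[of "{h, y}" M] M3 y(2) by auto
        then show ?thesis using that by blast
      qed
      have zh: "z \<inter> h = {}" "z \<inter> y = {}" "z \<noteq> {}" using blocksD[OF M] z h y by blast+
      have "\<Union>M - y \<notin> M"
      proof
        assume a: "\<Union>M - y \<in> M"
        then have "\<Union>M - y = h" using blocksD(5)[OF M a h(1)] hne hy h(1) by blast
        then show False using z zh by blast
      qed
      moreover have "1 < sum w (\<Union>M - y)"
      proof -
        have "0 < sum w z" using w z zh blocksD[OF M] by (intro sum_pos) auto
        moreover have "sum w (h \<union> z) \<le> sum w (\<Union>M - y)"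
          using blocksD(2)[OF M] w zh z h(1) hy by (intro sum_mono2) (auto intro: less_imp_le)
        moreover have "sum w (h \<union> z) = sum w h + sum w z"
          using blocksD(4)[OF M] h(1) z(1) zh by (intro sum.union_disjoint) auto
        ultimately show ?thesis using h(2) by linarith
      qed
      moreover have "b \<subseteq> \<Union>M - y \<or> b \<inter> (\<Union>M - y) = {}" if "b \<in> M" for b
        using blocksD(5)[OF M that y(1)] that by blast
      moreover have "\<Union>M - y \<noteq> \<Union>M" using y yne by blast
      ultimately show ?thesis unfolding V_def clusters_def by blast
    qed
    have V'P: "V = V' \<union> P" "V' \<inter> P = {}"
      using a0 unfolding V'_def P_def crit_def by blast+
    have h_crit: "h \<inter> B = {}" if "B \<in> crit" for B
    proof -
      have "B \<in> clusters M w" "\<not> h \<subseteq> B" using that by (auto simp: crit_def V_def)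
      then show ?thesis using clustersD(2)[OF _ h(1)] by auto
    qed
    \<comment> \<open>Minimality has two uses: critical clusters all contain \<open>y\<close>, so
      compatible ones would be nested; and it allows the link to be described by fusing. If
      \<open>v\<close> contains \<open>y\<close>, the exchange argument makes \<open>B - y\<close> a
      cluster; otherwise \<open>v\<close> lies in \<open>B - y\<close> and makes it heavy
      enough.\<close>
    have minimal: "\<not> v \<subset> B" if B: "B \<in> crit" and v: "v \<in> V" for B v
    proof
      assume vB: "v \<subset> B"
      have yB: "y \<subseteq> B" "B \<in> V" "B - y \<notin> V" using B by (auto simp: crit_def)
      show False
      proof (cases "y \<subseteq> v")
        case True
        have "B - y \<in> clusters M w"
        proof (rule clusters_Diff_lightest[OF M w _ True _ vB y(1)])
          fix b assume "b \<in> M" "b \<subseteq> B"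
          moreover from this have "b \<noteq> h" using h_crit[OF B] hne by blast
          ultimately show "sum w y \<le> sum w b" using light by blast
        qed (use v yB in \<open>auto simp: V_def\<close>)
        then show False using yB by (simp add: V_def)
      next
        case False
        then have "y \<inter> v = {}" using clustersD(2)[OF v[unfolded V_def] y(1)] by simp
        then have vBy: "v \<subseteq> B - y" using vB by blast
        have v': "v \<in> clusters M w" and B': "B \<in> clusters M w" using v yB by (auto simp: V_def)
        have finB: "finite B"
          using clustersD(1)[OF B'] blocksD(2)[OF M] finite_subset by blast
        have "sum w v \<le> sum w (B - y)"
        proof (rule sum_mono2)
          show "0 \<le> w b" if "b \<in> B - y - v" for b
            using that clustersD(1)[OF B'] w by (meson DiffD1 less_imp_le subsetD)
        qed (use finB vBy in auto)
        then have "1 < sum w (B - y)" using clustersD(5)[OF v'] by linarith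
        moreover have "b \<subseteq> B - y \<or> b \<inter> (B - y) = {}" if "b \<in> M" for b
          using clustersD(2)[OF B' that] blocksD(5)[OF M that y(1)] by blast
        moreover have "B - y \<notin> M"
        proof
          assume a: "B - y \<in> M"
          then have "v = B - y"
            using clustersD(2)[OF v', of "B - y"] clustersD(6)[OF v'] a vBy by blast
          then show False using a clustersD(3)[OF v'] by simp
        qed
        moreover have "B - y \<noteq> \<Union>M" using y yne by blast
        ultimately have "B - y \<in> V" using clustersD(1)[OF B'] unfolding V_def clusters_def by blast
        then show False using yB by simp
      qed
    qed
    \<comment> \<open>\<open>B\<close> contains \<open>y\<close> and misses \<open>h\<close>, so the
      two sets could only be disjoint, which forces \<open>B = y\<close>.\<close>
    have incompat0: "\<not> compat B (\<Union>M - y)" if B: "B \<in> crit" for B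
    proof
      assume "compat B (\<Union>M - y)"
      moreover have "y \<subseteq> B" "B \<in> clusters M w" using B by (auto simp: crit_def V_def)
      moreover have "\<not> \<Union>M - y \<subseteq> B" using h_crit[OF B] hne hy h(1) by blast
      moreover have "\<not> B \<subseteq> \<Union>M - y" using \<open>y \<subseteq> B\<close> yne by blast
      ultimately have "B = y" using clustersD(1)[of B M w] unfolding compat_def by blast
      then show False using clustersD(3)[OF \<open>B \<in> clusters M w\<close>] y by simp
    qed
    have indep: "\<not> compat a b" if "a \<in> P" "b \<in> P" "a \<noteq> b" for a b
    proof -
      have "\<not> compat a b" if "a \<in> crit" "b \<in> crit" "a \<noteq> b" for a b
      proof
        assume "compat a b"
        moreover have "y \<subseteq> a" "y \<subseteq> b" "a \<in> V" "b \<in> V" using that by (auto simp: crit_def)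
        ultimately have "a \<subset> b \<or> b \<subset> a" using that(3) yne unfolding compat_def by blast
        then show False using minimal that \<open>a \<in> V\<close> \<open>b \<in> V\<close> by blast
      qed
      then show ?thesis using that incompat0 compat_sym unfolding P_def by blast
    qed
    have coll: "collapsible (laminar_families V')"
      unfolding V'_def V_def by (rule collapsible_noncritical[OF M w h y M3])

    have ex0: "\<exists>C X. near_collapsible (laminar_families (link_verts V (\<Union>M - y))) C X \<and>
           (\<forall>\<sigma>\<in>X. card \<sigma> \<le> card M - 3) \<and> (\<exists>\<sigma>\<in>X. card \<sigma> = card M - 3)"
    proof -
      have c: "card (M - {y}) = card M - 1" using y finM by simp
      have bl: "blocks (M - {y})" using M by (auto simp: blocks_def disjoint_def)
      have "\<exists>C X. near_collapsible (laminar_families (clusters (M - {y}) w)) C X \<and>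
           (\<forall>\<sigma>\<in>X. card \<sigma> \<le> card (M - {y}) - 2) \<and> (\<exists>\<sigma>\<in>X. card \<sigma> = card (M - {y}) - 2) \<and>
           (3 \<le> card (M - {y}) \<longrightarrow> C \<noteq> {})"
        by (rule less.hyps) (use c bl M3 h y w in auto)
      then show ?thesis
        unfolding V_def link_verts_Diff_block[OF M y(1)] c by (auto simp: numeral_eq_Suc)
    qed
    \<comment> \<open>The block \<open>h\<close> survives the fusion since \<open>B\<close> avoids
      it, and \<open>B\<close> is a second block beside it, so the induction hypothesis applies to
      the fused blocks.\<close>
    have exB: "\<exists>C X. near_collapsible (laminar_families (link_verts V B)) C X \<and>
           (\<forall>\<sigma>\<in>X. card \<sigma> \<le> card M - 3)" if B: "B \<in> crit" for B
    proof -
      define M' where "M' = insert B {b \<in> M. b \<inter> B = {}}"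
      have B': "B \<in> clusters M w" using B by (auto simp: crit_def V_def)
      note fuse = blocks_fuse[OF M B', folded M'_def]
      have "\<not> v \<subset> B" if "v \<in> clusters M w" for v
        using minimal[OF B] that by (simp add: V_def)
      from link_verts_minimal_cluster[OF M B' this]
      have link: "link_verts V B = clusters M' w" "\<Union>M' = \<Union>M"
        by (simp_all add: V_def M'_def)
      have hM': "h \<in> M'" using h_crit[OF B] h(1) by (simp add: M'_def)
      have "B \<noteq> h" using h_crit[OF B] hne by blast
      then have "card {B, h} \<le> card M'"
        using blocksD(1)[OF fuse(1)] hM' by (intro card_mono) (auto simp: M'_def)
      then have "2 \<le> card M'" using \<open>B \<noteq> h\<close> by simp
      then have "\<exists>C X. near_collapsible (laminar_families (clusters M' w)) C X \<and>
           (\<forall>\<sigma>\<in>X. card \<sigma> \<le> card M' - 2) \<and> (\<exists>\<sigma>\<in>X. card \<sigma> = card M' - 2) \<and>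
           (3 \<le> card M' \<longrightarrow> C \<noteq> {})"
        by (intro less.hyps) (use fuse hM' h w link(2) in auto)
      then obtain C X where CX: "near_collapsible (laminar_families (link_verts V B)) C X"
        "\<forall>\<sigma>\<in>X. card \<sigma> \<le> card M' - 2" unfolding link by blast
      moreover have "card M' - 2 \<le> card M - 3" using fuse(2) by linarith
      ultimately show ?thesis by (meson order_trans)
    qed
    have ex: "\<forall>a\<in>P. \<exists>C X. near_collapsible (laminar_families (link_verts V a)) C X \<and>
        (\<forall>\<sigma>\<in>X. card \<sigma> \<le> card M - 3) \<and> (a = \<Union>M - y \<longrightarrow> (\<exists>\<sigma>\<in>X. card \<sigma> = card M - 3))"
    proof
      fix a assume "a \<in> P"
      show "\<exists>C X. near_collapsible (laminar_families (link_verts V a)) C X \<and>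
        (\<forall>\<sigma>\<in>X. card \<sigma> \<le> card M - 3) \<and> (a = \<Union>M - y \<longrightarrow> (\<exists>\<sigma>\<in>X. card \<sigma> = card M - 3))"
      proof (cases "a = \<Union>M - y")
        case True
        then show ?thesis using ex0 by auto
      next
        case False
        then show ?thesis using exB[of a] \<open>a \<in> P\<close> by (auto simp: P_def)
      qed
    qed
    from bchoice[OF ex] obtain C where "\<forall>a\<in>P. \<exists>X. near_collapsible (laminar_families (link_verts V a)) (C a) X \<and>
        (\<forall>\<sigma>\<in>X. card \<sigma> \<le> card M - 3) \<and> (a = \<Union>M - y \<longrightarrow> (\<exists>\<sigma>\<in>X. card \<sigma> = card M - 3))" ..
    from bchoice[OF this] obtain X where X: "\<forall>a\<in>P. near_collapsible (laminar_families (link_verts V a)) (C a) (X a) \<and>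
        (\<forall>\<sigma>\<in>X a. card \<sigma> \<le> card M - 3) \<and> (a = \<Union>M - y \<longrightarrow> (\<exists>\<sigma>\<in>X a. card \<sigma> = card M - 3))" ..
    have a0P: "\<Union>M - y \<in> P" by (simp add: P_def)
    have CX: "\<And>a. a \<in> P \<Longrightarrow> near_collapsible (laminar_families (link_verts V a)) (C a) (X a)"
      "\<And>a \<sigma>. a \<in> P \<Longrightarrow> \<sigma> \<in> X a \<Longrightarrow> card \<sigma> \<le> card M - 3" "\<exists>\<sigma>\<in>X (\<Union>M - y). card \<sigma> = card M - 3"
      using X bspec[OF X a0P] by simp_all
    have finV: "finite V" unfolding V_def by (rule finite_clusters[OF M])
    have card_insert: "card (insert a \<sigma>) = Suc (card \<sigma>)" if "a \<in> P" "\<sigma> \<in> X a" for a \<sigma>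
    proof -
      have "\<sigma> \<in> laminar_families (link_verts V a)"
      proof -
        have "laminar_families (link_verts V a) = C a \<union> X a"
          using CX(1)[OF that(1)] by (simp only: near_collapsible_def)
        then show ?thesis using that(2) by blast
      qed
      then have "\<sigma> \<subseteq> V" "a \<notin> \<sigma>" by (auto simp: laminar_families_def link_verts_def)
      then show ?thesis using finite_subset[OF _ finV] by simp
    qed
    have "near_collapsible (laminar_families V)
        (laminar_families V' \<union> (\<Union>a\<in>P. insert a ` C a)) (\<Union>a\<in>P. insert a ` X a)"
      by (rule near_collapsible_laminar_families[OF V'P finV indep coll CX(1)])
    moreover have "\<forall>\<sigma>\<in>(\<Union>a\<in>P. insert a ` X a). card \<sigma> \<le> card M - 2"
    proof
      fix \<sigma> assume \<sigma>: "\<sigma> \<in> (\<Union>a\<in>P. insert a ` X a)"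
      obtain a \<rho> where "a \<in> P" "\<rho> \<in> X a" "\<sigma> = insert a \<rho>" using \<sigma> by blast
      then show "card \<sigma> \<le> card M - 2" using card_insert[of a \<rho>] CX(2)[of a \<rho>] M3 by simp
    qed
    moreover have "\<exists>\<sigma>\<in>(\<Union>a\<in>P. insert a ` X a). card \<sigma> = card M - 2"
    proof -
      obtain \<rho> where \<rho>: "\<rho> \<in> X (\<Union>M - y)" "card \<rho> = card M - 3" using CX(3) by blast
      have "\<Union>M - y \<in> P" by (simp add: P_def)
      moreover from this have "card (insert (\<Union>M - y) \<rho>) = card M - 2"
        using card_insert[OF _ \<rho>(1)] \<rho>(2) M3 by simp
      ultimately show ?thesis using \<rho>(1) by blast
    qed
    moreover have "{} \<in> laminar_families V'"
      by (simp add: laminar_families_def)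
    then have "laminar_families V' \<union> (\<Union>a\<in>P. insert a ` C a) \<noteq> {}" by blast
    ultimately show ?thesis unfolding V_def[symmetric] by blast
  qed
qed

section \<open>Geometric realization\<close>

definition supp :: "('v \<Rightarrow> real) \<Rightarrow> 'v set" where
  "supp x = {v. x v \<noteq> 0}"

text \<open>Barycentric coordinates are extended by 0 to the whole vertex type, so subcomplexes
  become subsets of one function space. The empty face carries no point, as an empty sum is not
  1.\<close>

definition realization :: "'v set set \<Rightarrow> ('v \<Rightarrow> real) set" where
  "realization K = {x. supp x \<in> K \<and> (\<forall>v. 0 \<le> x v) \<and> sum x (supp x) = 1}"

lemma sum_supp: "finite S \<Longrightarrow> supp x \<subseteq> S \<Longrightarrow> sum x (supp x) = sum x S"
  by (rule sum.mono_neutral_left) (auto simp: supp_def)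

lemma realizationD:
  assumes "x \<in> realization K"
  shows "supp x \<in> K" "0 \<le> x v" "sum x (supp x) = 1"
  using assms by (auto simp: realization_def)

lemma realization_mono: "K \<subseteq> L \<Longrightarrow> realization K \<subseteq> realization L"
  by (auto simp: realization_def)

lemma realizationI:
  assumes "finite S" "supp x \<subseteq> S" "supp x \<in> K" "\<And>v. 0 \<le> x v" "sum x S = 1"
  shows "x \<in> realization K"
  using assms sum_supp[of S x] by (simp add: realization_def)

lemma continuous_on_coordinate [continuous_intros]: "continuous_on S (\<lambda>x::'v \<Rightarrow> real. x u)"
  by (rule continuous_on_subset[OF continuous_on_product_coordinates]) simp

lemma continuous_on_Min [continuous_intros]:
  fixes f :: "'v \<Rightarrow> 'a::topological_space \<Rightarrow> real"
  assumes "finite T" "T \<noteq> {}" "\<And>u. u \<in> T \<Longrightarrow> continuous_on S (f u)"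
  shows "continuous_on S (\<lambda>x. Min ((\<lambda>u. f u x) ` T))"
  using assms
proof (induction rule: finite_ne_induct)
  case (insert u T)
  have "continuous_on S (\<lambda>x. min (f u x) (Min ((\<lambda>u. f u x) ` T)))"
    using insert by (intro continuous_on_min) auto
  then show ?case using insert by simp
qed simp

text \<open>The least coordinate over \<open>T\<close> measures the depth inside the open star of
  the face \<open>T\<close>. It drives the deformations below and also the map from a simplex to a
  sphere.\<close>

lemma Min_image_pos_iff:
  fixes x :: "'v \<Rightarrow> real"
  assumes "finite T" "T \<noteq> {}" "\<And>v. 0 \<le> x v"
  shows "0 \<le> Min (x ` T)" "Min (x ` T) = 0 \<longleftrightarrow> \<not> T \<subseteq> supp x"
proof -
  show ge: "0 \<le> Min (x ` T)" using assms by simp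
  have "0 < Min (x ` T) \<longleftrightarrow> (\<forall>u\<in>T. 0 < x u)" using assms by simp
  also have "\<dots> \<longleftrightarrow> T \<subseteq> supp x"
    using assms(3) by (auto simp: supp_def less_le)
  finally show "Min (x ` T) = 0 \<longleftrightarrow> \<not> T \<subseteq> supp x" using ge by linarith
qed

text \<open>The amount \<open>m x\<close> is drawn gradually from every vertex of
  \<open>\<tau>\<close> and given to \<open>v\<close>. Since \<open>m\<close> vanishes off the open
  star of \<open>\<tau>\<close>, points of \<open>K\<close> stay fixed; at \<open>t = 1\<close> some
  vertex of \<open>\<tau>\<close> has weight 0.\<close>

lemma elementary_collapse:
  fixes v :: 'v
  assumes K': "simplicial_complex K'" "K' = insert \<tau> (insert (insert v \<tau>) K)"
    and K: "simplicial_complex K" and v: "v \<notin> \<tau>" "\<tau> \<notin> K" "insert v \<tau> \<notin> K" "\<tau> \<noteq> {}"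
  shows "top_of_set (realization K') homotopy_equivalent_space top_of_set (realization K)"
proof -
  have fin: "finite \<tau>" using K' by (simp add: simplicial_complex_def)
  define m :: "('v \<Rightarrow> real) \<Rightarrow> real" where "m = (\<lambda>x. Min (x ` \<tau>))"
  \<comment> \<open>Each vertex of \<open>\<tau>\<close> gives one unit and \<open>v\<close>
    receives \<open>card \<tau>\<close> units, so the total is unchanged.\<close>
  define d where "d = (\<lambda>u. if u = v then real (card \<tau>) else if u \<in> \<tau> then -1 else 0)"
  define g where "g = (\<lambda>(t::real, x). \<lambda>u. x u + t * m x * d u)"
  have m_ge: "0 \<le> m x" and m0: "m x = 0 \<longleftrightarrow> \<not> \<tau> \<subseteq> supp x" if "x \<in> realization K'" for x
    using Min_image_pos_iff[OF fin v(4), of x] realizationD(2)[OF that] by (simp_all add: m_def)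
  have m_le: "m x \<le> x u" if "u \<in> \<tau>" for x u
    using that fin by (simp add: m_def)
  \<comment> \<open>Only points with support \<open>\<tau>\<close> or \<open>insert v \<tau>\<close>
    move, and for these the way towards \<open>v\<close> stays inside \<open>K'\<close>.\<close>
  have cofaces: "\<sigma> = \<tau> \<or> \<sigma> = insert v \<tau>" if "\<sigma> \<in> K'" "\<tau> \<subseteq> \<sigma>" for \<sigma>
    using that K'(2) v(2) simplicial_complexD(3)[OF K] by blast
  have g_id: "g (t, x) = x" if "m x = 0" for t x
    using that by (simp add: g_def)
  have sumd: "sum d (insert v \<tau>) = 0"
  proof -
    have "sum d \<tau> = (\<Sum>u\<in>\<tau>. -1)" using v(1) by (intro sum.cong) (auto simp: d_def)
    moreover have "d v = card \<tau>" by (simp add: d_def)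
    ultimately show ?thesis using fin v(1) by simp
  qed
  have pushed: "supp (g (t, x)) \<subseteq> insert v \<tau>" "\<And>u. 0 \<le> g (t, x) u" "sum (g (t, x)) (insert v \<tau>) = 1"
    if x: "x \<in> realization K'" and "0 < m x" and t: "t \<in> {0..1}" for t x
  proof -
    have "supp x = \<tau> \<or> supp x = insert v \<tau>"
      using cofaces[OF realizationD(1)[OF x]] m0[OF x] \<open>0 < m x\<close> by auto
    then have sx: "supp x \<subseteq> insert v \<tau>" by auto
    have d0: "d u = 0" if "u \<notin> insert v \<tau>" for u using that by (simp add: d_def)
    show "supp (g (t, x)) \<subseteq> insert v \<tau>"
      using sx d0 by (auto simp: supp_def g_def)
    show "0 \<le> g (t, x) u" for u
    proof (cases "u \<in> \<tau>")
      case True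
      have "t * m x \<le> m x" using t m_ge[OF x] by (simp add: mult_left_le_one_le)
      moreover have "d u = -1" using True v(1) by (auto simp: d_def)
      ultimately show ?thesis using m_le[OF True, of x] by (simp add: g_def)
    next
      case False
      then have "0 \<le> d u" by (simp add: d_def)
      then show ?thesis using realizationD(2)[OF x] t m_ge[OF x] by (simp add: g_def)
    qed
    have "sum (g (t, x)) (insert v \<tau>) = sum x (insert v \<tau>) + t * m x * sum d (insert v \<tau>)"
      by (simp add: g_def sum.distrib sum_distrib_left)
    also have "\<dots> = 1"
      using sumd sum_supp[of "insert v \<tau>" x] sx fin realizationD(3)[OF x] by simp
    finally show "sum (g (t, x)) (insert v \<tau>) = 1" .
  qed
  have g_K': "g (t, x) \<in> realization K'" if x: "x \<in> realization K'" and t: "t \<in> {0..1}" for t x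
  proof (cases "m x = 0")
    case False
    then have "0 < m x" using m_ge[OF x] by simp
    note p = pushed[OF x this t]
    have "supp (g (t, x)) \<in> K'" using p(1) K' simplicial_complexD(3)[OF K'(1)] by blast
    then show ?thesis using p fin by (intro realizationI[of "insert v \<tau>"]) auto
  qed (use x g_id in simp)
  have g_K: "g (1, x) \<in> realization K" if x: "x \<in> realization K'" for x
  proof -
    have "\<not> \<tau> \<subseteq> supp (g (1, x))"
    proof (cases "m x = 0")
      case True
      then show ?thesis using g_id[OF True] m0[OF x] by simp
    next
      case False
      have "Min (x ` \<tau>) \<in> x ` \<tau>" using fin v(4) by simp
      then obtain u where u: "u \<in> \<tau>" "x u = m x" by (auto simp: m_def)
      then have "g (1, x) u = 0" using v(1) by (auto simp: g_def d_def)
      then show ?thesis using u(1) by (auto simp: supp_def)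
    qed
    moreover have "g (1, x) \<in> realization K'" using g_K'[OF x] by simp
    ultimately show ?thesis using K'(2) by (auto simp: realization_def)
  qed
  have cont: "continuous_on S g" for S
  proof -
    have "continuous_on S (\<lambda>p. m (snd p))"
      unfolding m_def by (intro continuous_intros fin v(4))
        (rule continuous_on_compose2[OF continuous_on_product_coordinates]; auto intro: continuous_intros)
    then show ?thesis
      unfolding g_def case_prod_unfold
      by (intro continuous_intros)
        (rule continuous_on_compose2[OF continuous_on_product_coordinates]; auto intro: continuous_intros)
  qed
  have "homotopic_with (\<lambda>x. True) (top_of_set (realization K')) (top_of_set (realization K')) id (\<lambda>x. g (1, x))"
    unfolding homotopic_with_def
  proof (intro exI conjI allI ballI)
    show "continuous_map (prod_topology (top_of_set {0..1}) (top_of_set (realization K')))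
            (top_of_set (realization K')) g"
      using cont g_K' by (auto simp: continuous_map_subtopology_eu)
    show "g (0, x) = id x" for x by (simp add: g_def)
  qed auto
  moreover have "retraction_maps (top_of_set (realization K')) (top_of_set (realization K)) (\<lambda>x. g (1, x)) id"
    unfolding retraction_maps_def
  proof (intro conjI ballI)
    have "continuous_on (realization K') (\<lambda>x. g (1, x))"
      by (rule continuous_on_compose2[OF cont[of UNIV]]) (auto intro: continuous_intros)
    then show "continuous_map (top_of_set (realization K')) (top_of_set (realization K)) (\<lambda>x. g (1, x))"
      using g_K by (auto simp: continuous_map_subtopology_eu)
    have sub: "realization K \<subseteq> realization K'" using K'(2) by (intro realization_mono) auto
    then show "continuous_map (top_of_set (realization K)) (top_of_set (realization K')) id"
      by (auto simp: continuous_map_subtopology_eu)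
    fix x assume "x \<in> topspace (top_of_set (realization K))"
    then have x: "x \<in> realization K" by simp
    have "\<not> \<tau> \<subseteq> supp x"
      using realizationD(1)[OF x] v(2) simplicial_complexD(3)[OF K] by blast
    then have "m x = 0" using m0 x sub by blast
    then show "g (1, id x) = x" by (simp add: g_id)
  qed
  ultimately show ?thesis
    by (intro deformation_retract_imp_homotopy_equivalent_space[of _ "\<lambda>x. g (1, x)"])
      (simp_all add: homotopic_with_symD)
qed

text \<open>Every expansion is a homotopy equivalence except the one with
  \<open>\<tau> = {}\<close>, which turns the empty space into a point. The empty space itself
  counts as contractible.\<close>

lemma collapsible_imp_contractible:
  "collapsible K \<Longrightarrow> contractible_space (top_of_set (realization K))"
proof (induction rule: collapsible.induct)
  case void
  then show ?case by (simp add: realization_def)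
next
  case (expand K \<tau> v)
  show ?case
  proof (cases "\<tau> = {}")
    case True
    have "K = {}"
      using expand.hyps True simplicial_complexD(3)[OF collapsible_imp_simplicial_complex[OF expand.hyps(1)]] by blast
    have "x = (\<lambda>u. if u = v then 1 else 0)"
      if x: "x \<in> realization (insert \<tau> (insert (insert v \<tau>) K))" for x
    proof
      fix u
      have "supp x = {v}"
        using x \<open>K = {}\<close> True realizationD(1,3)[OF x] by auto
      then show "x u = (if u = v then 1 else 0)"
        using realizationD(3)[OF x] by (auto simp: supp_def)
    qed
    then show ?thesis
      by (intro contractible_space_subset_singleton[of _ "\<lambda>u. if u = v then 1 else 0"]) auto
  next
    case False
    show ?thesis
      using elementary_collapse[OF expand.hyps(2) refl collapsible_imp_simplicial_complex[OF expand.hyps(1)]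
          expand.hyps(3-5) False] expand.IH homotopy_equivalent_space_contractibility by blast
  qed
qed

lemma collapsible_has_vertex:
  "collapsible K \<Longrightarrow> K \<noteq> {} \<Longrightarrow> \<exists>v. {v} \<in> K"
proof (induction rule: collapsible.induct)
  case (expand K \<tau> v)
  show ?case
    using simplicial_complexD(3)[OF expand.hyps(2), of "insert v \<tau>" "{v}"] by blast
qed simp

text \<open>The familiar fact on collapsing a contractible subspace with the homotopy extension
  property, phrased with fibres of \<open>q\<close> in place of the subspace. The end of
  \<open>h\<close> factors through \<open>q\<close> and gives the inverse; \<open>h\<close> itself
  descends to a homotopy of \<open>W\<close>.\<close>

lemma collapse_homotopy_equivalence:
  fixes X :: "'a topology" and W :: "'b topology"
  assumes q: "quotient_map X W q"
    and h: "continuous_map (prod_topology (top_of_set {0..1::real}) X) X h"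
    and h0: "\<And>x. x \<in> topspace X \<Longrightarrow> h (0, x) = x"
    and h1: "\<And>x y. \<lbrakk>x \<in> topspace X; y \<in> topspace X; q x = q y\<rbrakk> \<Longrightarrow> h (1, x) = h (1, y)"
    and hq: "\<And>t x y. \<lbrakk>t \<in> {0..1}; x \<in> topspace X; y \<in> topspace X; q x = q y\<rbrakk>
               \<Longrightarrow> q (h (t, x)) = q (h (t, y))"
  shows "X homotopy_equivalent_space W"
proof -
  let ?I = "top_of_set {0..1::real}"
  have cq: "continuous_map X W q" using q quotient_imp_continuous_map by blast
  have surj: "q ` topspace X = topspace W" using q quotient_imp_surjective_map by blast
  have slice: "continuous_map Y (prod_topology ?I Y) (\<lambda>x. (t, x))" if "t \<in> {0..1}" for t and Y :: "'c topology"
    using that by (intro continuous_intros) (auto simp: continuous_map_pairedI)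
  have ch1: "continuous_map X X (\<lambda>x. h (1, x))"
    using continuous_map_compose[OF slice[of 1 X] h] by (simp add: o_def)
  obtain g where g: "continuous_map W X g" "\<And>x. x \<in> topspace X \<Longrightarrow> g (q x) = h (1, x)"
    using quotient_map_lift_exists[OF q ch1] h1 by metis
  \<comment> \<open>The interval is compact and Hausdorff, so its product with \<open>q\<close> is
    again a quotient map and \<open>q \<circ> h\<close> descends.\<close>
  have Q: "quotient_map (prod_topology ?I X) (prod_topology ?I W) (\<lambda>(t, x). (t, q x))"
  proof (rule quotient_map_prod_right[OF _ _ q])
    show "locally_compact_space ?I"
      by (intro compact_imp_locally_compact_space) (auto simp: compact_space_subtopology)
    show "Hausdorff_space ?I \<or> regular_space ?I"
      by (simp add: Hausdorff_space_subtopology)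
  qed
  have C: "continuous_map (prod_topology ?I X) W (q \<circ> h)"
    using continuous_map_compose[OF h cq] .
  have E: "(q \<circ> h) p = (q \<circ> h) p'"
    if "p \<in> topspace (prod_topology ?I X)" "p' \<in> topspace (prod_topology ?I X)"
      "(\<lambda>(t, x). (t, q x)) p = (\<lambda>(t, x). (t, q x)) p'" for p p'
  proof -
    obtain t x where p: "p = (t, x)" by (cases p)
    obtain t' x' where p': "p' = (t', x')" by (cases p')
    have "t = t'" "q x = q x'" "t \<in> {0..1}" "x \<in> topspace X" "x' \<in> topspace X"
      using that unfolding p p' by simp_all
    then show ?thesis using hq[of t x x'] unfolding p p' by (simp only: o_apply)
  qed
  obtain k where k: "continuous_map (prod_topology ?I W) W k"
    "k ` topspace (prod_topology ?I W) = (q \<circ> h) ` topspace (prod_topology ?I X)"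
    "\<And>p. p \<in> topspace (prod_topology ?I X) \<Longrightarrow> k ((\<lambda>(t, x). (t, q x)) p) = (q \<circ> h) p"
    by (rule quotient_map_lift_exists[OF Q C E]) (assumption | rule that)+
  have k': "k (t, q x) = q (h (t, x))" if "t \<in> {0..1}" "x \<in> topspace X" for t x
    using k(3)[of "(t, x)"] that by simp
  have "homotopic_with (\<lambda>x. True) X X (\<lambda>x. h (0, x)) (\<lambda>x. h (1, x))"
    unfolding homotopic_with_def using h by blast
  then have 1: "homotopic_with (\<lambda>x. True) X X (g \<circ> q) id"
    by (rule homotopic_with_eq[OF homotopic_with_symD]) (use g h0 in auto)
  have "homotopic_with (\<lambda>x. True) W W (\<lambda>x. k (0, x)) (\<lambda>x. k (1, x))"
    unfolding homotopic_with_def using k(1) by blast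
  then have 2: "homotopic_with (\<lambda>x. True) W W (q \<circ> g) id"
  proof (rule homotopic_with_eq[OF homotopic_with_symD])
    fix y assume "y \<in> topspace W"
    then obtain x where "x \<in> topspace X" "y = q x" using surj by auto
    then show "(q \<circ> g) y = k (1, y)" "id y = k (0, y)" using k' g h0 by simp_all
  qed auto
  show ?thesis
    unfolding homotopy_equivalent_space_def using cq g(1) 1 2 by blast
qed

section \<open>Collapsing the boundary of a simplex to a point\<close>

lemma topspace_nsphere: "topspace (nsphere d) = {x. (\<Sum>i\<le>d. (x i)\<^sup>2) = 1 \<and> (\<forall>i>d. x i = 0)}"
  by (simp add: nsphere)

lemma nsphere_eq_top_of_set: "nsphere d = top_of_set {x. (\<Sum>i\<le>d. (x i)\<^sup>2) = 1 \<and> (\<forall>i>d. x i = 0)}"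
  by (simp add: nsphere euclidean_product_topology)

lemma sphere_pole_in_nsphere: "sphere_pole \<in> topspace (nsphere d)"
proof -
  have "(\<Sum>i\<le>d. (sphere_pole i)\<^sup>2) = (\<Sum>i\<le>d. if i = 0 then 1 else 0)"
    by (rule sum.cong) (auto simp: sphere_pole_def)
  then show ?thesis by (simp add: topspace_nsphere sphere_pole_def)
qed

lemma sum_atMost_split0: "(\<Sum>i\<le>d. f i) = f 0 + (\<Sum>i=1..d. f i)" for f :: "nat \<Rightarrow> real"
  by (simp add: sum.atLeast_Suc_atMost flip: atLeast0AtMost)

text \<open>Such a map presents the sphere as the closed simplex with its boundary collapsed to the
  pole. For \<open>d = 0\<close> the boundary has no points and the pole is not attained.\<close>

definition sphere_collapse :: "'v set \<Rightarrow> nat \<Rightarrow> (('v \<Rightarrow> real) \<Rightarrow> nat \<Rightarrow> real) \<Rightarrow> bool" where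
  "sphere_collapse \<sigma> d \<theta> \<longleftrightarrow>
     continuous_on (realization (Pow \<sigma>)) \<theta> \<and>
     (\<forall>x\<in>realization (Pow \<sigma>). \<theta> x \<in> topspace (nsphere d)) \<and>
     (\<forall>x\<in>realization (Pow \<sigma>). \<theta> x = sphere_pole \<longleftrightarrow> supp x \<noteq> \<sigma>) \<and>
     (\<forall>x\<in>realization (Pow \<sigma>). \<forall>y\<in>realization (Pow \<sigma>).
        supp x = \<sigma> \<longrightarrow> supp y = \<sigma> \<longrightarrow> \<theta> x = \<theta> y \<longrightarrow> x = y) \<and>
     (\<forall>p\<in>topspace (nsphere d). p \<noteq> sphere_pole \<longrightarrow>
        (\<exists>x\<in>realization (Pow \<sigma>). supp x = \<sigma> \<and> \<theta> x = p))"

text \<open>The map divides the displacement from the barycentre by the least barycentric coordinate,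
  which turns the open simplex into a Euclidean space, and then applies the inverse stereographic
  projection.\<close>

lemma sphere_collapse_exists:
  fixes \<sigma> :: "'v set"
  assumes "card \<sigma> = Suc d"
  shows "\<exists>\<theta>. sphere_collapse \<sigma> d \<theta>"
proof -
  have fin: "finite \<sigma>" and ne: "\<sigma> \<noteq> {}" using assms card.infinite by fastforce+
  obtain e where "bij_betw e {0..<Suc d} \<sigma>"
    using ex_bij_betw_nat_finite[OF fin] assms by auto
  then have e: "bij_betw e {..d} \<sigma>" by (simp add: atLeast0LessThan lessThan_Suc_atMost)
  have e_in: "e i \<in> \<sigma>" if "i \<le> d" for i using e that by (auto simp: bij_betw_def)
  have e_ex: "\<exists>i\<le>d. u = e i" if "u \<in> \<sigma>" for u using e that by (auto simp: bij_betw_def)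
  define c :: real where "c = 1 / (d + 1)"
  have c: "0 < c" "(d + 1) * c = 1" by (auto simp: c_def)
  define m :: "('v \<Rightarrow> real) \<Rightarrow> real" where "m = (\<lambda>x. Min (x ` \<sigma>))"
  define S :: "('v \<Rightarrow> real) \<Rightarrow> real" where "S = (\<lambda>x. \<Sum>i=1..d. (x (e i) - c)\<^sup>2)"
  define N where "N = (\<lambda>x. S x + (m x)\<^sup>2)"
  \<comment> \<open>With \<open>z = (x - c) / m\<close> this is inverse stereographic projection
    \<open>(|z|^2 - 1, 2 z) / (|z|^2 + 1)\<close>, multiplied through by \<open>m^2\<close> so that
    it makes sense on the boundary, where \<open>m = 0\<close> and the value is the pole. The
    displacement at \<open>e 0\<close> is dropped, as the displacements sum to 0, and index 0
    becomes the axis of the pole.\<close>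
  define \<theta> where "\<theta> = (\<lambda>x k. if k = 0 then (S x - (m x)\<^sup>2) / N x
                     else if k \<le> d then 2 * m x * (x (e k) - c) / N x else 0)"
  let ?F = "realization (Pow \<sigma>)"
  have m_le: "m x \<le> x u" if "u \<in> \<sigma>" for x u using that fin by (simp add: m_def)
  have m_ex: "\<exists>j\<le>d. m x = x (e j)" for x
  proof -
    have "m x \<in> x ` \<sigma>" unfolding m_def using fin ne by simp
    then obtain u where u: "u \<in> \<sigma>" "m x = x u" by blast
    obtain j where "j \<le> d" "u = e j" using e_ex[OF u(1)] by blast
    then show ?thesis using u(2) by blast
  qed
  have m0: "0 \<le> m x" "m x = 0 \<longleftrightarrow> supp x \<noteq> \<sigma>" if "x \<in> ?F" for x
  proof -
    have "supp x \<subseteq> \<sigma>" using realizationD(1)[OF that] by simp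
    then show "0 \<le> m x" "m x = 0 \<longleftrightarrow> supp x \<noteq> \<sigma>"
      using Min_image_pos_iff[OF fin ne, of x] realizationD(2)[OF that] by (auto simp: m_def)
  qed
  have sum1: "(\<Sum>i\<le>d. x (e i)) = 1" if "x \<in> ?F" for x
  proof -
    have "(\<Sum>i\<le>d. x (e i)) = sum x \<sigma>" by (rule sum.reindex_bij_betw[OF e])
    then show ?thesis using sum_supp[OF fin, of x] realizationD(1,3)[OF that] by simp
  qed
  have sum0: "(\<Sum>i\<le>d. x (e i) - c) = 0" if "x \<in> ?F" for x
    using sum1[OF that] c(2) by (simp add: sum_subtractf algebra_simps)
  have S_ge: "0 \<le> S x" for x unfolding S_def by (intro sum_nonneg) simp
  \<comment> \<open>If \<open>S x = 0\<close>, all coordinates equal \<open>c\<close>, the one at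
    \<open>e 0\<close> because of the sum, and then \<open>m x = c\<close> is positive.\<close>
  have N_pos: "0 < N x" if x: "x \<in> ?F" for x
  proof (rule ccontr)
    assume "\<not> 0 < N x"
    then have "S x = 0" "(m x)\<^sup>2 = 0"
      using S_ge[of x] zero_le_power2[of "m x"] unfolding N_def by linarith+
    then have "m x = 0" by simp
    have z: "x (e i) - c = 0" if "i \<in> {1..d}" for i
      using \<open>S x = 0\<close> that unfolding S_def by (subst (asm) sum_nonneg_eq_0_iff) auto
    then have "x (e 0) - c = 0" using sum0[OF x] by (subst (asm) sum_atMost_split0) simp
    obtain j where "j \<le> d" "m x = x (e j)" using m_ex by blast
    then have "m x = c" using z[of j] \<open>x (e 0) - c = 0\<close> by (cases "j = 0") auto
    then show False using \<open>m x = 0\<close> c by simp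
  qed
  have "continuous_on ?F S" unfolding S_def by (intro continuous_intros)
  moreover have "continuous_on ?F m"
    unfolding m_def by (rule continuous_on_Min[OF fin ne]) (intro continuous_intros)
  ultimately have cS: "continuous_on ?F S" and cm: "continuous_on ?F m" and cN: "continuous_on ?F N"
    unfolding N_def by (auto intro!: continuous_intros)
  have cont: "continuous_on ?F \<theta>"
  proof (rule continuous_on_coordinatewise_then_product)
    fix k
    have "\<And>x. x \<in> ?F \<Longrightarrow> N x \<noteq> 0" using N_pos by fastforce
    then show "continuous_on ?F (\<lambda>x. \<theta> x k)"
      unfolding \<theta>_def using cS cm cN
      by (cases "k = 0"; cases "k \<le> d") (auto intro!: continuous_intros)
  qed
  have sphere: "\<theta> x \<in> topspace (nsphere d)" if x: "x \<in> ?F" for x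
  proof -
    have "(\<Sum>i=1..d. (\<theta> x i)\<^sup>2) = (\<Sum>i=1..d. (2 * m x / N x)\<^sup>2 * (x (e i) - c)\<^sup>2)"
      by (rule sum.cong) (auto simp: \<theta>_def power_mult_distrib power_divide)
    also have "\<dots> = (2 * m x / N x)\<^sup>2 * S x"
      by (simp add: S_def sum_distrib_left)
    finally have "(\<Sum>i\<le>d. (\<theta> x i)\<^sup>2) = ((S x - (m x)\<^sup>2) / N x)\<^sup>2 + (2 * m x / N x)\<^sup>2 * S x"
      by (subst sum_atMost_split0) (simp add: \<theta>_def)
    also have "\<dots> = ((S x - (m x)\<^sup>2)\<^sup>2 + 4 * (m x)\<^sup>2 * S x) / (N x)\<^sup>2"
      by (simp add: power_divide power_mult_distrib add_divide_distrib)
    also have "(S x - (m x)\<^sup>2)\<^sup>2 + 4 * (m x)\<^sup>2 * S x = (N x)\<^sup>2"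
      unfolding N_def by algebra
    finally show ?thesis using N_pos[OF x] by (simp add: topspace_nsphere \<theta>_def)
  qed
  have pole: "\<theta> x = sphere_pole \<longleftrightarrow> supp x \<noteq> \<sigma>" if x: "x \<in> ?F" for x
  proof
    assume "\<theta> x = sphere_pole"
    then have "\<theta> x 0 = 1" by (simp add: sphere_pole_def)
    then have "S x - (m x)\<^sup>2 = N x" using N_pos[OF x] by (simp add: \<theta>_def)
    then show "supp x \<noteq> \<sigma>" using m0(2)[OF x] by (simp add: N_def)
  next
    assume "supp x \<noteq> \<sigma>"
    then have "m x = 0" using m0(2)[OF x] by simp
    then show "\<theta> x = sphere_pole"
      using N_pos[OF x] by (auto simp: \<theta>_def sphere_pole_def N_def)
  qed
  have z_eq: "(x (e k) - c) / m x = \<theta> x k / (1 - \<theta> x 0)"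
    if x: "x \<in> ?F" and s: "supp x = \<sigma>" and k: "k \<in> {1..d}" for x k
  proof -
    have "0 < m x" using m0[OF x] s by simp
    have "1 - \<theta> x 0 = 2 * (m x)\<^sup>2 / N x"
      using N_pos[OF x] by (simp add: \<theta>_def N_def field_simps)
    moreover have "\<theta> x k = 2 * m x * (x (e k) - c) / N x" using k by (simp add: \<theta>_def)
    ultimately show ?thesis using N_pos[OF x] \<open>0 < m x\<close> by (simp add: power2_eq_square)
  qed
  have inj: "x = y" if x: "x \<in> ?F" and y: "y \<in> ?F" and s: "supp x = \<sigma>" "supp y = \<sigma>" and eq: "\<theta> x = \<theta> y" for x y
  proof -
    have mx: "0 < m x" and my: "0 < m y" using m0[OF x] m0[OF y] s by auto
    define z where "z = (\<lambda>k. (x (e k) - c) / m x)"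
    have zy1: "z k = (y (e k) - c) / m y" if "k \<in> {1..d}" for k
      using z_eq[OF x s(1) that] z_eq[OF y s(2) that] eq by (simp add: z_def)
    have sx: "(\<Sum>i\<le>d. (x (e i) - c) / m x) = 0" and sy: "(\<Sum>i\<le>d. (y (e i) - c) / m y) = 0"
      using sum0[OF x] sum0[OF y] by (simp_all flip: sum_divide_distrib)
    have "(\<Sum>i=1..d. (x (e i) - c) / m x) = (\<Sum>i=1..d. (y (e i) - c) / m y)"
      by (rule sum.cong) (use zy1 in \<open>auto simp: z_def\<close>)
    then have "z 0 = (y (e 0) - c) / m y"
      using sx sy unfolding sum_atMost_split0 z_def by linarith
    then have zy: "z k = (y (e k) - c) / m y" if "k \<le> d" for k
      using zy1[of k] that by (cases "k = 0") auto
    have xz: "x (e k) = c + m x * z k" for k using mx by (simp add: z_def)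
    have yz: "y (e k) = c + m y * z k" if "k \<le> d" for k using my zy[OF that] by simp
    \<comment> \<open>The points are \<open>c + m x * z\<close> and \<open>c + m y * z\<close> with
      the same \<open>z\<close>. Comparing them at a vertex where one attains its least coordinate,
      and then with roles exchanged, gives \<open>m x = m y\<close>.\<close>
    obtain i where i: "i \<le> d" "m x = x (e i)" using m_ex by blast
    obtain j where j: "j \<le> d" "m y = y (e j)" using m_ex by blast
    have ci: "m x * (1 - z i) = c" using xz[of i] i by (simp add: algebra_simps)
    have cj: "m y * (1 - z j) = c" using yz[OF j(1)] j by (simp add: algebra_simps)
    have "m y \<le> c + m y * z i" using m_le[OF e_in[OF i(1)], of y] yz[OF i(1)] by simp
    then have 1: "m y * (1 - z i) \<le> m x * (1 - z i)" using ci by (simp add: algebra_simps)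
    have "m x \<le> c + m x * z j" using m_le[OF e_in[OF j(1)], of x] xz by simp
    then have 2: "m x * (1 - z j) \<le> m y * (1 - z j)" using cj by (simp add: algebra_simps)
    have "0 < 1 - z i" using ci mx c(1) by (metis zero_less_mult_pos)
    moreover have "0 < 1 - z j" using cj my c(1) by (metis zero_less_mult_pos)
    ultimately have "m x = m y" using 1 2 by simp
    then have "x (e k) = y (e k)" if "k \<le> d" for k using xz yz[OF that] by simp
    then have "x u = y u" if "u \<in> \<sigma>" for u using e_ex[OF that] by auto
    moreover have "x u = y u" if "u \<notin> \<sigma>" for u
    proof -
      have "u \<notin> supp x" "u \<notin> supp y" using that s by simp_all
      then show ?thesis by (simp add: supp_def)
    qed
    ultimately show ?thesis by (intro ext) metis
  qed
  have surj: "\<exists>x\<in>?F. supp x = \<sigma> \<and> \<theta> x = p" if p: "p \<in> topspace (nsphere d)" "p \<noteq> sphere_pole" for p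
  proof -
    have psum: "(p 0)\<^sup>2 + (\<Sum>i=1..d. (p i)\<^sup>2) = 1" and p_out: "\<And>i. i > d \<Longrightarrow> p i = 0"
      using p(1) by (auto simp: topspace_nsphere sum_atMost_split0)
    have "p 0 \<noteq> 1"
    proof
      assume "p 0 = 1"
      then have "(\<Sum>i=1..d. (p i)\<^sup>2) = 0" using psum by simp
      then have "p i = 0" if "i \<in> {1..d}" for i
        using that by (subst (asm) sum_nonneg_eq_0_iff) auto
      then have "p i = sphere_pole i" for i
        using p_out[of i] \<open>p 0 = 1\<close> by (cases "i = 0"; cases "i \<le> d") (auto simp: sphere_pole_def)
      then show False using p(2) by auto
    qed
    moreover have "p 0 \<le> 1"
    proof -
      have "0 \<le> (\<Sum>i=1..d. (p i)\<^sup>2)" by (intro sum_nonneg) simp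
      then have "(p 0)\<^sup>2 \<le> 1" using psum by linarith
      then have "\<bar>p 0\<bar> \<le> 1" by (simp add: abs_square_le_1)
      then show ?thesis by simp
    qed
    ultimately have p0: "0 < 1 - p 0" by simp
    \<comment> \<open>Stereographic projection from the pole, with the value at index 0 restored by
      the vanishing of the sum.\<close>
    define z where "z = (\<lambda>k. if k = 0 then - (\<Sum>i=1..d. p i / (1 - p 0)) else p k / (1 - p 0))"
    have z_sum: "(\<Sum>i\<le>d. z i) = 0"
    proof -
      have "(\<Sum>i=1..d. z i) = (\<Sum>i=1..d. p i / (1 - p 0))"
        by (rule sum.cong) (auto simp: z_def)
      then show ?thesis unfolding sum_atMost_split0 by (simp add: z_def)
    qed
    define zm where "zm = Min (z ` {..d})"
    have zm_le: "zm \<le> z k" if "k \<le> d" for k using that by (simp add: zm_def)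
    have "zm \<in> z ` {..d}" unfolding zm_def by (rule Min_in) auto
    then obtain j where j: "j \<le> d" "zm = z j" by auto
    have "zm \<le> 0"
    proof (rule ccontr)
      assume "\<not> zm \<le> 0"
      then have "0 < (\<Sum>i\<le>d. z i)" using zm_le by (intro sum_pos) force+
      then show False using z_sum by simp
    qed
    \<comment> \<open>The solution of \<open>\<mu> = c + \<mu> * zm\<close>, chosen so that
      \<open>\<mu>\<close> is the least coordinate of the preimage. The denominator is positive
      because the \<open>z k\<close> sum to 0.\<close>
    define \<mu> where "\<mu> = c / (1 - zm)"
    have \<mu>: "0 < \<mu>" "\<mu> * (1 - zm) = c" using \<open>zm \<le> 0\<close> c by (auto simp: \<mu>_def)
    define x where "x = (\<lambda>u. if u \<in> \<sigma> then c + \<mu> * z (the_inv_into {..d} e u) else 0)"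
    have xe: "x (e k) = c + \<mu> * z k" if "k \<le> d" for k
    proof -
      have "the_inv_into {..d} e (e k) = k"
        using e that by (intro the_inv_into_f_f) (auto simp: bij_betw_def)
      then show ?thesis using e_in[OF that] by (simp add: x_def)
    qed
    have x_ge: "\<mu> \<le> x (e k)" if "k \<le> d" for k
    proof -
      have "\<mu> * zm \<le> \<mu> * z k" using zm_le[OF that] \<mu>(1) by simp
      then show ?thesis using xe[OF that] \<mu>(2) by (simp add: algebra_simps)
    qed
    have x_pos: "0 < x u" if "u \<in> \<sigma>" for u
      using e_ex[OF that] x_ge \<mu>(1) by fastforce
    have supp_x: "supp x = \<sigma>"
      using x_pos by (force simp: supp_def x_def)
    have "sum x \<sigma> = (\<Sum>i\<le>d. x (e i))" by (rule sum.reindex_bij_betw[OF e, symmetric])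
    also have "\<dots> = (\<Sum>i\<le>d. c + \<mu> * z i)" by (rule sum.cong) (auto simp: xe)
    also have "\<dots> = 1" using z_sum c(2) by (simp add: sum.distrib algebra_simps flip: sum_distrib_left)
    finally have x: "x \<in> ?F"
      using supp_x x_pos by (intro realizationI[OF fin]) (auto simp: x_def less_imp_le)
    have mx: "m x = \<mu>"
    proof (rule antisym)
      have "x (e j) = \<mu>" using xe[OF j(1)] j(2) \<mu>(2) by (simp add: algebra_simps)
      then show "m x \<le> \<mu>" using m_le[OF e_in[OF j(1)], of x] by simp
      obtain i where "i \<le> d" "m x = x (e i)" using m_ex by blast
      then show "\<mu> \<le> m x" using x_ge by simp
    qed
    have Sx: "S x = \<mu>\<^sup>2 * ((1 - (p 0)\<^sup>2) / (1 - p 0)\<^sup>2)"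
    proof -
      have "S x = (\<Sum>i=1..d. \<mu>\<^sup>2 / (1 - p 0)\<^sup>2 * (p i)\<^sup>2)"
        unfolding S_def by (rule sum.cong) (auto simp: xe z_def power_mult_distrib power_divide)
      also have "\<dots> = \<mu>\<^sup>2 / (1 - p 0)\<^sup>2 * (1 - (p 0)\<^sup>2)"
      proof -
        have "(\<Sum>i=1..d. (p i)\<^sup>2) = 1 - (p 0)\<^sup>2" using psum by linarith
        then show ?thesis by (simp only: sum_distrib_left[symmetric])
      qed
      finally show ?thesis by simp
    qed
    have "1 - (p 0)\<^sup>2 = (1 + p 0) * (1 - p 0)" by algebra
    then have Sx': "S x = \<mu>\<^sup>2 * ((1 + p 0) / (1 - p 0))"
      unfolding Sx using p0 by (simp add: power2_eq_square)
    have Nx: "N x = \<mu>\<^sup>2 * (2 / (1 - p 0))"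
      unfolding N_def Sx' mx using p0 by (simp add: field_simps)
    have "S x - (m x)\<^sup>2 = \<mu>\<^sup>2 * (2 * p 0 / (1 - p 0))"
      unfolding Sx' mx using p0 by (simp add: field_simps)
    then have t0: "\<theta> x 0 = p 0"
      unfolding \<theta>_def Nx using p0 \<mu>(1) by simp
    have "\<theta> x k = p k" for k
    proof (cases "k = 0 \<or> k > d")
      case True
      then show ?thesis using t0 p_out by (auto simp: \<theta>_def)
    next
      case False
      then have "\<theta> x k = 2 * \<mu> * (\<mu> * (p k / (1 - p 0))) / N x"
        by (simp add: \<theta>_def mx xe z_def)
      then show ?thesis unfolding Nx using p0 \<mu>(1) by (simp add: power2_eq_square)
    qed
    then show ?thesis using x supp_x by blast
  qed
  have "sphere_collapse \<sigma> d \<theta>"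
    unfolding sphere_collapse_def using cont sphere pole inj surj by blast
  then show ?thesis by blast
qed

text \<open>Points of a cell outside \<open>C\<close> that are close to its boundary are first pushed radially away from
  the barycentre, by subtracting a constant from the coordinates; only once they have reached \<open>C\<close> do
  they follow its contraction.\<close>

lemma near_collapsible_extend_contraction:
  fixes K :: "'v set set"
  assumes K: "simplicial_complex K" and nc: "near_collapsible K C X" and ne: "C \<noteq> {}"
  obtains h a where
    "continuous_map (prod_topology (top_of_set {0..1::real}) (top_of_set (realization K)))
       (top_of_set (realization K)) h"
    "\<And>x. x \<in> realization K \<Longrightarrow> h (0, x) = x"
    "\<And>t x. \<lbrakk>t \<in> {0..1}; x \<in> realization C\<rbrakk> \<Longrightarrow> h (t, x) \<in> realization C"
    "\<And>x. x \<in> realization C \<Longrightarrow> h (1, x) = a"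
proof -
  have C: "collapsible C" and K_eq: "K = C \<union> X" and disj: "C \<inter> X = {}"
    and faces: "\<And>\<sigma> \<tau>. \<sigma> \<in> X \<Longrightarrow> \<tau> \<subset> \<sigma> \<Longrightarrow> \<tau> \<in> C"
    using nc by (auto simp: near_collapsible_def)
  have scC: "simplicial_complex C" by (rule collapsible_imp_simplicial_complex[OF C])
  have finX: "finite X" using simplicial_complexD(1)[OF K] K_eq by simp
  have fin: "finite \<sigma>" if "\<sigma> \<in> K" for \<sigma> using simplicial_complexD(2)[OF K that] .
  have finX': "finite \<sigma>" if "\<sigma> \<in> X" for \<sigma> using fin[of \<sigma>] that K_eq by simp
  have neX: "\<sigma> \<noteq> {}" if "\<sigma> \<in> X" for \<sigma>
  proof
    assume "\<sigma> = {}"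
    moreover obtain \<rho> where "\<rho> \<in> C" using ne by blast
    ultimately have "\<sigma> \<in> C" using simplicial_complexD(3)[OF scC] by simp
    then show False using disj that by blast
  qed
  have sub: "realization C \<subseteq> realization K" using K_eq by (intro realization_mono) simp
  obtain a where "homotopic_with (\<lambda>x. True) (top_of_set (realization C)) (top_of_set (realization C)) id (\<lambda>x. a)"
    using collapsible_imp_contractible[OF C] unfolding contractible_space_def by blast
  then obtain H where H: "continuous_map (prod_topology (top_of_set {0..1::real}) (top_of_set (realization C)))
       (top_of_set (realization C)) H" and H0: "\<And>x. H (0, x) = x" and H1: "\<And>x. H (1, x) = a"
    unfolding homotopic_with_def by auto
  have contH: "continuous_on ({0..1} \<times> realization C) H"
    using H by (simp add: continuous_map_subtopology_eu)
  have H_in: "H (t, x) \<in> realization C" if "t \<in> {0..1}" "x \<in> realization C" for t x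
    using H that by (auto simp: continuous_map_subtopology_eu)

  \<comment> \<open>Keeps the total \<open>D\<close> of the subtracted amounts at most 1/2, so that
    the normalising factor \<open>1 - D\<close> stays away from 0. The summand 1 covers an empty
    \<open>X\<close>.\<close>
  define \<epsilon> where "\<epsilon> = 1 / (2 * (1 + real (\<Sum>\<sigma>\<in>X. card \<sigma>)))"
  define m :: "'v set \<Rightarrow> ('v \<Rightarrow> real) \<Rightarrow> real" where "m = (\<lambda>\<sigma> x. Min (x ` \<sigma>))"
  \<comment> \<open>Sums over all of \<open>X\<close> give one formula that is continuous on the
    whole realization. At each point at most one summand is nonzero, that of the open cell
    containing the point.\<close>
  define M where "M = (\<lambda>x. \<Sum>\<sigma>\<in>X. m \<sigma> x)"
  define \<delta> where "\<delta> = (\<lambda>\<sigma> p. min (m \<sigma> (snd p)) (\<epsilon> * fst p))"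
  define D where "D = (\<lambda>p. \<Sum>\<sigma>\<in>X. real (card \<sigma>) * \<delta> \<sigma> p)"
  define P where "P = (\<lambda>p u. (snd p u - (\<Sum>\<sigma>\<in>X. if u \<in> \<sigma> then \<delta> \<sigma> p else 0)) / (1 - D p))"
  \<comment> \<open>Subtracting at rate \<open>\<epsilon>\<close>, a point reaches \<open>C\<close>
    at time \<open>M x / \<epsilon>\<close> and spends the remaining time on \<open>H\<close>.
    Points with \<open>M x > \<epsilon>\<close> never get there, which is allowed: only points of
    \<open>C\<close> have to end at \<open>a\<close>.\<close>
  define h where "h = (\<lambda>p. if M (snd p) - \<epsilon> * fst p \<le> 0 then H (fst p - M (snd p) / \<epsilon>, P p) else P p)"
  let ?S = "{0..1::real} \<times> realization K"
  have \<epsilon>: "0 < \<epsilon>" unfolding \<epsilon>_def by (simp add: add_pos_nonneg del: of_nat_sum)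
  have m_ge: "0 \<le> m \<sigma> x" and m0: "m \<sigma> x = 0 \<longleftrightarrow> \<not> \<sigma> \<subseteq> supp x" if "\<sigma> \<in> X" "x \<in> realization K" for \<sigma> x
    using Min_image_pos_iff[OF finX'[OF that(1)] neX[OF that(1)], of x] realizationD(2)[OF that(2)]
    by (simp_all add: m_def)
  have \<delta>_bounds: "0 \<le> \<delta> \<sigma> p" "\<delta> \<sigma> p \<le> \<epsilon>" if "\<sigma> \<in> X" "p \<in> ?S" for \<sigma> p
  proof -
    have p: "0 \<le> fst p" "fst p \<le> 1" "snd p \<in> realization K" using that by auto
    then have le: "\<epsilon> * fst p \<le> \<epsilon>" using \<epsilon> by (simp add: mult_left_le)
    show "0 \<le> \<delta> \<sigma> p" using m_ge[OF that(1) p(3)] p \<epsilon> by (simp add: \<delta>_def)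
    show "\<delta> \<sigma> p \<le> \<epsilon>" unfolding \<delta>_def using le by (rule min.coboundedI2)
  qed
  have D_le: "D p \<le> 1 / 2" if "p \<in> ?S" for p
  proof -
    have "D p \<le> (\<Sum>\<sigma>\<in>X. real (card \<sigma>) * \<epsilon>)"
      unfolding D_def by (intro sum_mono mult_left_mono \<delta>_bounds that) auto
    also have "\<dots> = real (\<Sum>\<sigma>\<in>X. card \<sigma>) * \<epsilon>" by (simp add: sum_distrib_right)
    also have "\<dots> \<le> 1 / 2" by (simp add: \<epsilon>_def field_simps del: of_nat_sum)
    finally show ?thesis .
  qed
  have on_C: "M x = 0" "P (t, x) = x" if x: "x \<in> realization C" and t: "t \<in> {0..1}" for x t
  proof -
    have xK: "x \<in> realization K" using x sub by blast
    have mx: "m \<sigma> x = 0" if "\<sigma> \<in> X" for \<sigma>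
    proof -
      have "\<not> \<sigma> \<subseteq> supp x"
        using simplicial_complexD(3)[OF scC realizationD(1)[OF x]] disj that by blast
      then show ?thesis using m0[OF that xK] by simp
    qed
    then show "M x = 0" by (simp add: M_def)
    have "\<delta> \<sigma> (t, x) = 0" if "\<sigma> \<in> X" for \<sigma>
      using mx[OF that] t \<epsilon> by (simp add: \<delta>_def)
    then have "(\<Sum>\<sigma>\<in>X. if u \<in> \<sigma> then \<delta> \<sigma> (t, x) else 0) = 0" "D (t, x) = 0" for u
      by (auto simp: D_def intro!: sum.neutral)
    then show "P (t, x) = x" by (simp add: P_def fun_eq_iff)
  qed
  have on_cell: "P (t, x) \<in> realization K \<and> M x = m (supp x) x \<and>
      (M x \<le> \<epsilon> * t \<longrightarrow> P (t, x) \<in> realization C) \<and> (t = 0 \<longrightarrow> P (t, x) = x) \<and> 0 < M x"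
    if x: "x \<in> realization K" and s: "supp x \<in> X" and t: "t \<in> {0..1}" for x t
  proof -
    let ?\<sigma> = "supp x"
    have p: "(t, x) \<in> ?S" using x t by simp
    \<comment> \<open>Another cell of \<open>X\<close> inside \<open>supp x\<close> would be a
      proper face of it and so belong to \<open>C\<close>.\<close>
    have m_other: "m \<sigma> x = 0" if "\<sigma> \<in> X" "\<sigma> \<noteq> ?\<sigma>" for \<sigma>
    proof -
      have "\<not> \<sigma> \<subseteq> ?\<sigma>" using faces[OF s, of \<sigma>] disj that by blast
      then show ?thesis using m0[OF that(1) x] by simp
    qed
    then have \<delta>_other: "\<delta> \<sigma> (t, x) = 0" if "\<sigma> \<in> X" "\<sigma> \<noteq> ?\<sigma>" for \<sigma>
      using that t \<epsilon> by (simp add: \<delta>_def)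
    have M: "M x = m ?\<sigma> x"
      unfolding M_def using sum.remove[OF finX s, of "\<lambda>\<sigma>. m \<sigma> x"] m_other by simp
    define k where "k = real (card ?\<sigma>)"
    define d where "d = \<delta> ?\<sigma> (t, x)"
    have D: "D (t, x) = k * d"
      unfolding D_def using sum.remove[OF finX s, of "\<lambda>\<sigma>. real (card \<sigma>) * \<delta> \<sigma> (t, x)"] \<delta>_other
      by (simp add: k_def d_def)
    have Pu: "P (t, x) u = (x u - (if u \<in> ?\<sigma> then d else 0)) / (1 - k * d)" for u
    proof -
      have "(\<Sum>\<sigma>\<in>X - {?\<sigma>}. if u \<in> \<sigma> then \<delta> \<sigma> (t, x) else 0) = 0"
        by (rule sum.neutral) (use \<delta>_other in auto)
      then show ?thesis
        unfolding P_def D using sum.remove[OF finX s, of "\<lambda>\<sigma>. if u \<in> \<sigma> then \<delta> \<sigma> (t, x) else 0"]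
        by (simp add: d_def)
    qed
    have kd: "0 < 1 - k * d" using D_le[OF p] D by simp
    have d_le: "d \<le> x u" if "u \<in> ?\<sigma>" for u
    proof -
      have "m ?\<sigma> x \<le> x u" using that finX'[OF s] by (simp add: m_def)
      then show ?thesis by (simp add: d_def \<delta>_def)
    qed
    have outside: "x u = 0" if "u \<notin> ?\<sigma>" for u using that by (simp add: supp_def)
    have P_supp: "supp (P (t, x)) \<subseteq> ?\<sigma>"
    proof
      fix u assume "u \<in> supp (P (t, x))"
      then have "P (t, x) u \<noteq> 0" by (simp add: supp_def)
      then show "u \<in> ?\<sigma>" using outside[of u] Pu[of u] by (cases "u \<in> ?\<sigma>") auto
    qed
    have P_ge: "0 \<le> P (t, x) u" for u
      using d_le[of u] outside[of u] kd Pu[of u] by (cases "u \<in> ?\<sigma>") auto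
    have "sum (P (t, x)) ?\<sigma> = (\<Sum>u\<in>?\<sigma>. (x u - d) / (1 - k * d))"
      by (rule sum.cong) (simp_all add: Pu)
    also have "\<dots> = (sum x ?\<sigma> - k * d) / (1 - k * d)"
      by (simp add: sum_subtractf k_def flip: sum_divide_distrib)
    also have "\<dots> = 1" using realizationD(3)[OF x] kd by simp
    finally have P_sum: "sum (P (t, x)) ?\<sigma> = 1" .
    have PK: "P (t, x) \<in> realization K"
      using simplicial_complexD(3)[OF K realizationD(1)[OF x] P_supp]
      by (intro realizationI[OF finX'[OF s] P_supp _ P_ge P_sum])
    have "P (t, x) \<in> realization C" if le: "M x \<le> \<epsilon> * t"
    proof -
      have "m ?\<sigma> x \<in> x ` ?\<sigma>" unfolding m_def using finX'[OF s] neX[OF s] by (intro Min_in) auto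
      then obtain u where u: "u \<in> ?\<sigma>" "m ?\<sigma> x = x u" by blast
      have "d = x u" using le M u(2) by (simp add: d_def \<delta>_def)
      then have "P (t, x) u = 0" using Pu[of u] u by simp
      then have "u \<notin> supp (P (t, x))" by (simp add: supp_def)
      then have "supp (P (t, x)) \<subset> ?\<sigma>" using P_supp u(1) by blast
      then have "supp (P (t, x)) \<in> C" by (rule faces[OF s])
      then show ?thesis by (intro realizationI[OF finX'[OF s] P_supp _ P_ge P_sum])
    qed
    moreover have "P (t, x) = x" if "t = 0"
    proof -
      have "d = 0" using that m_ge[OF s x] by (simp add: d_def \<delta>_def)
      then show ?thesis using Pu by (simp add: fun_eq_iff)
    qed
    moreover have "0 < M x" using M m_ge[OF s x] m0[OF s x] by simp
    ultimately show ?thesis using PK M by blast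
  qed
  have cases_K: "x \<in> realization C \<or> supp x \<in> X" if "x \<in> realization K" for x
    using that K_eq by (auto simp: realization_def)
  have P_K: "P (t, x) \<in> realization K" and M_ge: "0 \<le> M x"
    and P_C: "M x \<le> \<epsilon> * t \<Longrightarrow> P (t, x) \<in> realization C"
    if "x \<in> realization K" "t \<in> {0..1}" for x t
  proof -
    note or = cases_K[OF that(1)]
    have "P (t, x) \<in> realization K \<and> 0 \<le> M x \<and> (M x \<le> \<epsilon> * t \<longrightarrow> P (t, x) \<in> realization C)"
      using or
    proof
      assume 1: "x \<in> realization C"
      then show ?thesis using on_C[OF 1 that(2)] that(1) by simp
    next
      assume "supp x \<in> X"
      then show ?thesis using on_cell[OF that(1) _ that(2)] by auto
    qed
    then show "P (t, x) \<in> realization K" "0 \<le> M x"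
      "M x \<le> \<epsilon> * t \<Longrightarrow> P (t, x) \<in> realization C" by blast+
  qed
  have time: "t - M x / \<epsilon> \<in> {0..1}" if "x \<in> realization K" "t \<in> {0..1}" "M x \<le> \<epsilon> * t" for x t
    using that M_ge[OF that(1,2)] \<epsilon> by (auto simp: divide_le_eq mult.commute intro: order_trans[of _ t])
  have h_in: "h (t, x) \<in> realization K" if "x \<in> realization K" "t \<in> {0..1}" for x t
  proof (cases "M x \<le> \<epsilon> * t")
    case True
    then show ?thesis using H_in[OF time[OF that True] P_C[OF that True]] sub by (auto simp: h_def)
  next
    case False
    then show ?thesis using P_K[OF that] by (simp add: h_def)
  qed
  have cm: "continuous_on T (\<lambda>p. m \<sigma> (snd p))" if "\<sigma> \<in> X" for T :: "(real \<times> ('v \<Rightarrow> real)) set" and \<sigma>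
    unfolding m_def
    by (rule continuous_on_Min[OF finX'[OF that] neX[OF that]])
      (rule continuous_on_compose2[OF continuous_on_product_coordinates]; auto intro: continuous_intros)
  have cM: "continuous_on T (\<lambda>p. M (snd p))" for T :: "(real \<times> ('v \<Rightarrow> real)) set"
    unfolding M_def by (intro continuous_on_sum cm)
  have c\<delta>: "continuous_on T (\<delta> \<sigma>)" if "\<sigma> \<in> X" for T \<sigma>
    unfolding \<delta>_def by (intro continuous_intros cm that)
  have cD: "continuous_on T D" for T
    unfolding D_def by (intro continuous_intros c\<delta>)
  have cP: "continuous_on ?S P"
  proof (rule continuous_on_coordinatewise_then_product)
    fix u
    have "continuous_on ?S (\<lambda>p. snd p u)"
      by (rule continuous_on_compose2[OF continuous_on_product_coordinates]) (auto intro: continuous_intros)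
    moreover have "continuous_on ?S (\<lambda>p. \<Sum>\<sigma>\<in>X. if u \<in> \<sigma> then \<delta> \<sigma> p else 0)"
    proof (rule continuous_on_sum)
      fix \<sigma> assume "\<sigma> \<in> X"
      then show "continuous_on ?S (\<lambda>p. if u \<in> \<sigma> then \<delta> \<sigma> p else 0)"
        using c\<delta>[of \<sigma>] by (cases "u \<in> \<sigma>") auto
    qed
    moreover have "\<forall>p\<in>?S. 1 - D p \<noteq> 0" using D_le by fastforce
    ultimately show "continuous_on ?S (\<lambda>p. P p u)"
      unfolding P_def by (intro continuous_on_divide continuous_on_diff continuous_on_const cD)
  qed
  \<comment> \<open>On the seam \<open>M x = \<epsilon> * t\<close> the time left for
    \<open>H\<close> is 0, where \<open>H\<close> is the identity.\<close>
  have ch: "continuous_on ?S h"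
    unfolding h_def
  proof (rule continuous_on_cases_le)
    show "continuous_on {p \<in> ?S. M (snd p) - \<epsilon> * fst p \<le> 0} (\<lambda>p. H (fst p - M (snd p) / \<epsilon>, P p))"
    proof (rule continuous_on_compose2[OF contH])
      show "continuous_on {p \<in> ?S. M (snd p) - \<epsilon> * fst p \<le> 0} (\<lambda>p. (fst p - M (snd p) / \<epsilon>, P p))"
        using \<epsilon> by (intro continuous_intros cM continuous_on_subset[OF cP]) auto
      show "(\<lambda>p. (fst p - M (snd p) / \<epsilon>, P p)) ` {p \<in> ?S. M (snd p) - \<epsilon> * fst p \<le> 0}
              \<subseteq> {0..1} \<times> realization C"
      proof (rule image_subsetI)
        fix p assume p: "p \<in> {p \<in> ?S. M (snd p) - \<epsilon> * fst p \<le> 0}"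
        obtain t x where tx: "p = (t, x)" by (cases p)
        have tx': "x \<in> realization K" "t \<in> {0..1}" "M x \<le> \<epsilon> * t" using p tx by auto
        show "(fst p - M (snd p) / \<epsilon>, P p) \<in> {0..1} \<times> realization C"
          using time[OF tx'] P_C[OF tx'] unfolding tx by simp
      qed
    qed
    show "continuous_on {p \<in> ?S. 0 \<le> M (snd p) - \<epsilon> * fst p} P"
      by (rule continuous_on_subset[OF cP]) auto
    show "continuous_on ?S (\<lambda>p. M (snd p) - \<epsilon> * fst p)"
      by (intro continuous_intros cM)
    show "H (fst p - M (snd p) / \<epsilon>, P p) = P p" if "M (snd p) - \<epsilon> * fst p = 0" for p
    proof -
      have "fst p - M (snd p) / \<epsilon> = 0" using that \<epsilon> by (simp add: field_simps)
      then show ?thesis by (simp add: H0)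
    qed
  qed
  show ?thesis
  proof (rule that)
    show "continuous_map (prod_topology (top_of_set {0..1::real}) (top_of_set (realization K)))
       (top_of_set (realization K)) h"
      using ch h_in by (auto simp: continuous_map_subtopology_eu)
    show "h (0, x) = x" if x: "x \<in> realization K" for x
    proof (cases "x \<in> realization C")
      case True
      then show ?thesis using on_C[OF True, of 0] by (simp add: h_def H0)
    next
      case False
      then have "supp x \<in> X" using cases_K[OF x] by blast
      then show ?thesis using on_cell[OF x, of 0] by (simp add: h_def)
    qed
    show "h (t, x) \<in> realization C" if "t \<in> {0..1}" "x \<in> realization C" for t x
      using on_C[OF that(2,1)] H_in[OF that] that \<epsilon> by (simp add: h_def)
    show "h (1, x) = a" if "x \<in> realization C" for x
      using on_C[OF that, of 1] \<epsilon> by (simp add: h_def H1)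
  qed
qed

section \<open>Closed faces and the quotient by the collapsible part\<close>

lemma realization_Pow_eq:
  assumes "finite \<sigma>"
  shows "realization (Pow \<sigma>) = {x. (\<forall>v. 0 \<le> x v) \<and> (\<forall>v. v \<notin> \<sigma> \<longrightarrow> x v = 0) \<and> sum x \<sigma> = 1}"
proof -
  have "supp x \<subseteq> \<sigma> \<longleftrightarrow> (\<forall>v. v \<notin> \<sigma> \<longrightarrow> x v = 0)" for x by (auto simp: supp_def)
  moreover have "sum x (supp x) = sum x \<sigma>" if "supp x \<subseteq> \<sigma>" for x using sum_supp[OF assms that] .
  ultimately show ?thesis unfolding realization_def by auto
qed

text \<open>Coordinates outside \<open>\<sigma>\<close> are confined to \<open>{0}\<close>, so the
  simplex is closed in a product of compact sets even if there are infinitely many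
  coordinates.\<close>

lemma compact_realization_Pow:
  fixes \<sigma> :: "'v set"
  assumes fin: "finite \<sigma>"
  shows "compact (realization (Pow \<sigma>))"
proof -
  let ?B = "Pi\<^sub>E UNIV (\<lambda>v. if v \<in> \<sigma> then {0..1::real} else {0})"
  let ?F = "{x::'v \<Rightarrow> real. (\<forall>v. 0 \<le> x v) \<and> (\<forall>v. v \<notin> \<sigma> \<longrightarrow> x v = 0) \<and> sum x \<sigma> = 1}"
  have "compactin (product_topology (\<lambda>_::'v. euclidean) UNIV) ?B"
    by (subst compactin_PiE) auto
  then have B: "compact ?B" by (simp add: euclidean_product_topology)
  have "?F = (\<Inter>v. {x. 0 \<le> x v}) \<inter> (\<Inter>v\<in>-\<sigma>. {x. x v = 0}) \<inter> {x. sum x \<sigma> = 1}" by auto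
  also have "closed \<dots>"
    by (intro closed_Int closed_INT ballI closed_Collect_le closed_Collect_eq continuous_intros)
  finally have "closed ?F" .
  moreover
  have "?F \<subseteq> ?B"
  proof
    fix x assume x: "x \<in> ?F"
    have "x v \<le> 1" if "v \<in> \<sigma>" for v
      using x member_le_sum[OF that, of x] fin by auto
    then show "x \<in> ?B" using x by (auto simp: PiE_iff)
  qed
  then have "?B \<inter> ?F = ?F" by (rule Int_absorb1)
  ultimately have "compact ?F"
    using compact_Int_closed[OF B \<open>closed ?F\<close>] by (simp only:)
  then show ?thesis by (simp only: realization_Pow_eq[OF fin])
qed

lemma closedin_realization_face:
  "closedin (top_of_set (realization K)) {x \<in> realization K. supp x \<subseteq> \<rho>}"
proof -
  have "{x \<in> realization K. supp x \<subseteq> \<rho>} = realization K \<inter> (\<Inter>v\<in>-\<rho>. {x. x v = 0})"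
    by (auto simp: supp_def)
  moreover have "closed (\<Inter>v\<in>-\<rho>. {x::'a \<Rightarrow> real. x v = 0})"
    by (intro closed_INT ballI closed_Collect_eq continuous_intros)
  ultimately show ?thesis by (simp only: closedin_closed_Int)
qed

lemma closedin_realization_subcomplex:
  assumes "simplicial_complex C" "C \<subseteq> K"
  shows "closedin (top_of_set (realization K)) (realization C)"
proof -
  have "realization C = (\<Union>\<rho>\<in>C. {x \<in> realization K. supp x \<subseteq> \<rho>})"
    using assms simplicial_complexD(3)[OF assms(1)] by (auto simp: realization_def)
  then show ?thesis
    using simplicial_complexD(1)[OF assms(1)]
    by (simp only:) (intro closedin_Union finite_imageI; auto intro: closedin_realization_face)
qed

text \<open>The generated equivalence can be written out because only the base points are
  identified, all of them in one class.\<close>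

lemma glue_rel_wedge:
  "(a, b) \<in> glue_rel X (\<lambda>(i, x) (j, y). x = p i \<and> y = p j) \<longleftrightarrow>
     a = b \<or> (a \<in> topspace X \<and> b \<in> topspace X \<and> snd a = p (fst a) \<and> snd b = p (fst b))"
  (is "_ \<in> glue_rel X ?r \<longleftrightarrow> ?P b")
proof
  assume "(a, b) \<in> glue_rel X ?r"
  then have "equivclp (\<lambda>x y. x \<in> topspace X \<and> y \<in> topspace X \<and> ?r x y) a b"
    by (simp add: glue_rel_def)
  then show "?P b"
    by (induction rule: equivclp_induct) (auto simp: case_prod_unfold)
next
  assume "?P b"
  then consider "a = b" | "a \<in> topspace X \<and> b \<in> topspace X \<and> ?r a b"
    by (auto simp: case_prod_unfold)
  then show "(a, b) \<in> glue_rel X ?r"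
    by cases (auto simp: glue_rel_def intro: r_into_equivclp)
qed

text \<open>The map \<open>q\<close> sends \<open>C\<close> to the base point and the open cell
  number \<open>i\<close> onto the \<open>i\<close>-th sphere without its pole. It is a quotient map
  whose fibres are single points apart from \<open>C\<close>, and the contraction of
  \<open>C\<close>, extended to \<open>K\<close>, makes it a homotopy equivalence.\<close>

theorem near_collapsible_homotopy_equivalent_wedge:
  fixes K :: "'v set set"
  assumes K: "simplicial_complex K" and nc: "near_collapsible K C X" and ne: "C \<noteq> {}"
    and cs: "distinct cs" "set cs = X" "cs \<noteq> []"
  shows "top_of_set (realization K) homotopy_equivalent_space
           wedge_of_spheres (map (\<lambda>\<sigma>. int (card \<sigma>) - 1) cs)"
proof -
  have C: "collapsible C" and K_eq: "K = C \<union> X" and disj: "C \<inter> X = {}"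
    and faces: "\<And>\<sigma> \<tau>. \<sigma> \<in> X \<Longrightarrow> \<tau> \<subset> \<sigma> \<Longrightarrow> \<tau> \<in> C"
    using nc by (auto simp: near_collapsible_def)
  have scC: "simplicial_complex C" by (rule collapsible_imp_simplicial_complex[OF C])
  define r where "r = length cs"
  \<comment> \<open>The subtraction is exact: cells are nonempty, because the empty face lies in
    \<open>C\<close>.\<close>
  define d where "d = (\<lambda>i. card (cs ! i) - 1)"
  have r0: "0 < r" using cs by (simp add: r_def)
  have cell: "cs ! i \<in> X" if "i < r" for i using that cs(2) by (auto simp: r_def)
  have cell_fin: "finite (cs ! i)" if "i < r" for i
    using simplicial_complexD(2)[OF K] cell[OF that] K_eq by blast
  have empty_C: "{} \<in> C" using ne simplicial_complexD(3)[OF scC] by blast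
  have card_cell: "card (cs ! i) = Suc (d i)" if "i < r" for i
  proof -
    have "cs ! i \<noteq> {}" using cell[OF that] disj empty_C by (auto simp: disjoint_iff)
    then show ?thesis using cell_fin[OF that] by (simp add: d_def card_gt_0_iff)
  qed
  have face_C: "\<tau> \<in> C" if "i < r" "\<tau> \<subset> cs ! i" for i \<tau> using faces[OF cell[OF that(1)] that(2)] .
  have notin_C: "cs ! i \<notin> C" if "i < r" for i using cell[OF that] disj by blast

  define T where "T = sum_topology (\<lambda>i. std_sphere (map (\<lambda>\<sigma>. int (card \<sigma>) - 1) cs ! i)) {..<r}"
  define R :: "nat \<times> (nat \<Rightarrow> real) \<Rightarrow> nat \<times> (nat \<Rightarrow> real) \<Rightarrow> bool"
    where "R = (\<lambda>(i, x) (j, y). x = sphere_pole \<and> y = sphere_pole)"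
  define W where "W = wedge_of_spheres (map (\<lambda>\<sigma>. int (card \<sigma>) - 1) cs)"
  have W: "W = glue T R"
    by (simp add: W_def wedge_of_spheres_def wedge_sum_def T_def R_def r_def)
  have sphere_i: "std_sphere (map (\<lambda>\<sigma>. int (card \<sigma>) - 1) cs ! i) = nsphere (d i)" if "i < r" for i
    using card_cell[OF that] that by (simp add: std_sphere_def r_def)
  have top_T: "a \<in> topspace T \<longleftrightarrow> fst a < r \<and> snd a \<in> topspace (nsphere (d (fst a)))" for a
    using sphere_i by (cases a) (auto simp: T_def)
  have closed_T: "closedin T U \<longleftrightarrow> U \<subseteq> topspace T \<and> (\<forall>i<r. closedin (nsphere (d i)) {x. (i, x) \<in> U})" for U
    unfolding T_def closedin_sum_topology topspace_sum_topology using sphere_i by auto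
  define cls where "cls = (\<lambda>a. glue_rel T R `` {a})"
  have cls_quot: "quotient_map T W cls" unfolding W cls_def by (rule quotient_map_glue)
  have cls_eq: "cls a = cls b \<longleftrightarrow> a = b \<or> (snd a = sphere_pole \<and> snd b = sphere_pole)"
    if "a \<in> topspace T" "b \<in> topspace T" for a b
    unfolding cls_def eq_equiv_class_iff[OF equiv_glue_rel UNIV_I UNIV_I] R_def
    using that glue_rel_wedge[of a b T "\<lambda>_. sphere_pole"] by simp
  define base where "base = cls (0, sphere_pole)"
  have pole_T: "(i, sphere_pole) \<in> topspace T" if "i < r" for i
    using that sphere_pole_in_nsphere by (simp add: top_T)
  have cls_base: "cls (i, sphere_pole) = base" if "i < r" for i
    unfolding base_def using cls_eq[OF pole_T[OF that] pole_T[OF r0]] by simp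

  have "\<forall>i\<in>{..<r}. \<exists>\<theta>. sphere_collapse (cs ! i) (d i) \<theta>"
  proof
    fix i assume "i \<in> {..<r}"
    then show "\<exists>\<theta>. sphere_collapse (cs ! i) (d i) \<theta>"
      by (intro sphere_collapse_exists card_cell) simp
  qed
  from bchoice[OF this] obtain \<theta> where
    \<theta>: "\<forall>i\<in>{..<r}. sphere_collapse (cs ! i) (d i) (\<theta> i)" ..
  define F where "F = (\<lambda>i. realization (Pow (cs ! i)))"
  have \<theta>_cont: "continuous_on (F i) (\<theta> i)"
    and \<theta>_in: "x \<in> F i \<Longrightarrow> \<theta> i x \<in> topspace (nsphere (d i))"
    and \<theta>_pole: "x \<in> F i \<Longrightarrow> \<theta> i x = sphere_pole \<longleftrightarrow> supp x \<noteq> cs ! i"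
    and \<theta>_inj: "\<lbrakk>x \<in> F i; y \<in> F i; supp x = cs ! i; supp y = cs ! i; \<theta> i x = \<theta> i y\<rbrakk> \<Longrightarrow> x = y"
    and \<theta>_surj: "\<lbrakk>p \<in> topspace (nsphere (d i)); p \<noteq> sphere_pole\<rbrakk> \<Longrightarrow> \<exists>x\<in>F i. supp x = cs ! i \<and> \<theta> i x = p"
    if "i < r" for i x y p
    using bspec[OF \<theta>, of i] that unfolding F_def sphere_collapse_def by simp_all
  let ?K = "realization K" and ?C = "realization C"
  have F_eq: "F i = {x \<in> ?K. supp x \<subseteq> cs ! i}" if "i < r" for i
  proof -
    have "\<tau> \<in> K" if "\<tau> \<subseteq> cs ! i" for \<tau>
      using simplicial_complexD(3)[OF K _ that] cell[OF \<open>i < r\<close>] K_eq by blast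
    then show ?thesis unfolding F_def realization_def by auto
  qed
  have inj_cs: "inj_on ((!) cs) {..<r}" using cs(1) by (simp add: inj_on_nth r_def)
  define idx where "idx = the_inv_into {..<r} ((!) cs)"
  have idx: "idx (cs ! i) = i" if "i < r" for i
    unfolding idx_def using the_inv_into_f_f[OF inj_cs] that by simp
  define q where "q = (\<lambda>x. if supp x \<in> C then base else cls (idx (supp x), \<theta> (idx (supp x)) x))"
  have q_F: "q x = cls (i, \<theta> i x)" if i: "i < r" and x: "x \<in> F i" for i x
  proof (cases "supp x = cs ! i")
    case True
    then show ?thesis using idx[OF i] notin_C[OF i] by (simp add: q_def)
  next
    case False
    then have "supp x \<in> C" using face_C[OF i] x F_eq[OF i] by blast
    then show ?thesis using \<theta>_pole[OF i x] False cls_base[OF i] by (simp add: q_def)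
  qed
  have q_C: "q x = base" if "x \<in> ?C" for x using realizationD(1)[OF that] by (simp add: q_def)
  have cases_K: "x \<in> ?C \<or> (\<exists>i<r. x \<in> F i \<and> supp x = cs ! i)" if x: "x \<in> ?K" for x
  proof (cases "supp x \<in> C")
    case True
    then show ?thesis using x by (simp add: realization_def)
  next
    case False
    then have "supp x \<in> set cs" using realizationD(1)[OF x] K_eq cs(2) by simp
    then obtain i where i: "i < r" "supp x = cs ! i" by (metis in_set_conv_nth r_def)
    then have "x \<in> F i" using x F_eq by simp
    then show ?thesis using i by blast
  qed
  have subC: "?C \<subseteq> ?K" using K_eq by (intro realization_mono) simp
  have theta_T: "(i, \<theta> i x) \<in> topspace T" if "i < r" "x \<in> F i" for i x
    using \<theta>_in[OF that] that by (simp add: top_T)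

  \<comment> \<open>\<open>q\<close> is pasted from the closed cells and \<open>C\<close>; the index
    \<open>r\<close>, one beyond the cells, stands for \<open>C\<close>.\<close>
  have q_cont: "continuous_map (top_of_set ?K) W q"
  proof (rule pasting_lemma_closed[where I = "{..r}" and T = "\<lambda>i. if i < r then F i else ?C"
        and f = "\<lambda>i. if i < r then (\<lambda>x. cls (i, \<theta> i x)) else (\<lambda>x. base)"])
    show "closedin (top_of_set ?K) (if i < r then F i else ?C)" for i
      using closedin_realization_face[of K "cs ! i"] closedin_realization_subcomplex[OF scC] F_eq K_eq
      by simp
    show "continuous_map (subtopology (top_of_set ?K) (if i < r then F i else ?C)) W
            (if i < r then (\<lambda>x. cls (i, \<theta> i x)) else (\<lambda>x. base))" for i
    proof (cases "i < r")
      case True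
      have "F i \<subseteq> ?K" using F_eq[OF True] by blast
      then have sub: "subtopology (top_of_set ?K) (F i) = top_of_set (F i)"
        by (simp add: subtopology_subtopology Int_absorb1)
      have "continuous_map (top_of_set (F i)) (nsphere (d i)) (\<theta> i)"
        using \<theta>_cont[OF True] \<theta>_in[OF True]
        by (auto simp: nsphere_eq_top_of_set continuous_map_subtopology_eu)
      moreover have "continuous_map (nsphere (d i)) T (\<lambda>x. (i, x))"
        using continuous_map_component_injection[of i "{..<r}"
            "\<lambda>i. std_sphere (map (\<lambda>\<sigma>. int (card \<sigma>) - 1) cs ! i)"] True sphere_i[OF True]
        by (simp add: T_def)
      ultimately have "continuous_map (top_of_set (F i)) W (cls \<circ> ((\<lambda>x. (i, x)) \<circ> \<theta> i))"
        by (intro continuous_map_compose[OF _ quotient_imp_continuous_map[OF cls_quot]]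
            continuous_map_compose)
      then show ?thesis using True sub by (simp add: o_def)
    next
      case False
      have "base \<in> topspace W"
        unfolding base_def using quotient_imp_surjective_map[OF cls_quot] pole_T[OF r0] by blast
      then show ?thesis using False by simp
    qed
    have agree: "(if i < r then (\<lambda>x. cls (i, \<theta> i x)) else (\<lambda>x. base)) x = q x"
      if "x \<in> (if i < r then F i else ?C)" for i x
      using that q_F q_C by (cases "i < r") simp_all
    show "(if i < r then (\<lambda>x. cls (i, \<theta> i x)) else (\<lambda>x. base)) x =
        (if j < r then (\<lambda>x. cls (j, \<theta> j x)) else (\<lambda>x. base)) x"
      if "x \<in> topspace (top_of_set ?K) \<inter> (if i < r then F i else ?C) \<inter> (if j < r then F j else ?C)" for i j x
      by (rule trans[OF agree[OF IntD2[OF IntD1[OF that]]] agree[OF IntD2[OF that], symmetric]])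
    show "\<exists>j. j \<in> {..r} \<and> x \<in> (if j < r then F j else ?C) \<and>
        q x = (if j < r then (\<lambda>x. cls (j, \<theta> j x)) else (\<lambda>x. base)) x"
      if "x \<in> topspace (top_of_set ?K)" for x
    proof -
      have "x \<in> ?K" using that by simp
      then consider "x \<in> ?C" | i where "i < r" "x \<in> F i" using cases_K by blast
      then show ?thesis
      proof cases
        case 1
        then show ?thesis using q_C by (intro exI[of _ r]) simp
      next
        case (2 i)
        then show ?thesis using q_F by (intro exI[of _ i]) simp
      qed
    qed
  qed simp
  obtain v where v: "{v} \<in> C" using collapsible_has_vertex[OF C ne] by blast
  have vC: "(\<lambda>u. if u = v then 1 else 0) \<in> ?C"
  proof -
    have "supp (\<lambda>u. if u = v then 1 else 0) = {v}" by (auto simp: supp_def)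
    then show ?thesis using v by (intro realizationI[of "{v}"]) auto
  qed
  \<comment> \<open>A cell that is a single vertex does not attain the pole, so the base point has
    to be hit from \<open>C\<close>.\<close>
  have q_lift: "\<exists>x\<in>F i \<union> ?C. q x = cls (i, p)" if i: "i < r" and p: "p \<in> topspace (nsphere (d i))" for i p
  proof (cases "p = sphere_pole")
    case True
    then show ?thesis using q_C[OF vC] vC cls_base[OF i] by auto
  next
    case False
    then show ?thesis using \<theta>_surj[OF i p False] q_F[OF i] by auto
  qed
  have FK: "F i \<union> ?C \<subseteq> ?K" if "i < r" for i using F_eq[OF that] subC by blast
  have q_surj: "q ` ?K = topspace W"
  proof
    show "q ` ?K \<subseteq> topspace W" using q_cont by (auto simp: continuous_map_def)
    show "topspace W \<subseteq> q ` ?K"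
    proof
      fix c assume "c \<in> topspace W"
      then obtain a where a: "a \<in> topspace T" "c = cls a"
        using quotient_imp_surjective_map[OF cls_quot] by blast
      then have a': "fst a < r" "snd a \<in> topspace (nsphere (d (fst a)))" by (simp_all add: top_T)
      obtain x where "x \<in> F (fst a) \<union> ?C" "q x = cls (fst a, snd a)"
        using q_lift[OF a'] by blast
      then show "c \<in> q ` ?K" using FK[OF a'(1)] a(2) by auto
    qed
  qed
  have q_quot: "quotient_map (top_of_set ?K) W q"
    unfolding quotient_map_closedin
  proof (intro conjI allI impI)
    show "q ` topspace (top_of_set ?K) = topspace W" using q_surj by simp
    fix U assume U: "U \<subseteq> topspace W"
    show "closedin (top_of_set ?K) {x. x \<in> topspace (top_of_set ?K) \<and> q x \<in> U} = closedin W U"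
    proof
      assume "closedin W U"
      then show "closedin (top_of_set ?K) {x. x \<in> topspace (top_of_set ?K) \<and> q x \<in> U}"
        using closedin_continuous_map_preimage[OF q_cont] by simp
    next
      assume cl: "closedin (top_of_set ?K) {x. x \<in> topspace (top_of_set ?K) \<and> q x \<in> U}"
      let ?V = "{a. a \<in> topspace T \<and> cls a \<in> U}"
      have "closedin (nsphere (d i)) {p. (i, p) \<in> ?V}" if i: "i < r" for i
      proof -
        \<comment> \<open>The pole is listed separately because the image of the cell may miss it.
          The other part is the image of a compact set, so the union is closed.\<close>
        have eq: "{p. (i, p) \<in> ?V} = \<theta> i ` {x \<in> F i. q x \<in> U} \<union> (if base \<in> U then {sphere_pole} else {})"
        proof (intro set_eqI iffI)
          fix p assume "p \<in> {p. (i, p) \<in> ?V}"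
          then have p: "p \<in> topspace (nsphere (d i))" "cls (i, p) \<in> U" by (auto simp: top_T)
          show "p \<in> \<theta> i ` {x \<in> F i. q x \<in> U} \<union> (if base \<in> U then {sphere_pole} else {})"
          proof (cases "p = sphere_pole")
            case True
            then show ?thesis using p(2) cls_base[OF i] by simp
          next
            case False
            obtain x where "x \<in> F i" "\<theta> i x = p" using \<theta>_surj[OF i p(1) False] by blast
            then show ?thesis using p(2) q_F[OF i] by auto
          qed
        next
          fix p assume p: "p \<in> \<theta> i ` {x \<in> F i. q x \<in> U} \<union> (if base \<in> U then {sphere_pole} else {})"
          then consider x where "x \<in> F i" "q x \<in> U" "p = \<theta> i x" | "base \<in> U" "p = sphere_pole"
            by (cases "base \<in> U") auto
          then show "p \<in> {p. (i, p) \<in> ?V}"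
          proof cases
            case 1
            then show ?thesis using theta_T[OF i] q_F[OF i] by simp
          next
            case 2
            then show ?thesis using pole_T[OF i] cls_base[OF i] by simp
          qed
        qed
        have "closedin (top_of_set (F i)) {x \<in> F i. q x \<in> U}"
        proof -
          have "F i \<subseteq> ?K" using FK[OF i] by blast
          then have eqi: "{x \<in> F i. q x \<in> U} = {x. x \<in> topspace (top_of_set ?K) \<and> q x \<in> U} \<inter> F i"
            by auto
          have "closedin (subtopology (top_of_set ?K) (F i)) {x \<in> F i. q x \<in> U}"
            unfolding closedin_subtopology[of _ "F i"] eqi by (intro exI conjI) (rule cl, rule refl)
          moreover have "subtopology (top_of_set ?K) (F i) = top_of_set (F i)"
            using \<open>F i \<subseteq> ?K\<close> by (simp add: subtopology_subtopology Int_absorb1)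
          ultimately show ?thesis by (simp only:)
        qed
        moreover have "compact (F i)" unfolding F_def by (rule compact_realization_Pow[OF cell_fin[OF i]])
        ultimately have "compact {x \<in> F i. q x \<in> U}" using closedin_compact by blast
        then have "compact (\<theta> i ` {x \<in> F i. q x \<in> U})"
          by (rule compact_continuous_image[rotated]) (rule continuous_on_subset[OF \<theta>_cont[OF i]], auto)
        then have "closed {p. (i, p) \<in> ?V}"
          unfolding eq by (intro closed_Un compact_imp_closed) auto
        moreover have "{p. (i, p) \<in> ?V} \<subseteq> topspace (nsphere (d i))" by (auto simp: top_T)
        ultimately show ?thesis
          unfolding nsphere_eq_top_of_set by (simp add: closed_subset)
      qed
      then have "closedin T ?V" unfolding closed_T by blast
      then show "closedin W U" using cls_quot U unfolding quotient_map_closedin by blast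
    qed
  qed
  have q_fibre: "x = y \<or> (x \<in> ?C \<and> y \<in> ?C)" if x: "x \<in> ?K" and y: "y \<in> ?K" and eq: "q x = q y" for x y
  proof -
    have not_base: "q z \<noteq> base" if "i < r" "z \<in> F i" "supp z = cs ! i" for i z
      using that cls_eq[OF theta_T[OF that(1,2)] pole_T[OF r0]] q_F \<theta>_pole[OF that(1,2)]
      by (auto simp: base_def)
    consider "x \<in> ?C" "y \<in> ?C" | i where "i < r" "x \<in> F i" "supp x = cs ! i" "y \<in> ?C"
      | i where "i < r" "y \<in> F i" "supp y = cs ! i" "x \<in> ?C"
      | i j where "i < r" "x \<in> F i" "supp x = cs ! i" "j < r" "y \<in> F j" "supp y = cs ! j"
      using cases_K[OF x] cases_K[OF y] by blast
    then show ?thesis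
    proof cases
      case (4 i j)
      have "cls (i, \<theta> i x) = cls (j, \<theta> j y)" using eq q_F 4 by simp
      moreover have "\<theta> i x \<noteq> sphere_pole" using \<theta>_pole[OF 4(1,2)] 4(3) by simp
      ultimately have "(i, \<theta> i x) = (j, \<theta> j y)"
        using cls_eq[OF theta_T[OF 4(1,2)] theta_T[OF 4(4,5)]] by auto
      then have ij: "i = j" and th: "\<theta> i x = \<theta> i y" by auto
      have "y \<in> F i" "supp y = cs ! i" using 4(5,6) ij by simp_all
      then show ?thesis using \<theta>_inj[OF 4(1,2) _ 4(3) _ th] by simp
    next
      case 1
      then show ?thesis by simp
    next
      case (2 i)
      then show ?thesis using not_base[OF 2(1-3)] q_C[OF 2(4)] eq by simp
    next
      case (3 i)
      then show ?thesis using not_base[OF 3(1-3)] q_C[OF 3(4)] eq by simp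
    qed
  qed
  obtain h a where h: "continuous_map (prod_topology (top_of_set {0..1::real}) (top_of_set ?K)) (top_of_set ?K) h"
    "\<And>x. x \<in> ?K \<Longrightarrow> h (0, x) = x"
    "\<And>t x. \<lbrakk>t \<in> {0..1}; x \<in> ?C\<rbrakk> \<Longrightarrow> h (t, x) \<in> ?C"
    "\<And>x. x \<in> ?C \<Longrightarrow> h (1, x) = a"
    by (rule near_collapsible_extend_contraction[OF K nc ne]) (assumption | rule that)+
  have "top_of_set ?K homotopy_equivalent_space W"
  proof (rule collapse_homotopy_equivalence[OF q_quot h(1)])
    show "h (0, x) = x" if "x \<in> topspace (top_of_set ?K)" for x using h(2) that by simp
    show "h (1, x) = h (1, y)"
      if "x \<in> topspace (top_of_set ?K)" "y \<in> topspace (top_of_set ?K)" "q x = q y" for x y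
      using q_fibre[of x y] that h(4) by auto
    show "q (h (t, x)) = q (h (t, y))"
      if "t \<in> {0..1}" "x \<in> topspace (top_of_set ?K)" "y \<in> topspace (top_of_set ?K)" "q x = q y" for t x y
      using q_fibre[of x y] that(2-4) h(3)[OF that(1)] q_C by auto
  qed
  then show ?thesis by (simp only: W_def)
qed

section \<open>Edges and sides of trees\<close>

lemma edge_connected_refl [simp]: "edge_connected E u u"
  by (simp add: edge_connected_def)

lemma edge_connected_trans:
  "edge_connected E u v \<Longrightarrow> edge_connected E v w \<Longrightarrow> edge_connected E u w"
  unfolding edge_connected_def by (rule rtranclp_trans)

lemma edge_connected_edge: "{u, v} \<in> E \<Longrightarrow> edge_connected E u v"
  unfolding edge_connected_def by (rule r_into_rtranclp)

lemma edge_connected_step: "edge_connected E u v \<Longrightarrow> {v, w} \<in> E \<Longrightarrow> edge_connected E u w"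
  by (rule edge_connected_trans[OF _ edge_connected_edge])

lemma edge_connected_induct [consumes 1, case_names refl step]:
  assumes "edge_connected E u v" "P u"
    and "\<And>y z. \<lbrakk>edge_connected E u y; {y, z} \<in> E; P y\<rbrakk> \<Longrightarrow> P z"
  shows "P v"
  using assms(1) unfolding edge_connected_def
  by (induction rule: rtranclp_induct) (use assms(2,3) in \<open>auto simp: edge_connected_def\<close>)

lemma edge_connected_sym: "edge_connected E u v \<Longrightarrow> edge_connected E v u"
proof (induction rule: edge_connected_induct)
  case (step y z)
  have "edge_connected E z y" using step(2) by (intro edge_connected_edge) (simp add: insert_commute)
  then show ?case using step(3) by (rule edge_connected_trans)
qed simp

lemma edge_connected_mono: "edge_connected E u v \<Longrightarrow> E \<subseteq> E' \<Longrightarrow> edge_connected E' u v"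
  by (induction rule: edge_connected_induct) (auto intro: edge_connected_step)

text \<open>The path grows edge by edge; on a return to an earlier vertex it is cut off
  there.\<close>

lemma edge_connected_imp_path:
  assumes "edge_connected E u v"
  shows "\<exists>p. p \<noteq> [] \<and> distinct p \<and> hd p = u \<and> last p = v \<and>
           (\<forall>i. Suc i < length p \<longrightarrow> {p ! i, p ! Suc i} \<in> E)"
  using assms
proof (induction rule: edge_connected_induct)
  case refl
  show ?case by (intro exI[of _ "[u]"]) simp
next
  case (step y z)
  then obtain p where p: "p \<noteq> []" "distinct p" "hd p = u" "last p = y"
    "\<And>i. Suc i < length p \<Longrightarrow> {p ! i, p ! Suc i} \<in> E" by blast
  show ?case
  proof (cases "z \<in> set p")
    case True
    then obtain j where j: "j < length p" "p ! j = z" by (auto simp: in_set_conv_nth)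
    let ?q = "take (Suc j) p"
    have "last ?q = z" using j by (simp add: take_Suc_conv_app_nth)
    moreover have "hd ?q = u" using p by (simp add: hd_take)
    moreover have "\<forall>i. Suc i < length ?q \<longrightarrow> {?q ! i, ?q ! Suc i} \<in> E" using p(5) by simp
    ultimately show ?thesis using p by (intro exI[of _ ?q]) auto
  next
    case False
    have "{(p @ [z]) ! i, (p @ [z]) ! Suc i} \<in> E" if "Suc i < length (p @ [z])" for i
    proof (cases "Suc i < length p")
      case True
      then show ?thesis using p(5) by (simp add: nth_append)
    next
      case False
      then have "i = length p - 1" "i < length p" using that p(1) by auto
      then show ?thesis using p(1,4) step(2) by (auto simp: nth_append last_conv_nth)
    qed
    then show ?thesis using p False by (intro exI[of _ "p @ [z]"]) auto
  qed
qed

text \<open>A simple path between the ends that avoids the edge closes up to a cycle. It has at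
  least three vertices because a path with two would be the removed edge.\<close>

lemma acyclic_imp_bridge:
  assumes acyclic: "\<nexists>c. is_cycle E c" and e: "{u, v} \<in> E" "u \<noteq> v"
  shows "\<not> edge_connected (E - {{u, v}}) u v"
proof
  assume "edge_connected (E - {{u, v}}) u v"
  from edge_connected_imp_path[OF this] obtain p where
    p: "p \<noteq> []" "distinct p" "hd p = u" "last p = v"
    "\<And>i. Suc i < length p \<Longrightarrow> {p ! i, p ! Suc i} \<in> E - {{u, v}}" by blast
  have hl: "p ! 0 = u" "p ! (length p - 1) = v"
    using p(1,3,4) by (simp_all add: hd_conv_nth last_conv_nth)
  have "length p \<noteq> 0" using p(1) by simp
  moreover have "length p \<noteq> 1" using hl e(2) by auto
  moreover have "length p \<noteq> 2" using hl p(5)[of 0] by auto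
  ultimately have len: "3 \<le> length p" by linarith
  have "{p ! i, p ! (Suc i mod length p)} \<in> E" if "i < length p" for i
  proof (cases "Suc i < length p")
    case True
    then show ?thesis using p(5)[OF True] by simp
  next
    case False
    then have "Suc i = length p" using that by simp
    then have "i = length p - 1" "Suc i mod length p = 0" by simp_all
    then have "p ! i = v" "Suc i mod length p = 0" using hl by simp_all
    then show ?thesis using hl e(1) by (simp add: insert_commute)
  qed
  then have "is_cycle E p" using len p(2) by (simp add: is_cycle_def)
  then show False using acyclic by blast
qed

lemma edge_connected_remove_edge:
  assumes "edge_connected E x u"
  shows "edge_connected (E - {{u, v}}) x u \<or> edge_connected (E - {{u, v}}) x v"
  using edge_connected_sym[OF assms]
proof (induction rule: edge_connected_induct)
  case (step y z)
  show ?case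
  proof (cases "{y, z} = {u, v}")
    case True
    then have "z = u \<or> z = v" by (auto simp: doubleton_eq_iff)
    then show ?thesis by auto
  next
    case False
    then have "edge_connected (E - {{u, v}}) z y"
      using step(2) by (intro edge_connected_edge) (auto simp: insert_commute)
    then show ?thesis using step(3) edge_connected_trans by blast
  qed
qed simp

text \<open>Numbers which are not vertices belong to every side.\<close>

definition side :: "nat set set \<Rightarrow> nat \<Rightarrow> nat set \<Rightarrow> nat set" where
  "side E r e = {v. \<not> edge_connected (E - {e}) r v}"

text \<open>In a rooted tree exactly one end of an edge lies on its side, so \<open>SOME\<close> has
  a unique choice, here and in \<open>parent\<close>; \<open>edge_ends\<close> establishes
  this.\<close>

definition child :: "nat set set \<Rightarrow> nat \<Rightarrow> nat set \<Rightarrow> nat" where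
  "child E r e = (SOME c. c \<in> e \<and> c \<in> side E r e)"

definition parent :: "nat set set \<Rightarrow> nat \<Rightarrow> nat set \<Rightarrow> nat" where
  "parent E r e = (SOME c. c \<in> e \<and> c \<notin> side E r e)"

lemma side_connected_iff: "edge_connected (E - {e}) u v \<Longrightarrow> u \<in> side E r e \<longleftrightarrow> v \<in> side E r e"
  unfolding side_def mem_Collect_eq by (meson edge_connected_sym edge_connected_trans)

lemma side_edge_iff: "{a, b} \<in> E \<Longrightarrow> {a, b} \<noteq> e \<Longrightarrow> a \<in> side E r e \<longleftrightarrow> b \<in> side E r e"
  by (rule side_connected_iff[OF edge_connected_edge]) simp

lemma root_notin_side [simp]: "r \<notin> side E r e"
  by (simp add: side_def)

lemma finite_tree_edgeD: "finite_tree V E \<Longrightarrow> {a, b} \<in> E \<Longrightarrow> a \<in> V \<and> b \<in> V \<and> a \<noteq> b"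
  unfolding finite_tree_def by (metis card_2_iff doubleton_eq_iff insert_subset)

locale rooted_tree =
  fixes V :: "nat set" and E :: "nat set set" and r :: nat
  assumes tree: "finite_tree V E" and root: "r \<in> V"
begin

lemma finite_V: "finite V" and finite_E: "finite E"
  and connected: "u \<in> V \<Longrightarrow> v \<in> V \<Longrightarrow> edge_connected E u v"
proof -
  show "finite V" using tree by (simp add: finite_tree_def)
  then show "finite E"
    using tree by (intro finite_subset[of E "Pow V"]) (auto simp: finite_tree_def)
  show "u \<in> V \<Longrightarrow> v \<in> V \<Longrightarrow> edge_connected E u v" using tree by (simp add: finite_tree_def)
qed

lemmas edgeD = finite_tree_edgeD[OF tree]

lemma edge_ex: "e \<in> E \<Longrightarrow> \<exists>a b. e = {a, b}"
  using tree unfolding finite_tree_def by (metis card_2_iff)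

lemma bridge: "{a, b} \<in> E \<Longrightarrow> \<not> edge_connected (E - {{a, b}}) a b"
  using acyclic_imp_bridge edgeD tree unfolding finite_tree_def by blast

lemma edge_ends:
  assumes "e \<in> E"
  shows "e = {parent E r e, child E r e}" "child E r e \<in> side E r e" "parent E r e \<notin> side E r e"
    "parent E r e \<in> V" "child E r e \<in> V"
proof -
  obtain a b where ab: "e = {a, b}" using edge_ex[OF assms] by blast
  have abV: "a \<in> V" "b \<in> V" using edgeD ab assms by blast+
  have "a \<in> side E r e \<longleftrightarrow> b \<notin> side E r e"
  proof -
    have "\<not> (a \<notin> side E r e \<and> b \<notin> side E r e)"
      using bridge[of a b] ab assms edge_connected_sym edge_connected_trans
      unfolding side_def mem_Collect_eq by metis
    moreover have "a \<notin> side E r e \<or> b \<notin> side E r e"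
      using edge_connected_remove_edge[OF connected[OF root abV(1)], of b] ab
      by (auto simp: side_def)
    ultimately show ?thesis by blast
  qed
  then have ex: "\<exists>c. c \<in> e \<and> c \<in> side E r e" "\<exists>p. p \<in> e \<and> p \<notin> side E r e" using ab by auto
  have c: "child E r e \<in> e \<and> child E r e \<in> side E r e"
    and p: "parent E r e \<in> e \<and> parent E r e \<notin> side E r e"
    unfolding child_def parent_def using someI_ex[OF ex(1)] someI_ex[OF ex(2)] by simp_all
  then show "child E r e \<in> side E r e" "parent E r e \<notin> side E r e" by simp_all
  have "parent E r e \<noteq> child E r e" using c p by metis
  then show "e = {parent E r e, child E r e}" using c p ab by auto
  show "parent E r e \<in> V" "child E r e \<in> V" using c p ab abV by auto
qed

lemma child_eqI: "e \<in> E \<Longrightarrow> c \<in> e \<Longrightarrow> c \<in> side E r e \<Longrightarrow> c = child E r e"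
  by (metis edge_ends(1,3) insertE singletonD)

lemma parent_eqI: "e \<in> E \<Longrightarrow> c \<in> e \<Longrightarrow> c \<notin> side E r e \<Longrightarrow> c = parent E r e"
  by (metis edge_ends(1,2) insertE singletonD)

lemma child_connected:
  assumes e: "e \<in> E" and v: "v \<in> V" "v \<in> side E r e"
  shows "edge_connected (E - {e}) (child E r e) v"
proof -
  let ?c = "child E r e" and ?p = "parent E r e"
  have eq: "e = {?c, ?p}" using edge_ends(1)[OF e] by (simp add: insert_commute)
  have "edge_connected (E - {e}) v ?c \<or> edge_connected (E - {e}) v ?p"
    using edge_connected_remove_edge[OF connected[OF v(1) edge_ends(5)[OF e]], of ?p] eq by simp
  moreover have "\<not> edge_connected (E - {e}) v ?p"
    using side_connected_iff v(2) edge_ends(3)[OF e] by blast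
  ultimately show ?thesis using edge_connected_sym by blast
qed

lemma parent_in_side_iff:
  "e \<in> E \<Longrightarrow> e \<noteq> e' \<Longrightarrow> parent E r e \<in> side E r e' \<longleftrightarrow> child E r e \<in> side E r e'"
  using side_edge_iff edge_ends(1) by metis

text \<open>A walk from the root avoiding \<open>e'\<close> stays off the side of \<open>e'\<close>,
  so it cannot traverse \<open>e\<close>, which has an end there.\<close>

lemma side_nested:
  assumes e: "e \<in> E" "e \<noteq> e'" and c: "child E r e \<in> side E r e'"
  shows "side E r e \<subseteq> side E r e'"
proof
  fix v assume v: "v \<in> side E r e"
  show "v \<in> side E r e'"
  proof (rule ccontr)
    assume "v \<notin> side E r e'"
    then have "edge_connected (E - {e'}) r v" by (simp add: side_def)
    then have "edge_connected (E - {e}) r v"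
    proof (induction rule: edge_connected_induct)
      case (step y z)
      have y: "y \<notin> side E r e'" using step(1) by (simp add: side_def)
      have z: "z \<notin> side E r e'" using edge_connected_step[OF step(1,2)] by (simp add: side_def)
      have "{y, z} \<noteq> e" using y z c edge_ends(1)[OF e(1)] by (auto simp: doubleton_eq_iff)
      then show ?case using step(2,3) by (intro edge_connected_step[of _ r y z]) auto
    qed simp
    then show False using v by (simp add: side_def)
  qed
qed

text \<open>Antisymmetry of the order on edges: the upper end of \<open>e\<close> is on the side of
  \<open>e'\<close> along with the lower end, but not on the side of \<open>e\<close>.\<close>

lemma side_not_nested:
  assumes e: "e \<in> E" "e' \<in> E" "e \<noteq> e'" and c: "child E r e \<in> side E r e'"
  shows "child E r e' \<notin> side E r e"
proof
  assume "child E r e' \<in> side E r e"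
  then have "side E r e' \<subseteq> side E r e" using e by (intro side_nested) auto
  moreover have "parent E r e \<in> side E r e'" using parent_in_side_iff[OF e(1,3)] c by simp
  ultimately show False using edge_ends(3)[OF e(1)] by blast
qed

text \<open>Consider a walk from the lower end of \<open>e\<close> to \<open>v\<close> that avoids
  \<open>e\<close>. If it crosses \<open>e'\<close>, the lower end of \<open>e'\<close> is on the
  side of \<open>e\<close>; if not, its start is on the side of \<open>e'\<close>, as
  \<open>v\<close> is.\<close>

lemma side_cases:
  assumes e: "e \<in> E" "e' \<in> E" "e \<noteq> e'" and v: "v \<in> V" "v \<in> side E r e" "v \<in> side E r e'"
  shows "child E r e \<in> side E r e' \<or> child E r e' \<in> side E r e"
proof (rule ccontr)
  assume neg: "\<not> ?thesis"
  have "v \<notin> side E r e'"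
    using child_connected[OF e(1) v(1,2)]
  proof (induction rule: edge_connected_induct)
    case refl
    show ?case using neg by simp
  next
    case (step y z)
    have "{y, z} \<noteq> e'"
    proof
      assume e': "{y, z} = e'"
      then have "child E r e' = y \<or> child E r e' = z" using edge_ends(1)[OF e(2)] by blast
      moreover have "edge_connected (E - {e}) (child E r e) z"
        using edge_connected_step[OF step(1,2)] .
      ultimately have "edge_connected (E - {e}) (child E r e) (child E r e')" using step(1) by auto
      then have "child E r e' \<in> side E r e"
        using side_connected_iff edge_ends(2)[OF e(1)] by blast
      then show False using neg by simp
    qed
    then show ?case using side_edge_iff[of y z E e' r] step(2,3) by simp
  qed
  then show False using v(3) by simp
qed

text \<open>A smallest edge set between \<open>F\<close> and \<open>E\<close> connecting
  \<open>u\<close> to \<open>v\<close> has an edge outside \<open>F\<close>. This edge separates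
  \<open>u\<close> from \<open>v\<close>, since a detour around it would connect its own ends and
  contradict \<open>bridge\<close>. It follows that vertices not separated by any edge outside
  \<open>F\<close> are joined within \<open>F\<close>.\<close>

lemma not_connected_imp_edge:
  assumes F: "F \<subseteq> E" and uv: "u \<in> V" "v \<in> V" "\<not> edge_connected F u v"
  shows "\<exists>e\<in>E - F. u \<in> side E r e \<longleftrightarrow> v \<notin> side E r e"
proof -
  let ?P = "\<lambda>G. F \<subseteq> G \<and> G \<subseteq> E \<and> edge_connected G u v"
  have "?P E" using F connected uv by simp
  then obtain G where G: "?P G" and min: "\<And>G'. ?P G' \<Longrightarrow> card G \<le> card G'"
    using exists_least_iff[of "\<lambda>k. \<exists>G. ?P G \<and> card G = k"] by (metis not_le)
  have finG: "finite G" using G finite_E finite_subset by blast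
  have "G \<noteq> F" using G uv(3) by metis
  then obtain e where e: "e \<in> G" "e \<notin> F" using G by blast
  then have eE: "e \<in> E" using G by blast
  obtain a b where ab: "e = {a, b}" using edge_ex[OF eE] by blast
  have "card (G - {e}) < card G" using e(1) finG by (metis card_Diff1_less)
  then have nG: "\<not> edge_connected (G - {e}) u v"
    using min[of "G - {e}"] G e(2) by (metis Diff_empty subset_Diff_insert Diff_subset order_trans not_le)
  have "edge_connected (E - {e}) u v \<Longrightarrow> False"
  proof -
    assume uvE: "edge_connected (E - {e}) u v"
    have mono: "edge_connected (G - {e}) x y \<Longrightarrow> edge_connected (E - {e}) x y" for x y
      using G by (auto elim: edge_connected_mono)
    \<comment> \<open>A walk in \<open>G\<close> can be shortened until it uses \<open>e\<close> at
      most once, in one of the two directions.\<close>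
    have "edge_connected (G - {e}) u v \<or>
       (edge_connected (G - {e}) u a \<and> edge_connected (G - {e}) b v) \<or>
       (edge_connected (G - {e}) u b \<and> edge_connected (G - {e}) a v)"
      using G[THEN conjunct2, THEN conjunct2]
    proof (induction rule: edge_connected_induct)
      case (step y z)
      show ?case
      proof (cases "{y, z} = e")
        case True
        then have "(y = a \<and> z = b) \<or> (y = b \<and> z = a)" using ab by (auto simp: doubleton_eq_iff)
        then show ?thesis using step(3) edge_connected_refl by blast
      next
        case False
        then have "{y, z} \<in> G - {e}" using step(2) by simp
        then show ?thesis using step(3) edge_connected_step by blast
      qed
    qed simp
    then have "(edge_connected (E - {e}) u a \<and> edge_connected (E - {e}) b v) \<or>
       (edge_connected (E - {e}) u b \<and> edge_connected (E - {e}) a v)"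
      using nG mono by blast
    then have "edge_connected (E - {e}) a b"
      using uvE by (meson edge_connected_sym edge_connected_trans)
    then show False using bridge[of a b] eE ab by simp
  qed
  moreover have "edge_connected (E - {e}) u v"
    if "u \<in> side E r e \<longleftrightarrow> v \<in> side E r e"
  proof (cases "u \<in> side E r e")
    case True
    then show ?thesis
      using child_connected[OF eE] uv that by (meson edge_connected_sym edge_connected_trans)
  next
    case False
    then show ?thesis
      using that edge_connected_sym edge_connected_trans unfolding side_def mem_Collect_eq by metis
  qed
  ultimately show ?thesis using e(2) eE by blast
qed

end

section \<open>Clusters of a stable tree\<close>

definition cluster :: "nat \<Rightarrow> marked_tree \<Rightarrow> nat \<Rightarrow> nat set \<Rightarrow> nat set" where
  "cluster n T r e = {i \<in> {1..n}. mark T i \<in> side (edges T) r e}"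

locale stable_rooted_tree = rooted_tree "verts T" "edges T" r for T r +
  fixes n :: nat and w :: "nat \<Rightarrow> real"
  assumes stable: "stable_tree n w T" and w_pos: "\<forall>i\<in>{1..n}. 0 < w i"
begin

lemma mark_in: "i \<in> {1..n} \<Longrightarrow> mark T i \<in> verts T"
  using stable by (simp add: stable_tree_def)

lemma valency: "v \<in> verts T \<Longrightarrow>
    2 < real (card {e \<in> edges T. v \<in> e}) + (\<Sum>i | i \<in> {1..n} \<and> mark T i = v. w i)"
  using stable by (simp add: stable_tree_def weighted_valency_def)

lemma edge_below:
  assumes e: "e \<in> edges T" and e1: "e1 \<in> edges T" "e1 \<noteq> e" "child (edges T) r e \<in> e1"
  shows "child (edges T) r e = parent (edges T) r e1" "child (edges T) r e1 \<in> side (edges T) r e"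
    "side (edges T) r e1 \<subseteq> side (edges T) r e" "child (edges T) r e \<notin> side (edges T) r e1"
proof -
  let ?c = "child (edges T) r e"
  show 1: "?c \<notin> side (edges T) r e1"
  proof
    assume c: "?c \<in> side (edges T) r e1"
    then have "?c = child (edges T) r e1" using child_eqI e1 by blast
    moreover have "child (edges T) r e1 \<notin> side (edges T) r e"
      using side_not_nested[OF e e1(1) _ c] e1(2) by blast
    ultimately show False using edge_ends(2)[OF e] by simp
  qed
  show 2: "?c = parent (edges T) r e1" using parent_eqI[OF e1(1,3) 1] .
  show 3: "child (edges T) r e1 \<in> side (edges T) r e"
    using parent_in_side_iff[OF e1(1,2)] 2 edge_ends(2)[OF e] by simp
  show "side (edges T) r e1 \<subseteq> side (edges T) r e" by (rule side_nested[OF e1(1,2) 3])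
qed

lemma cluster_mono: "side (edges T) r e \<subseteq> side (edges T) r e' \<Longrightarrow> cluster n T r e \<subseteq> cluster n T r e'"
  by (auto simp: cluster_def)

lemma sum_w_mono: "A \<subseteq> B \<Longrightarrow> B \<subseteq> {1..n} \<Longrightarrow> sum w A \<le> sum w B"
  using w_pos by (intro sum_mono2) (auto intro: finite_subset less_imp_le)

text \<open>Descend to an edge whose lower end has no other edge: there stability leaves more than 1
  for the marks. On the way back up clusters only grow.\<close>

lemma cluster_weight: "e \<in> edges T \<Longrightarrow> 1 < sum w (cluster n T r e)"
proof (induction "card (side (edges T) r e \<inter> verts T)" arbitrary: e rule: less_induct)
  case less
  let ?c = "child (edges T) r e"
  note ends = edge_ends[OF less.prems]
  have ce: "?c \<in> e" using ends(1) by blast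
  show ?case
  proof (cases "\<exists>e1\<in>edges T. e1 \<noteq> e \<and> ?c \<in> e1")
    case True
    then obtain e1 where e1: "e1 \<in> edges T" "e1 \<noteq> e" "?c \<in> e1" by blast
    note below = edge_below[OF less.prems e1]
    have "side (edges T) r e1 \<inter> verts T \<subset> side (edges T) r e \<inter> verts T"
      using below ends(2,5) by blast
    then have "card (side (edges T) r e1 \<inter> verts T) < card (side (edges T) r e \<inter> verts T)"
      using finite_V by (intro psubset_card_mono) auto
    then have "1 < sum w (cluster n T r e1)" using less.hyps e1(1) by blast
    also have "\<dots> \<le> sum w (cluster n T r e)"
      using cluster_mono[OF below(3)] by (intro sum_w_mono) (auto simp: cluster_def)
    finally show ?thesis .
  next
    case False
    then have "{e' \<in> edges T. ?c \<in> e'} = {e}" using less.prems ce by blast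
    then have "1 < (\<Sum>i | i \<in> {1..n} \<and> mark T i = ?c. w i)"
      using valency[OF ends(5)] by simp
    also have "\<dots> \<le> sum w (cluster n T r e)"
      using ends(2) by (intro sum_w_mono) (auto simp: cluster_def)
    finally show ?thesis .
  qed
qed

lemma cluster_disjoint_or_nested:
  assumes e: "e \<in> edges T" "e' \<in> edges T" "e \<noteq> e'"
    and int: "cluster n T r e \<inter> cluster n T r e' \<noteq> {}"
  shows "child (edges T) r e \<in> side (edges T) r e' \<or> child (edges T) r e' \<in> side (edges T) r e"
proof -
  obtain i where "i \<in> {1..n}" "mark T i \<in> side (edges T) r e" "mark T i \<in> side (edges T) r e'"
    using int by (auto simp: cluster_def)
  then show ?thesis using side_cases[OF e] mark_in by blast
qed

text \<open>If no mark is lost between \<open>e\<close> and \<open>e'\<close>, the lower end of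
  \<open>e\<close> carries no mark, so stability gives it at least two further edges. Each has a
  nonempty cluster inside that of \<open>e'\<close>, so it is \<open>e'\<close> or leads to it,
  which only one of them can do.\<close>

lemma cluster_neq_below:
  assumes e: "e \<in> edges T" "e' \<in> edges T" "e \<noteq> e'" and c': "child (edges T) r e' \<in> side (edges T) r e"
  shows "cluster n T r e \<noteq> cluster n T r e'"
proof
  assume eq: "cluster n T r e = cluster n T r e'"
  let ?E = "edges T" and ?s = "side (edges T) r" and ?ch = "child (edges T) r"
  have ce': "?ch e \<notin> ?s e'" using side_not_nested[OF e(2,1) _ c'] e(3) by blast
  note ends = edge_ends[OF e(1)]
  have no_mark: "{i. i \<in> {1..n} \<and> mark T i = ?ch e} = {}"
  proof (rule equals0I)
    fix i assume i: "i \<in> {i. i \<in> {1..n} \<and> mark T i = ?ch e}"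
    then have "i \<in> cluster n T r e" "i \<notin> cluster n T r e'"
      using ends(2) ce' by (auto simp: cluster_def)
    then show False using eq by simp
  qed
  have "2 < card {e1 \<in> ?E. ?ch e \<in> e1}"
    using valency[OF ends(5)] unfolding no_mark by simp
  then have "1 < card ({e1 \<in> ?E. ?ch e \<in> e1} - {e})"
  proof -
    have "e \<in> {e1 \<in> ?E. ?ch e \<in> e1}" using e(1) ends(1) by blast
    then show ?thesis using \<open>2 < card _\<close> by (simp add: card_Diff_singleton)
  qed
  then obtain e1 e2 where e12: "e1 \<in> ?E" "e1 \<noteq> e" "?ch e \<in> e1" "e2 \<in> ?E" "e2 \<noteq> e" "?ch e \<in> e2" "e1 \<noteq> e2"
    using card_le_Suc0_iff_eq[of "{e1 \<in> ?E. ?ch e \<in> e1} - {e}"] finite_E by (fastforce simp: not_le[symmetric])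
  note b1 = edge_below[OF e(1) e12(1-3)] and b2 = edge_below[OF e(1) e12(4-6)]
  have meets: "f = e' \<or> ?ch e' \<in> ?s f"
    if f: "f \<in> ?E" "f \<noteq> e" "?ch e \<in> f" for f
  proof (rule disjCI)
    assume nf: "?ch e' \<notin> ?s f"
    note b = edge_below[OF e(1) f]
    show "f = e'"
    proof (rule ccontr)
      assume ne: "f \<noteq> e'"
      have "cluster n T r f \<subseteq> cluster n T r e'" using cluster_mono[OF b(3)] eq by simp
      moreover have "cluster n T r f \<noteq> {}" using cluster_weight[OF f(1)] by fastforce
      ultimately have "cluster n T r f \<inter> cluster n T r e' \<noteq> {}" by blast
      then have "?ch f \<in> ?s e'" using cluster_disjoint_or_nested[OF f(1) e(2) ne] nf by blast
      then have "parent ?E r f \<in> ?s e'" using parent_in_side_iff[OF f(1) ne] by simp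
      then show False using b(1) ce' by simp
    qed
  qed
  have excl: False if f: "f \<in> ?E" "f \<noteq> e" "?ch e \<in> f" and g: "g \<in> ?E" "g \<noteq> e" "?ch e \<in> g"
    and "f \<noteq> g" and "f = e'" for f g
  proof -
    note bf = edge_below[OF e(1) f] and bg = edge_below[OF e(1) g]
    have "?ch f \<in> ?s g" using meets[OF g] that by blast
    then have "parent ?E r f \<in> ?s g" using parent_in_side_iff[OF f(1) \<open>f \<noteq> g\<close>] by simp
    then show False using bf(1) bg(4) by simp
  qed
  have "e1 \<noteq> e'" using excl[OF e12(1-3) e12(4-6) e12(7)] by blast
  moreover have "e2 \<noteq> e'" using excl[OF e12(4-6) e12(1-3)] e12(7) by blast
  ultimately have "?ch e' \<in> ?s e1" "?ch e' \<in> ?s e2"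
    using meets[OF e12(1-3)] meets[OF e12(4-6)] by blast+
  then have "?ch e1 \<in> ?s e2 \<or> ?ch e2 \<in> ?s e1"
    using side_cases[OF e12(1,4,7) edge_ends(5)[OF e(2)]] by blast
  then have "parent ?E r e1 \<in> ?s e2 \<or> parent ?E r e2 \<in> ?s e1"
    using parent_in_side_iff[OF e12(1,7)] parent_in_side_iff[OF e12(4)] e12(7) by blast
  then show False using b1(1,4) b2(1,4) by auto
qed

lemma inj_on_cluster: "inj_on (cluster n T r) (edges T)"
proof (rule inj_onI, rule ccontr)
  fix e e' assume e: "e \<in> edges T" "e' \<in> edges T" "cluster n T r e = cluster n T r e'" "e \<noteq> e'"
  have "cluster n T r e \<noteq> {}" using cluster_weight[OF e(1)] by fastforce
  then have "child (edges T) r e \<in> side (edges T) r e' \<or> child (edges T) r e' \<in> side (edges T) r e"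
    using cluster_disjoint_or_nested[OF e(1,2,4)] e(3) by simp
  then show False using cluster_neq_below[of e e'] cluster_neq_below[of e' e] e by auto
qed

text \<open>Clusters thus recover the order on the edges, which is what allows vertices to be named
  by chains of clusters.\<close>

lemma cluster_subset_iff:
  assumes e: "e \<in> edges T" "e' \<in> edges T"
  shows "cluster n T r e \<subseteq> cluster n T r e' \<longleftrightarrow> child (edges T) r e \<in> side (edges T) r e'"
proof (cases "e = e'")
  case True
  then show ?thesis using edge_ends(2)[OF e(1)] by simp
next
  case False
  show ?thesis
  proof
    assume sub: "cluster n T r e \<subseteq> cluster n T r e'"
    show "child (edges T) r e \<in> side (edges T) r e'"
    proof (rule ccontr)
      assume neg: "child (edges T) r e \<notin> side (edges T) r e'"
      have "cluster n T r e \<noteq> {}" using cluster_weight[OF e(1)] by fastforce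
      then have "cluster n T r e \<inter> cluster n T r e' \<noteq> {}" using sub by blast
      then have "child (edges T) r e' \<in> side (edges T) r e"
        using cluster_disjoint_or_nested[OF e False] neg by blast
      then have "cluster n T r e' \<subseteq> cluster n T r e"
        using cluster_mono[OF side_nested[OF e(2)]] False by blast
      then show False using sub inj_on_cluster e False by (auto dest: inj_onD)
    qed
  next
    assume "child (edges T) r e \<in> side (edges T) r e'"
    then show "cluster n T r e \<subseteq> cluster n T r e'"
      using cluster_mono[OF side_nested[OF e(1) False]] by blast
  qed
qed

lemma compat_cluster:
  assumes e: "e \<in> edges T" "e' \<in> edges T"
  shows "compat (cluster n T r e) (cluster n T r e')"
  using cluster_disjoint_or_nested[OF e] cluster_subset_iff e cluster_subset_iff[OF e(2,1)]
  unfolding compat_def by blast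

end

section \<open>Contractions\<close>

text \<open>If two surviving edges had the same image, their ends would be joined by contracted
  edges, and one of the two could be bypassed through the other, against
  \<open>bridge\<close>.\<close>

lemma contraction_inj_edges:
  assumes T: "finite_tree (verts T) (edges T)" and c: "contraction n F f T T'"
  shows "inj_on ((`) f) (edges T - F)"
proof (rule inj_onI, rule ccontr)
  fix e e' assume e: "e \<in> edges T - F" "e' \<in> edges T - F" "f ` e = f ` e'" "e \<noteq> e'"
  obtain v where v: "v \<in> verts T" using T by (auto simp: finite_tree_def)
  interpret rooted_tree "verts T" "edges T" v using T v by unfold_locales
  obtain a b where ab: "e = {a, b}" using edge_ex e(1) by blast
  obtain a' b' where ab': "e' = {a', b'}" using edge_ex e(2) by blast
  have V: "a \<in> verts T" "b \<in> verts T" "a' \<in> verts T" "b' \<in> verts T"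
    using edgeD[of a b] edgeD[of a' b'] e(1,2) ab ab' by simp_all
  have F: "f u = f v \<longleftrightarrow> edge_connected F u v" if "u \<in> verts T" "v \<in> verts T" for u v
    using c that by (simp add: contraction_def)
  have sub: "F \<subseteq> edges T - {e}" using c e(1) by (auto simp: contraction_def)
  have conn: "edge_connected (edges T - {e}) u v" if "u \<in> verts T" "v \<in> verts T" "f u = f v" for u v
    using edge_connected_mono[OF _ sub] F that by blast
  have e': "edge_connected (edges T - {e}) a' b'" "edge_connected (edges T - {e}) b' a'"
    using e(2,4) ab' by (auto intro!: edge_connected_edge simp: insert_commute)
  have "(f a = f a' \<and> f b = f b') \<or> (f a = f b' \<and> f b = f a')"
    using e(3) ab ab' by (auto simp: doubleton_eq_iff)
  then have "edge_connected (edges T - {e}) a b"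
  proof
    assume "f a = f a' \<and> f b = f b'"
    then have "edge_connected (edges T - {e}) a a'" "edge_connected (edges T - {e}) b' b"
      using conn V by auto
    then show ?thesis using e'(1) edge_connected_trans by blast
  next
    assume "f a = f b' \<and> f b = f a'"
    then have "edge_connected (edges T - {e}) a b'" "edge_connected (edges T - {e}) a' b"
      using conn V by auto
    then show ?thesis using e'(2) edge_connected_trans by blast
  qed
  then show False using bridge[of a b] ab e(1) by simp
qed

lemma contraction_connected_iff:
  assumes T: "finite_tree (verts T) (edges T)" and c: "contraction n F f T T'"
    and e: "e \<in> edges T - F" and uv: "u \<in> verts T" "v \<in> verts T"
  shows "edge_connected (edges T' - {f ` e}) (f u) (f v) \<longleftrightarrow> edge_connected (edges T - {e}) u v"
proof -
  have F: "f x = f y \<longleftrightarrow> edge_connected F x y" if "x \<in> verts T" "y \<in> verts T" for x y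
    using c that by (simp add: contraction_def)
  have sub: "F \<subseteq> edges T - {e}" using c e by (auto simp: contraction_def)
  have E': "edges T' = (`) f ` (edges T - F)" using c by (simp add: contraction_def)
  have ne: "f ` e1 \<noteq> f ` e" if "e1 \<in> edges T - F" "e1 \<noteq> e" for e1
    using contraction_inj_edges[OF T c] that e by (auto dest: inj_onD)
  have conn: "edge_connected (edges T - {e}) x y" if "x \<in> verts T" "y \<in> verts T" "f x = f y" for x y
    using edge_connected_mono[OF _ sub] F that by blast
  show ?thesis
  proof
    assume "edge_connected (edges T - {e}) u v"
    then have "v \<in> verts T \<and> edge_connected (edges T' - {f ` e}) (f u) (f v)"
    proof (induction rule: edge_connected_induct)
      case refl
      show ?case using uv by simp
    next
      case (step y z)
      have V: "y \<in> verts T" "z \<in> verts T" using finite_tree_edgeD[OF T, of y z] step(2) by simp_all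
      show ?case
      proof (cases "{y, z} \<in> F")
        case True
        then have "f y = f z" using F[OF V] edge_connected_edge by blast
        then show ?thesis using step(3) V by simp
      next
        case False
        then have "{y, z} \<in> edges T - F" "{y, z} \<noteq> e" using step(2) by auto
        then have "f ` {y, z} \<in> edges T' - {f ` e}" using ne E' by blast
        then have "{f y, f z} \<in> edges T' - {f ` e}" by simp
        then show ?thesis using step(3) V edge_connected_step by blast
      qed
    qed
    then show "edge_connected (edges T' - {f ` e}) (f u) (f v)" by simp
  next
    assume "edge_connected (edges T' - {f ` e}) (f u) (f v)"
    \<comment> \<open>The induction follows a walk in the contracted tree, so its claim has to cover
      every vertex in the fibre over the current end.\<close>
    then have "\<forall>v'\<in>verts T. f v' = f v \<longrightarrow> edge_connected (edges T - {e}) u v'"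
    proof (induction rule: edge_connected_induct)
      case refl
      show ?case using conn uv by simp
    next
      case (step y z)
      show ?case
      proof (intro ballI impI)
        fix v' assume v': "v' \<in> verts T" "f v' = z"
        obtain e1 where e1: "e1 \<in> edges T - F" "{y, z} = f ` e1" using step(2) E' by auto
        have "e1 \<noteq> e" using e1(2) step(2) by auto
        obtain a0 b0 where "e1 = {a0, b0}"
          using T e1(1) unfolding finite_tree_def by (metis DiffD1 card_2_iff)
        then obtain a b where ab: "e1 = {a, b}" "f a = y" "f b = z"
          using e1(2) by (auto simp: doubleton_eq_iff insert_commute)
        have V: "a \<in> verts T" "b \<in> verts T" using finite_tree_edgeD[OF T, of a b] ab(1) e1(1) by simp_all
        have "edge_connected (edges T - {e}) u a" using step(3) V ab by simp
        moreover have "edge_connected (edges T - {e}) a b"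
          using e1(1) \<open>e1 \<noteq> e\<close> ab(1) by (intro edge_connected_edge) simp
        moreover have "edge_connected (edges T - {e}) b v'" using conn V v' ab by simp
        ultimately show "edge_connected (edges T - {e}) u v'" using edge_connected_trans by blast
      qed
    qed
    then show "edge_connected (edges T - {e}) u v" using uv by simp
  qed
qed

text \<open>Contracted edges differ from \<open>e\<close>, so removing \<open>e\<close> before or
  after the contraction separates the same marks. Coordinates indexed by clusters are therefore well
  defined on the glued space.\<close>

lemma contraction_cluster:
  assumes T: "stable_tree n w T" and c: "contraction n F f T T'" and e: "e \<in> edges T - F" and r: "r \<in> {1..n}"
  shows "cluster n T' (mark T' r) (f ` e) = cluster n T (mark T r) e"
proof -
  have tree: "finite_tree (verts T) (edges T)" and m: "\<And>i. i \<in> {1..n} \<Longrightarrow> mark T i \<in> verts T"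
    using T by (auto simp: stable_tree_def)
  have "mark T' i = f (mark T i)" if "i \<in> {1..n}" for i using c that by (simp add: contraction_def)
  then show ?thesis
    unfolding cluster_def side_def
    using contraction_connected_iff[OF tree c e m[OF r] m] r by auto
qed

section \<open>The tree of a laminar family\<close>

definition enc :: "nat \<Rightarrow> nat set set \<Rightarrow> nat" where
  "enc n = to_nat_on (Pow (Pow {1..n}))"

definition above :: "nat set set \<Rightarrow> nat set \<Rightarrow> nat set set" where
  "above \<sigma> A = {B \<in> \<sigma>. A \<subseteq> B}"

definition tree_edge :: "nat \<Rightarrow> nat set set \<Rightarrow> nat set \<Rightarrow> nat set" where
  "tree_edge n \<sigma> A = {enc n (above \<sigma> A), enc n (above \<sigma> A - {A})}"

text \<open>A vertex is encoded by the chain of the clusters below whose edges it lies. Deleting the least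
  element of this chain leads to the parent vertex.\<close>

definition laminar_tree :: "nat \<Rightarrow> nat set set \<Rightarrow> marked_tree" where
  "laminar_tree n \<sigma> = Marked_Tree (enc n ` insert {} (above \<sigma> ` \<sigma>)) (tree_edge n \<sigma> ` \<sigma>)
     (\<lambda>i. enc n {A \<in> \<sigma>. i \<in> A})"

text \<open>Vertices of a \<open>marked_tree\<close> are numbers, so families of sets need numerical
  codes, of which only the distinctness matters.\<close>

lemma inj_on_enc: "inj_on (enc n) (Pow (Pow {1..n}))"
  unfolding enc_def by (intro inj_on_to_nat_on countable_finite) simp

locale laminar =
  fixes n :: nat and \<sigma> :: "nat set set"
  assumes sub: "\<sigma> \<subseteq> Pow {1..n}" and nonempty: "A \<in> \<sigma> \<Longrightarrow> A \<noteq> {}"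
    and compatible: "A \<in> \<sigma> \<Longrightarrow> B \<in> \<sigma> \<Longrightarrow> compat A B"
begin

abbreviation "nodes \<equiv> insert {} (above \<sigma> ` \<sigma>)"
abbreviation "E \<equiv> tree_edge n \<sigma> ` \<sigma>"

lemma finite_\<sigma>: "finite \<sigma>"
  using sub finite_subset by (metis finite_Pow_iff finite_atLeastAtMost)

lemma enc_eq: "X \<subseteq> \<sigma> \<Longrightarrow> Y \<subseteq> \<sigma> \<Longrightarrow> enc n X = enc n Y \<longleftrightarrow> X = Y"
  using inj_on_eq_iff[OF inj_on_enc[of n], of X Y] sub by blast

lemma above_subset: "above \<sigma> A \<subseteq> \<sigma>"
  by (auto simp: above_def)

lemma nodes_subset: "X \<in> nodes \<Longrightarrow> X \<subseteq> \<sigma>"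
  using above_subset by blast

lemma above_self: "A \<in> \<sigma> \<Longrightarrow> A \<in> above \<sigma> A"
  by (simp add: above_def)

lemma above_inj: "A \<in> \<sigma> \<Longrightarrow> B \<in> \<sigma> \<Longrightarrow> above \<sigma> A = above \<sigma> B \<Longrightarrow> A = B"
  unfolding above_def by blast

text \<open>A nonempty finite chain has a least element, and upward closure makes it equal to
  everything above this element.\<close>

lemma upset_chain_in_nodes:
  assumes X: "X \<subseteq> \<sigma>" and up: "\<And>A B. A \<in> X \<Longrightarrow> B \<in> \<sigma> \<Longrightarrow> A \<subseteq> B \<Longrightarrow> B \<in> X"
    and chain: "\<And>A B. A \<in> X \<Longrightarrow> B \<in> X \<Longrightarrow> A \<subseteq> B \<or> B \<subseteq> A"
  shows "X \<in> nodes"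
proof (cases "X = {}")
  case False
  have "finite X" using X finite_\<sigma> finite_subset by blast
  then obtain P where P: "P \<in> X" "\<And>B. B \<in> X \<Longrightarrow> B \<subseteq> P \<Longrightarrow> B = P"
    using finite_has_minimal[OF _ False] by metis
  have "X = above \<sigma> P"
  proof
    show "X \<subseteq> above \<sigma> P"
    proof
      fix B assume B: "B \<in> X"
      then have "P \<subseteq> B" using chain[OF P(1) B] P(2)[OF B] by blast
      then show "B \<in> above \<sigma> P" using B X by (auto simp: above_def)
    qed
    show "above \<sigma> P \<subseteq> X" using up[OF P(1)] by (auto simp: above_def)
  qed
  then show ?thesis using P(1) X by blast
qed simp

lemma nested_if_common_subset: "A \<in> \<sigma> \<Longrightarrow> B \<in> \<sigma> \<Longrightarrow> C \<noteq> {} \<Longrightarrow> C \<subseteq> A \<Longrightarrow> C \<subseteq> B \<Longrightarrow> A \<subseteq> B \<or> B \<subseteq> A"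
  using compatible[of A B] unfolding compat_def by blast

lemma above_Diff_in_nodes: assumes A: "A \<in> \<sigma>" shows "above \<sigma> A - {A} \<in> nodes"
proof (rule upset_chain_in_nodes)
  show "above \<sigma> A - {A} \<subseteq> \<sigma>" using above_subset by blast
  show "D \<in> above \<sigma> A - {A}" if "B \<in> above \<sigma> A - {A}" "D \<in> \<sigma>" "B \<subseteq> D" for B D
    using that unfolding above_def by blast
  show "B \<subseteq> D \<or> D \<subseteq> B" if "B \<in> above \<sigma> A - {A}" "D \<in> above \<sigma> A - {A}" for B D
    using nested_if_common_subset[OF _ _ nonempty[OF A], of B D] that by (auto simp: above_def)
qed

lemma mark_in_nodes: "{A \<in> \<sigma>. i \<in> A} \<in> nodes"
  by (rule upset_chain_in_nodes) (use nested_if_common_subset[of _ _ "{i}"] in auto)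

lemma inj_on_tree_edge: "inj_on (tree_edge n \<sigma>) \<sigma>"
proof (rule inj_onI)
  fix A B assume AB: "A \<in> \<sigma>" "B \<in> \<sigma>" and eq: "tree_edge n \<sigma> A = tree_edge n \<sigma> B"
  have sub: "above \<sigma> A \<subseteq> \<sigma>" "above \<sigma> B \<subseteq> \<sigma>" "above \<sigma> A - {A} \<subseteq> \<sigma>" "above \<sigma> B - {B} \<subseteq> \<sigma>"
    using above_subset by blast+
  have "above \<sigma> A = above \<sigma> B \<or> (above \<sigma> A = above \<sigma> B - {B} \<and> above \<sigma> A - {A} = above \<sigma> B)"
    using eq unfolding tree_edge_def doubleton_eq_iff using enc_eq sub by auto
  moreover have "\<not> (above \<sigma> A = above \<sigma> B - {B} \<and> above \<sigma> A - {A} = above \<sigma> B)"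
    using above_self[OF AB(2)] by blast
  ultimately show "A = B" using above_inj AB by blast
qed

lemma tree_edge_cases:
  assumes "{enc n X, y} = tree_edge n \<sigma> A" "A \<in> \<sigma>" "X \<subseteq> \<sigma>"
  obtains "X = above \<sigma> A" "y = enc n (above \<sigma> A - {A})" | "X = above \<sigma> A - {A}" "y = enc n (above \<sigma> A)"
proof -
  have sub: "above \<sigma> A \<subseteq> \<sigma>" "above \<sigma> A - {A} \<subseteq> \<sigma>" using above_subset by blast+
  show ?thesis
    using assms(1) that enc_eq[OF assms(3) sub(1)] enc_eq[OF assms(3) sub(2)]
    unfolding tree_edge_def doubleton_eq_iff by blast
qed

text \<open>Deleting least elements leads to the root. That only edges named by members of
  \<open>X\<close> occur is the point of the statement: it determines the sides.\<close>

lemma connected_to_root: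
  "X \<in> nodes \<Longrightarrow> edge_connected (tree_edge n \<sigma> ` X) (enc n {}) (enc n X)"
proof (induction "card X" arbitrary: X rule: less_induct)
  case less
  show ?case
  proof (cases "X = {}")
    case False
    then obtain A where A: "A \<in> \<sigma>" "X = above \<sigma> A" using less.prems by blast
    have AX: "A \<in> X" using above_self A by simp
    have "finite X" using nodes_subset[OF less.prems] finite_\<sigma> finite_subset by blast
    then have "card (X - {A}) < card X" using AX by (rule card_Diff1_less)
    then have "edge_connected (tree_edge n \<sigma> ` (X - {A})) (enc n {}) (enc n (X - {A}))"
      using less.hyps above_Diff_in_nodes[OF A(1)] A(2) by blast
    then have "edge_connected (tree_edge n \<sigma> ` X) (enc n {}) (enc n (X - {A}))"
      by (rule edge_connected_mono) auto
    moreover have "{enc n (X - {A}), enc n X} \<in> tree_edge n \<sigma> ` X"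
      using AX unfolding tree_edge_def A(2) by (auto simp: insert_commute)
    ultimately show ?thesis by (rule edge_connected_step)
  qed simp
qed

text \<open>Only the edge of \<open>A\<close> adds \<open>A\<close> to a chain or removes it.
  Without this edge no walk from the root reaches a chain with \<open>A\<close>, whereas the path of
  deletions from a chain without \<open>A\<close> does not use it.\<close>

lemma in_side_iff:
  assumes X: "X \<in> nodes" and A: "A \<in> \<sigma>"
  shows "enc n X \<in> side E (enc n {}) (tree_edge n \<sigma> A) \<longleftrightarrow> A \<in> X"
proof
  assume "enc n X \<in> side E (enc n {}) (tree_edge n \<sigma> A)"
  then have nc: "\<not> edge_connected (E - {tree_edge n \<sigma> A}) (enc n {}) (enc n X)"
    by (simp add: side_def)
  show "A \<in> X"
  proof (rule ccontr)
    assume "A \<notin> X"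
    have "tree_edge n \<sigma> B \<in> E - {tree_edge n \<sigma> A}" if "B \<in> X" for B
    proof -
      have "B \<in> \<sigma>" "B \<noteq> A" using that nodes_subset[OF X] \<open>A \<notin> X\<close> by auto
      then show ?thesis using inj_on_tree_edge A by (auto dest: inj_onD)
    qed
    then have "tree_edge n \<sigma> ` X \<subseteq> E - {tree_edge n \<sigma> A}" by blast
    then show False using edge_connected_mono[OF connected_to_root[OF X]] nc by blast
  qed
next
  assume AX: "A \<in> X"
  have "\<exists>Y\<subseteq>\<sigma>. y = enc n Y \<and> A \<notin> Y"
    if "edge_connected (E - {tree_edge n \<sigma> A}) (enc n {}) y" for y
    using that
  proof (induction rule: edge_connected_induct)
    case refl
    show ?case by blast
  next
    case (step y z)
    then obtain Y where Y: "Y \<subseteq> \<sigma>" "y = enc n Y" "A \<notin> Y" by blast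
    obtain B where B: "B \<in> \<sigma>" "{enc n Y, z} = tree_edge n \<sigma> B" "B \<noteq> A" using step(2) Y(2) by auto
    from B(2,1) Y(1) show ?case
    proof (cases rule: tree_edge_cases)
      case 1
      then show ?thesis using Y(3) above_subset by blast
    next
      case 2
      then have "A \<notin> above \<sigma> B" using Y(3) B(3) by blast
      then show ?thesis using 2(2) above_subset by blast
    qed
  qed
  then show "enc n X \<in> side E (enc n {}) (tree_edge n \<sigma> A)"
    using enc_eq nodes_subset[OF X] AX unfolding side_def mem_Collect_eq by metis
qed

text \<open>At a longest chain on a cycle both neighbours arise by deleting its least element, so
  they coincide.\<close>

lemma no_cycle: "\<not> is_cycle E c"
proof
  assume c: "is_cycle E c"
  let ?L = "length c"
  have L: "3 \<le> ?L" and dist: "distinct c" and edge: "\<And>i. i < ?L \<Longrightarrow> {c ! i, c ! (Suc i mod ?L)} \<in> E"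
    using c by (auto simp: is_cycle_def)
  have sub': "above \<sigma> A \<subseteq> \<sigma>" "above \<sigma> A - {A} \<subseteq> \<sigma>" for A using above_subset by blast+
  have ex: "\<exists>X\<subseteq>\<sigma>. c ! i = enc n X" if i: "i < ?L" for i
  proof -
    obtain A where "A \<in> \<sigma>" "{c ! i, c ! (Suc i mod ?L)} = tree_edge n \<sigma> A" using edge[OF i] by blast
    then have "c ! i = enc n (above \<sigma> A) \<or> c ! i = enc n (above \<sigma> A - {A})"
      unfolding tree_edge_def by blast
    then show ?thesis using sub' by blast
  qed
  then have "\<forall>i\<in>{..<?L}. \<exists>X. X \<subseteq> \<sigma> \<and> c ! i = enc n X" by blast
  from bchoice[OF this] obtain X where X: "\<And>i. i < ?L \<Longrightarrow> X i \<subseteq> \<sigma> \<and> c ! i = enc n (X i)" by auto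
  have "Max ((card \<circ> X) ` {..<?L}) \<in> (card \<circ> X) ` {..<?L}"
  proof (rule Max_in)
    have "0 \<in> {..<?L}" using L by (metis lessThan_iff less_le_trans zero_less_numeral)
    then show "(card \<circ> X) ` {..<?L} \<noteq> {}" by blast
  qed simp
  then obtain i where i: "i < ?L" "card (X i) = Max ((card \<circ> X) ` {..<?L})" by auto
  have max: "card (X j) \<le> card (X i)" if "j < ?L" for j
    unfolding i(2) using that by (intro Max_ge) auto
  have down: "\<exists>A\<in>\<sigma>. X i = above \<sigma> A \<and> X j = above \<sigma> A - {A}" if j: "j < ?L" and ij: "{c ! i, c ! j} \<in> E" for j
  proof -
    obtain A where A: "A \<in> \<sigma>" "{enc n (X i), enc n (X j)} = tree_edge n \<sigma> A" using ij X i(1) j by auto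
    have Xi: "X i \<subseteq> \<sigma>" and Xj: "X j \<subseteq> \<sigma>" using X i(1) j by blast+
    from A(2,1) Xi show ?thesis
    proof (cases rule: tree_edge_cases)
      case 1
      then show ?thesis using A(1) enc_eq[OF Xj sub'(2)] by blast
    next
      case 2
      then have "X j = above \<sigma> A" using enc_eq[OF Xj sub'(1)] by blast
      moreover have "finite (above \<sigma> A)" using above_subset finite_\<sigma> finite_subset by blast
      ultimately have "card (X i) < card (X j)"
        using 2(1) above_self[OF A(1)] card_Diff1_less by metis
      then show ?thesis using max[OF j] by simp
    qed
  qed
  \<comment> \<open>Successor and predecessor of \<open>i\<close> on the cycle; they differ because
    its length is at least 3.\<close>
  let ?k = "Suc i mod ?L" and ?j = "if i = 0 then ?L - 1 else i - 1"
  have k: "?k < ?L" and j: "?j < ?L" using L i(1) by (auto intro: mod_less_divisor)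
  have jk: "?j \<noteq> ?k"
    using L i(1) by (cases "Suc i = ?L") auto
  have "Suc ?j mod ?L = i" using L i(1) by auto
  then have "{c ! i, c ! ?j} \<in> E" using edge[OF j] by (simp add: insert_commute)
  then obtain A where A: "A \<in> \<sigma>" "X i = above \<sigma> A" "X ?j = above \<sigma> A - {A}" using down[OF j] by blast
  obtain B where B: "B \<in> \<sigma>" "X i = above \<sigma> B" "X ?k = above \<sigma> B - {B}"
    using down[OF k edge[OF i(1)]] by blast
  have "A = B" using above_inj[OF A(1) B(1)] A(2) B(2) by simp
  then have "X ?j = X ?k" using A(3) B(3) by simp
  then have "c ! ?j = c ! ?k" using X[OF j] X[OF k] by simp
  then show False using nth_eq_iff_index_eq[OF dist j k] jk by blast
qed

lemma finite_tree_laminar_tree: "finite_tree (verts (laminar_tree n \<sigma>)) (edges (laminar_tree n \<sigma>))"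
  unfolding finite_tree_def laminar_tree_def marked_tree.sel
proof (intro conjI ballI)
  show "finite (enc n ` nodes)" using finite_\<sigma> by simp
  show "enc n ` nodes \<noteq> {}" by simp
  show "\<nexists>c. is_cycle E c" using no_cycle by blast
  fix e assume "e \<in> E"
  then obtain A where A: "A \<in> \<sigma>" "e = tree_edge n \<sigma> A" by blast
  then show "e \<subseteq> enc n ` nodes" using above_Diff_in_nodes[OF A(1)] unfolding tree_edge_def by blast
  have "above \<sigma> A - {A} \<subseteq> \<sigma>" using above_subset by blast
  then have "enc n (above \<sigma> A) \<noteq> enc n (above \<sigma> A - {A})"
    using enc_eq[OF above_subset] above_self[OF A(1)] by blast
  then show "card e = 2" unfolding A(2) tree_edge_def by simp
next
  fix u v assume "u \<in> enc n ` nodes" "v \<in> enc n ` nodes"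
  then obtain X Y where X: "X \<in> nodes" "u = enc n X" and Y: "Y \<in> nodes" "v = enc n Y" by blast
  have "edge_connected E (enc n {}) (enc n Z)" if "Z \<in> nodes" for Z
    by (rule edge_connected_mono[OF connected_to_root[OF that] image_mono[OF nodes_subset[OF that]]])
  then have "edge_connected E (enc n {}) u" "edge_connected E (enc n {}) v"
    unfolding X(2) Y(2) using X(1) Y(1) by simp_all
  then show "edge_connected E u v" by (rule edge_connected_trans[OF edge_connected_sym])
qed

text \<open>The mark \<open>r\<close> lies in no member of \<open>\<sigma>\<close>, so it sits at
  the empty chain, and \<open>in_side_iff\<close> computes the sides seen from there.\<close>

lemma cluster_laminar_tree:
  assumes "A \<in> \<sigma>" "r \<in> {1..n}" "\<And>A. A \<in> \<sigma> \<Longrightarrow> r \<notin> A"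
  shows "cluster n (laminar_tree n \<sigma>) (mark (laminar_tree n \<sigma>) r) (tree_edge n \<sigma> A) = A"
proof -
  have A_sub: "A \<subseteq> {1..n}" using sub assms(1) by blast
  have "mark (laminar_tree n \<sigma>) r = enc n {}" proof -
    have "{A \<in> \<sigma>. r \<in> A} = {}" using assms(3) by blast
    then show ?thesis by (simp only: laminar_tree_def marked_tree.sel)
  qed
  then show ?thesis
    using in_side_iff[OF mark_in_nodes assms(1)] A_sub assms(1)
    unfolding cluster_def by (auto simp: laminar_tree_def simp del: atLeastAtMost_iff)
qed

end

section \<open>Two heavy marks\<close>

definition mark_blocks :: "nat \<Rightarrow> nat set set" where
  "mark_blocks n = (\<lambda>i. {i}) ` ({1..n} - {2})"

lemma Union_mark_blocks: "\<Union>(mark_blocks n) = {1..n} - {2}"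
  by (auto simp: mark_blocks_def)

lemma clusters_mark_blocks:
  assumes "\<forall>i\<in>{1..n}. w i \<le> 1"
  shows "A \<in> clusters (mark_blocks n) w \<longleftrightarrow> A \<subseteq> {1..n} - {2} \<and> A \<noteq> {1..n} - {2} \<and> 1 < sum w A"
proof -
  have "A \<notin> mark_blocks n" if "1 < sum w A"
    using that assms by (force simp: mark_blocks_def)
  moreover have "b \<subseteq> A \<or> b \<inter> A = {}" if "b \<in> mark_blocks n" for b
    using that by (auto simp: mark_blocks_def)
  ultimately show ?thesis unfolding clusters_def Union_mark_blocks by blast
qed

locale heavy_marks =
  fixes n :: nat and w :: "nat \<Rightarrow> real"
  assumes n3: "3 \<le> n" and w_bounds: "\<forall>i\<in>{1..n}. 0 < w i \<and> w i \<le> 1" and w1: "w 1 = 1" and w2: "w 2 = 1"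
begin

abbreviation "Vs \<equiv> clusters (mark_blocks n) w"
abbreviation "cl T \<equiv> cluster n T (mark T 2)"

lemma in_Vs: "A \<in> Vs \<longleftrightarrow> A \<subseteq> {1..n} - {2} \<and> A \<noteq> {1..n} - {2} \<and> 1 < sum w A"
  by (rule clusters_mark_blocks) (use w_bounds in blast)

lemma two_in: "2 \<in> {1..n}"
  using n3 by simp

lemma finite_Vs: "finite Vs"
  by (rule finite_subset[of _ "Pow {1..n}"]) (use in_Vs in auto)

lemma sum_w_mono: "A \<subseteq> B \<Longrightarrow> B \<subseteq> {1..n} \<Longrightarrow> sum w A \<le> sum w B"
  using w_bounds by (intro sum_mono2) (auto intro: finite_subset less_imp_le)

lemma stable_rooted_tree: "stable_tree n w T \<Longrightarrow> r \<in> verts T \<Longrightarrow> stable_rooted_tree T r n w"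
  using w_bounds by unfold_locales (auto simp: stable_tree_def)

lemma stable_rooted_tree_2: "stable_tree n w T \<Longrightarrow> stable_rooted_tree T (mark T 2) n w"
  using two_in by (intro stable_rooted_tree) (auto simp: stable_tree_def)

lemma cluster_in_Vs:
  assumes T: "stable_tree n w T" and e: "e \<in> edges T"
  shows "cl T e \<in> Vs"
proof -
  interpret stable_rooted_tree T "mark T 2" n w by (rule stable_rooted_tree_2[OF T])
  let ?c = "child (edges T) (mark T 2) e"
  \<comment> \<open>Rerooting at the lower end of \<open>e\<close> makes a cluster of the marks on
    the other side. Its weight must exceed 1, and the mark 2 alone does not reach that.\<close>
  interpret C: stable_rooted_tree T ?c n w
    by (rule stable_rooted_tree[OF T edge_ends(5)[OF e]])
  have "cl T e \<subseteq> {1..n} - {2}" by (auto simp: cluster_def)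
  moreover have "cl T e \<noteq> {1..n} - {2}"
  proof
    assume eq: "cl T e = {1..n} - {2}"
    have "cluster n T ?c e \<subseteq> {2}"
    proof
      fix i assume i: "i \<in> cluster n T ?c e"
      show "i \<in> {2}"
      proof (rule ccontr)
        assume "i \<notin> {2}"
        then have "i \<in> cl T e" using i unfolding eq by (simp add: cluster_def)
        then have "edge_connected (edges T - {e}) ?c (mark T i)"
          using child_connected[OF e mark_in] by (simp add: cluster_def)
        then show False using i by (simp add: cluster_def side_def)
      qed
    qed
    then have "sum w (cluster n T ?c e) \<le> sum w {2}" using two_in by (intro sum_w_mono) auto
    then show False using C.cluster_weight[OF e] w2 by simp
  qed
  ultimately show ?thesis using cluster_weight[OF e] in_Vs by blast
qed

lemma clusters_laminar:
  assumes T: "stable_tree n w T" and F: "F \<subseteq> edges T"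
  shows "cl T ` F \<in> laminar_families Vs"
proof -
  interpret stable_rooted_tree T "mark T 2" n w by (rule stable_rooted_tree_2[OF T])
  show ?thesis
    unfolding laminar_families_def using compat_cluster cluster_in_Vs[OF T] F by blast
qed

lemma laminarI:
  assumes \<sigma>: "\<sigma> \<in> laminar_families Vs"
  shows "laminar n \<sigma>"
proof
  have V: "A \<in> Vs" if "A \<in> \<sigma>" for A using that \<sigma> by (auto simp: laminar_families_def)
  show "\<sigma> \<subseteq> Pow {1..n}" using V in_Vs by blast
  show "A \<noteq> {}" if "A \<in> \<sigma>" for A using V[OF that] in_Vs[of A] by auto
  show "compat A B" if "A \<in> \<sigma>" "B \<in> \<sigma>" for A B using that \<sigma> by (auto simp: laminar_families_def)
qed

text \<open>At the root, \<open>{1..n} - {2}\<close> replaces the cluster and the mark 2 of weight 1 replaces the edge to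
  the parent.\<close>

lemma laminar_tree_weight:
  assumes \<sigma>: "\<sigma> \<in> laminar_families Vs" and A: "A \<in> insert ({1..n} - {2}) \<sigma>"
  defines "Ch \<equiv> {B \<in> \<sigma>. above \<sigma> B - {B} = above \<sigma> A}"
  shows "1 < real (card Ch) + sum w {i \<in> A. {B \<in> \<sigma>. i \<in> B} = above \<sigma> A}" (is "_ < _ + sum w ?mk")
proof -
  interpret laminar n \<sigma> by (rule laminarI[OF \<sigma>])
  have V: "B \<in> Vs" if "B \<in> \<sigma>" for B using that \<sigma> by (auto simp: laminar_families_def)
  have A_sub: "A \<subseteq> {1..n}" using A sub by auto
  have A_weight: "1 < sum w A"
  proof (cases "A \<in> \<sigma>")
    case False
    then have "A = {1..n} - {2}" using A by simp
    \<comment> \<open>At the root the weight comes from mark 1 and one further mark, available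
      because \<open>3 \<le> n\<close>.\<close>
    then have "sum w {1, 3} \<le> sum w A" using n3 by (intro sum_w_mono) auto
    moreover have "0 < w 3" using w_bounds n3 by simp
    ultimately show ?thesis using w1 by simp
  qed (use V in_Vs in blast)
  have nested: "A \<subseteq> C \<or> C \<subseteq> A" if "C \<in> \<sigma>" "B \<subseteq> A" "B \<subseteq> C" "B \<noteq> {}" for B C
  proof (cases "A \<in> \<sigma>")
    case True
    then show ?thesis using nested_if_common_subset[OF True that(1,4,2,3)] by blast
  next
    case False
    then show ?thesis using A V[OF that(1)] in_Vs by blast
  qed
  \<comment> \<open>A largest member of \<open>\<sigma>\<close> that contains \<open>B\<close> and
    lies strictly inside \<open>A\<close> belongs to a child of the vertex of
    \<open>A\<close>.\<close>
  have child_ex: "\<exists>B'\<in>Ch. B \<subseteq> B'" if B: "B \<in> \<sigma>" "B \<subset> A" for B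
  proof -
    let ?S = "{C \<in> \<sigma>. C \<subset> A \<and> B \<subseteq> C}"
    have "finite ?S" using finite_\<sigma> by simp
    moreover have "?S \<noteq> {}" using B by blast
    ultimately have "\<exists>C\<in>?S. \<forall>D\<in>?S. C \<subseteq> D \<longrightarrow> C = D" by (rule finite_has_maximal)
    then obtain C where CS: "C \<in> ?S" and max': "\<forall>D\<in>?S. C \<subseteq> D \<longrightarrow> C = D" ..
    have C: "C \<in> \<sigma>" "C \<subset> A" "B \<subseteq> C" using CS by blast+
    have max: "D = C" if "D \<in> \<sigma>" "D \<subset> A" "C \<subseteq> D" for D
      using max' that C(3) by blast
    have "D \<in> above \<sigma> C - {C} \<longleftrightarrow> D \<in> above \<sigma> A" for D
    proof
      assume "D \<in> above \<sigma> C - {C}"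
      then have D: "D \<in> \<sigma>" "C \<subseteq> D" "D \<noteq> C" by (auto simp: above_def)
      then have "A \<subseteq> D \<or> D \<subseteq> A" using nested[OF D(1) _ D(2)] C nonempty by blast
      then have "A \<subseteq> D" using max[OF D(1) _ D(2)] D(3) by blast
      then show "D \<in> above \<sigma> A" using D by (simp add: above_def)
    next
      assume "D \<in> above \<sigma> A"
      then show "D \<in> above \<sigma> C - {C}" using C(2) by (auto simp: above_def)
    qed
    then show ?thesis using C unfolding Ch_def by blast
  qed
  have Ch_sub: "B \<subset> A" if B: "B \<in> Ch" for B
  proof (cases "A \<in> \<sigma>")
    case True
    then have "A \<in> above \<sigma> B - {B}" using B above_self[OF True] by (simp add: Ch_def)
    then show ?thesis by (auto simp: above_def)
  next
    case False
    then show ?thesis using A B V[of B] in_Vs[of B] by (auto simp: Ch_def)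
  qed
  have mk: "i \<in> ?mk" if i: "i \<in> A" "\<And>B. B \<in> Ch \<Longrightarrow> i \<notin> B" for i
  proof -
    have "B \<in> above \<sigma> A" if B: "B \<in> \<sigma>" "i \<in> B" for B
    proof -
      have "A \<subseteq> B \<or> B \<subset> A" using nested[OF B(1), of "{i}"] i(1) B(2) by auto
      then show ?thesis using child_ex[OF B(1)] i(2) B by (auto simp: above_def)
    qed
    then show ?thesis using i(1) by (auto simp: above_def)
  qed
  have finA: "finite A" using A_sub finite_subset by blast
  have w_ge: "0 \<le> w i" and w_gt: "0 < w i" if "i \<in> A" for i
    using that A_sub w_bounds by (auto intro: less_imp_le)
  have mk_ge: "0 \<le> sum w ?mk" using w_ge by (intro sum_nonneg) simp
  have finCh: "finite Ch" using finite_\<sigma> by (simp add: Ch_def)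
  \<comment> \<open>With no child all marks of \<open>A\<close> sit at the vertex; a single child is
    strictly smaller than \<open>A\<close> and leaves a mark of positive weight; two children
    suffice by themselves.\<close>
  consider "card Ch = 0" | "card Ch = 1" | "2 \<le> card Ch" by linarith
  then show ?thesis
  proof cases
    case 1
    then have "Ch = {}" using finCh by simp
    then have "?mk = A" using mk by blast
    then show ?thesis using A_weight 1 by simp
  next
    case 2
    then obtain B where B: "Ch = {B}" by (auto simp: card_1_singleton_iff)
    then have "B \<subset> A" using Ch_sub by blast
    then obtain i where i: "i \<in> A" "i \<notin> B" by blast
    then have imk: "i \<in> ?mk" using mk B by blast
    have "0 < sum w ?mk"
      by (rule sum_pos2[where i = i]) (use finA w_ge imk w_gt[OF i(1)] in auto)
    then show ?thesis using 2 by simp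
  next
    case 3
    then show ?thesis using mk_ge by simp
  qed
qed

lemma stable_laminar_tree:
  assumes \<sigma>: "\<sigma> \<in> laminar_families Vs"
  shows "stable_tree n w (laminar_tree n \<sigma>)"
proof -
  interpret laminar n \<sigma> by (rule laminarI[OF \<sigma>])
  let ?T = "laminar_tree n \<sigma>"
  have V: "B \<in> Vs" if "B \<in> \<sigma>" for B using that \<sigma> by (auto simp: laminar_families_def)
  have valency: "2 < weighted_valency n w ?T (enc n (above \<sigma> A))"
    if A: "A \<in> insert ({1..n} - {2}) \<sigma>" for A
  proof -
    define Ch where "Ch = {B \<in> \<sigma>. above \<sigma> B - {B} = above \<sigma> A}"
    define mk where "mk = {i \<in> A. {B \<in> \<sigma>. i \<in> B} = above \<sigma> A}"
    have wt: "1 < real (card Ch) + sum w mk"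
      unfolding Ch_def mk_def by (rule laminar_tree_weight[OF \<sigma> A])
    let ?v = "enc n (above \<sigma> A)"
    have A_sub: "A \<subseteq> {1..n}" using A sub by auto
    have edges: "tree_edge n \<sigma> ` Ch \<subseteq> {e \<in> edges ?T. ?v \<in> e}"
      unfolding Ch_def laminar_tree_def tree_edge_def by auto
    have finE: "finite {e \<in> edges ?T. ?v \<in> e}" using finite_\<sigma> by (simp add: laminar_tree_def)
    have inj: "inj_on (tree_edge n \<sigma>) Ch"
      by (rule inj_on_subset[OF inj_on_tree_edge]) (auto simp: Ch_def)
    have finCh: "finite Ch" using finite_\<sigma> by (simp add: Ch_def)
    have mk_sub: "mk \<subseteq> {i \<in> {1..n}. mark ?T i = ?v}"
      using A_sub by (auto simp: mk_def laminar_tree_def)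
    show ?thesis
    proof (cases "A \<in> \<sigma>")
      case True
      have "A \<notin> Ch" using above_self[OF True] by (auto simp: Ch_def)
      then have "card (tree_edge n \<sigma> ` insert A Ch) = Suc (card Ch)"
      proof -
        have "insert A Ch \<subseteq> \<sigma>" using True by (auto simp: Ch_def)
        from card_image[OF inj_on_subset[OF inj_on_tree_edge this]]
        show ?thesis using \<open>A \<notin> Ch\<close> finCh by simp
      qed
      moreover have "tree_edge n \<sigma> ` insert A Ch \<subseteq> {e \<in> edges ?T. ?v \<in> e}"
        using edges True by (auto simp: laminar_tree_def tree_edge_def)
      ultimately have "Suc (card Ch) \<le> card {e \<in> edges ?T. ?v \<in> e}"
        using card_mono[OF finE] by metis
      moreover have "sum w mk \<le> sum w {i \<in> {1..n}. mark ?T i = ?v}"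
        using mk_sub by (intro sum_w_mono) auto
      ultimately show ?thesis using wt unfolding weighted_valency_def by linarith
    next
      case False
      then have A_eq: "A = {1..n} - {2}" using A by simp
      have "\<not> A \<subseteq> B" if "B \<in> \<sigma>" for B
        using V[OF that] in_Vs[of B] unfolding A_eq by blast
      then have "above \<sigma> A = {}" by (auto simp: above_def)
      moreover have "{B \<in> \<sigma>. 2 \<in> B} = {}" using V in_Vs by blast
      ultimately have "mark ?T 2 = ?v" by (simp only: laminar_tree_def marked_tree.sel)
      then have "insert 2 mk \<subseteq> {i \<in> {1..n}. mark ?T i = ?v}" using mk_sub two_in by auto
      then have "sum w (insert 2 mk) \<le> sum w {i \<in> {1..n}. mark ?T i = ?v}"
        by (intro sum_w_mono) auto
      moreover have "sum w (insert 2 mk) = 1 + sum w mk"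
        using A_sub w2 by (subst sum.insert) (auto simp: mk_def A_eq intro: finite_subset[of mk])
      moreover have "card Ch \<le> card {e \<in> edges ?T. ?v \<in> e}"
        using card_mono[OF finE edges] card_image[OF inj] by simp
      ultimately show ?thesis using wt unfolding weighted_valency_def by linarith
    qed
  qed
  have root: "above \<sigma> ({1..n} - {2}) = {}"
    using V in_Vs unfolding above_def by blast
  show ?thesis
    unfolding stable_tree_def
  proof (intro conjI ballI)
    show "finite_tree (verts ?T) (edges ?T)" by (rule finite_tree_laminar_tree)
    show "mark ?T i \<in> verts ?T" for i
      unfolding laminar_tree_def marked_tree.sel by (rule imageI[OF mark_in_nodes])
    fix v assume "v \<in> verts ?T"
    then obtain X where X: "X \<in> nodes" "v = enc n X"
      unfolding laminar_tree_def marked_tree.sel by blast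
    then have "\<exists>A\<in>insert ({1..n} - {2}) \<sigma>. X = above \<sigma> A" using root by auto
    then show "2 < weighted_valency n w ?T v" using valency X(2) by blast
  qed
qed

lemma cl_laminar_tree:
  assumes \<sigma>: "\<sigma> \<in> laminar_families Vs" and A: "A \<in> \<sigma>"
  shows "cl (laminar_tree n \<sigma>) (tree_edge n \<sigma> A) = A"
proof (rule laminar.cluster_laminar_tree[OF laminarI[OF \<sigma>] A two_in])
  show "2 \<notin> B" if "B \<in> \<sigma>" for B
    using that \<sigma> in_Vs[of B] by (auto simp: laminar_families_def)
qed

text \<open>A vertex goes to the chain of those surviving clusters on whose side it lies. For
  \<open>F = {}\<close> this is an isomorphism of \<open>T\<close> with the tree of its own
  clusters; in general it is a normal form for the contracted tree.\<close>

lemma contraction_laminar_tree: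
  assumes T: "stable_tree n w T" and F: "F \<subseteq> edges T"
  defines "\<sigma> \<equiv> cl T ` (edges T - F)"
  defines "f \<equiv> (\<lambda>v. enc n {cl T e |e. e \<in> edges T - F \<and> v \<in> side (edges T) (mark T 2) e})"
  shows "contraction n F f T (laminar_tree n \<sigma>)"
proof -
  interpret stable_rooted_tree T "mark T 2" n w by (rule stable_rooted_tree_2[OF T])
  let ?s = "side (edges T) (mark T 2)" and ?ch = "child (edges T) (mark T 2)"
    and ?p = "parent (edges T) (mark T 2)"
  have \<sigma>: "\<sigma> \<in> laminar_families Vs" unfolding \<sigma>_def by (rule clusters_laminar[OF T]) blast
  interpret laminar n \<sigma> by (rule laminarI[OF \<sigma>])
  define X where "X = (\<lambda>v. {cl T e |e. e \<in> edges T - F \<and> v \<in> ?s e})"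
  have X_sub: "X v \<subseteq> \<sigma>" for v by (auto simp: X_def \<sigma>_def)
  have in_X: "cl T e \<in> X v \<longleftrightarrow> v \<in> ?s e" if "e \<in> edges T - F" for e v
  proof
    assume "cl T e \<in> X v"
    then obtain e' where "e' \<in> edges T - F" "v \<in> ?s e'" "cl T e = cl T e'" by (auto simp: X_def)
    then show "v \<in> ?s e" using inj_on_cluster that by (auto dest: inj_onD)
  qed (use that in \<open>auto simp: X_def\<close>)
  have X_child: "X (?ch e) = above \<sigma> (cl T e)" if e: "e \<in> edges T - F" for e
  proof (intro set_eqI iffI)
    fix A assume A: "A \<in> X (?ch e)"
    then obtain e' where e': "e' \<in> edges T - F" "A = cl T e'" using X_sub by (auto simp: \<sigma>_def)
    then show "A \<in> above \<sigma> (cl T e)"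
      using A in_X[OF e'(1)] cluster_subset_iff[of e e'] e by (auto simp: above_def \<sigma>_def)
  next
    fix A assume A: "A \<in> above \<sigma> (cl T e)"
    then obtain e' where e': "e' \<in> edges T - F" "A = cl T e'" by (auto simp: above_def \<sigma>_def)
    then show "A \<in> X (?ch e)"
      using A in_X[OF e'(1)] cluster_subset_iff[of e e'] e by (auto simp: above_def)
  qed
  \<comment> \<open>Passing from the lower to the upper end of \<open>e\<close> leaves the side of
    \<open>e\<close> and of no other edge.\<close>
  have X_parent: "X (?p e) = X (?ch e) - {cl T e}" if e: "e \<in> edges T - F" for e
  proof (intro set_eqI)
    fix A
    show "A \<in> X (?p e) \<longleftrightarrow> A \<in> X (?ch e) - {cl T e}"
    proof (cases "A \<in> \<sigma>")
      case True
      then obtain e' where e': "e' \<in> edges T - F" "A = cl T e'" by (auto simp: \<sigma>_def)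
      show ?thesis
      proof (cases "e' = e")
        case True
        then show ?thesis using in_X[OF e] edge_ends(3)[of e] e e'(2) by auto
      next
        case False
        then have "A \<noteq> cl T e" using inj_on_cluster e e' by (auto dest: inj_onD)
        then show ?thesis
          using in_X[OF e'(1)] parent_in_side_iff[of e e'] e e'(2) False by auto
      qed
    qed (use X_sub in auto)
  qed
  have X_root: "X (mark T 2) = {}" by (auto simp: X_def)
  have X_node: "X v \<in> nodes" if v: "v \<in> verts T" for v
  proof (rule upset_chain_in_nodes[OF X_sub])
    show "B \<in> X v" if A: "A \<in> X v" "B \<in> \<sigma>" "A \<subseteq> B" for A B
    proof -
      obtain e where e: "e \<in> edges T - F" "v \<in> ?s e" "A = cl T e" using A(1) by (auto simp: X_def)
      obtain e' where e': "e' \<in> edges T - F" "B = cl T e'" using A(2) by (auto simp: \<sigma>_def)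
      have c: "?ch e \<in> ?s e'" using cluster_subset_iff[of e e'] e e' A(3) by auto
      have "v \<in> ?s e'"
      proof (cases "e = e'")
        case False
        then show ?thesis using side_nested[OF _ False c] e by blast
      qed (use e in simp)
      then show ?thesis using in_X[OF e'(1)] e'(2) by simp
    qed
    show "A \<subseteq> B \<or> B \<subseteq> A" if A: "A \<in> X v" "B \<in> X v" for A B
    proof -
      obtain e where e: "e \<in> edges T - F" "v \<in> ?s e" "A = cl T e" using A(1) by (auto simp: X_def)
      obtain e' where e': "e' \<in> edges T - F" "v \<in> ?s e'" "B = cl T e'" using A(2) by (auto simp: X_def)
      show ?thesis
      proof (cases "e = e'")
        case False
        then have "?ch e \<in> ?s e' \<or> ?ch e' \<in> ?s e" using side_cases[of e e' v] e e' v by blast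
        then show ?thesis using cluster_subset_iff[of e e'] cluster_subset_iff[of e' e] e e' by auto
      qed (use e e' in simp)
    qed
  qed
  have f_X: "f v = enc n (X v)" for v by (simp add: f_def X_def)
  show ?thesis
    unfolding contraction_def
  proof (intro conjI ballI)
    show "F \<subseteq> edges T" by (rule F)
    show "verts (laminar_tree n \<sigma>) = f ` verts T"
    proof
      show "f ` verts T \<subseteq> verts (laminar_tree n \<sigma>)"
        using X_node unfolding laminar_tree_def marked_tree.sel f_X by blast
      have "{} \<in> X ` verts T" using X_root root by (metis image_eqI)
      moreover have "above \<sigma> A \<in> X ` verts T" if "A \<in> \<sigma>" for A
      proof -
        obtain e where "e \<in> edges T - F" "A = cl T e" using \<open>A \<in> \<sigma>\<close> by (auto simp: \<sigma>_def)
        then show ?thesis using X_child[of e] edge_ends(5)[of e] by (metis DiffD1 image_eqI)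
      qed
      ultimately have "nodes \<subseteq> X ` verts T" by blast
      then have "enc n ` nodes \<subseteq> enc n ` X ` verts T" by (rule image_mono)
      then show "verts (laminar_tree n \<sigma>) \<subseteq> f ` verts T"
        unfolding laminar_tree_def marked_tree.sel f_X image_image .
    qed
    \<comment> \<open>Equal chains mean that no edge outside \<open>F\<close> separates the two
      vertices, and this amounts to a connection within \<open>F\<close>.\<close>
    show "f u = f v \<longleftrightarrow> edge_connected F u v" if uv: "u \<in> verts T" "v \<in> verts T" for u v
    proof
      assume "f u = f v"
      then have "X u = X v" unfolding f_X using enc_eq[OF X_sub X_sub] by blast
      then have "u \<in> ?s e \<longleftrightarrow> v \<in> ?s e" if "e \<in> edges T - F" for e using in_X[OF that] by metis
      then show "edge_connected F u v" using not_connected_imp_edge[OF F uv] by blast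
    next
      assume c: "edge_connected F u v"
      have "u \<in> ?s e \<longleftrightarrow> v \<in> ?s e" if "e \<in> edges T - F" for e
        using that F by (intro side_connected_iff edge_connected_mono[OF c]) blast
      then have "X u = X v" unfolding X_def by blast
      then show "f u = f v" by (simp add: f_X)
    qed
    have "f ` e = tree_edge n \<sigma> (cl T e)" if e: "e \<in> edges T - F" for e
    proof -
      have "f ` e = f ` {?p e, ?ch e}" using edge_ends(1)[of e] e by simp
      also have "\<dots> = tree_edge n \<sigma> (cl T e)"
        using X_parent[OF e] X_child[OF e] by (simp add: f_X tree_edge_def insert_commute)
      finally show ?thesis .
    qed
    then have "(`) f ` (edges T - F) = tree_edge n \<sigma> ` cl T ` (edges T - F)"
      by (simp add: image_image)
    then show "edges (laminar_tree n \<sigma>) = (`) f ` (edges T - F)"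
      by (simp add: laminar_tree_def \<sigma>_def)
    show "mark (laminar_tree n \<sigma>) i = f (mark T i)" if i: "i \<in> {1..n}" for i
    proof -
      have "{A \<in> \<sigma>. i \<in> A} = X (mark T i)"
        using i by (auto simp: \<sigma>_def X_def cluster_def)
      then show ?thesis by (simp add: laminar_tree_def f_X)
    qed
  qed
qed

end

section \<open>Metric trees as points of the realization\<close>

lemma continuous_map_from_sum_topology:
  assumes "\<And>i. i \<in> I \<Longrightarrow> continuous_map (X i) Y (\<lambda>x. f (i, x))"
  shows "continuous_map (sum_topology X I) Y f"
  unfolding continuous_map_def
proof (intro conjI allI impI)
  show "f \<in> topspace (sum_topology X I) \<rightarrow> topspace Y"
    using assms by (fastforce simp: continuous_map_def)
  fix U assume U: "openin Y U"
  show "openin (sum_topology X I) {p \<in> topspace (sum_topology X I). f p \<in> U}"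
    unfolding openin_sum_topology
  proof (intro conjI ballI)
    fix i assume i: "i \<in> I"
    have "{x. (i, x) \<in> {p \<in> topspace (sum_topology X I). f p \<in> U}} = {x \<in> topspace (X i). f (i, x) \<in> U}"
      using i by auto
    then show "openin (X i) {x. (i, x) \<in> {p \<in> topspace (sum_topology X I). f p \<in> U}}"
      using openin_continuous_map_preimage[OF assms[OF i] U] by simp
  qed auto
qed

lemma topspace_length_simplex:
  "l \<in> topspace (length_simplex T) \<longleftrightarrow>
     l \<in> extensional (edges T) \<and> (\<forall>e\<in>edges T. 0 \<le> l e) \<and> sum l (edges T) = 1"
  by (auto simp: length_simplex_def PiE_def)

text \<open>For a stable tree the sum has at most one term, as distinct edges have distinct
  clusters; it supplies the value 0 when no edge has cluster \<open>A\<close>.\<close>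

definition coords :: "nat \<Rightarrow> marked_tree \<times> (nat set \<Rightarrow> real) \<Rightarrow> nat set \<Rightarrow> real" where
  "coords n = (\<lambda>(T, l) A. \<Sum>e | e \<in> edges T \<and> cluster n T (mark T 2) e = A. l e)"

text \<open>The inverse construction. \<open>\<sigma>\<close> may exceed the support of
  \<open>x\<close>, some edges then having length 0, so that one tree serves a whole closed face.
  \<open>restrict\<close> matches the product topology in \<open>length_simplex\<close>.\<close>

definition laminar_point :: "nat \<Rightarrow> nat set set \<Rightarrow> (nat set \<Rightarrow> real) \<Rightarrow> marked_tree \<times> (nat set \<Rightarrow> real)" where
  "laminar_point n \<sigma> x = (laminar_tree n \<sigma>,
     restrict (\<lambda>e. x (cluster n (laminar_tree n \<sigma>) (mark (laminar_tree n \<sigma>) 2) e)) (edges (laminar_tree n \<sigma>)))"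

context heavy_marks
begin

abbreviation "Z \<equiv> sum_topology length_simplex {T. stable_tree n w T}"
abbreviation "K \<equiv> laminar_families Vs"

lemma in_Z: "(T, l) \<in> topspace Z \<longleftrightarrow> stable_tree n w T \<and> l \<in> topspace (length_simplex T)"
  by simp

lemma cl_inj: "stable_tree n w T \<Longrightarrow> inj_on (cl T) (edges T)"
  using stable_rooted_tree_2 stable_rooted_tree.inj_on_cluster by blast

lemma finite_edges: "stable_tree n w T \<Longrightarrow> finite (edges T)"
  using stable_rooted_tree_2 rooted_tree.finite_E stable_rooted_tree.axioms(1) by blast

lemma coords_cl: assumes T: "stable_tree n w T" and e: "e \<in> edges T" shows "coords n (T, l) (cl T e) = l e"
proof -
  have "{e'. e' \<in> edges T \<and> cl T e' = cl T e} = {e}"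
    using cl_inj[OF T] e by (auto dest: inj_onD)
  then show ?thesis by (simp add: coords_def)
qed

lemma coords_outside: "A \<notin> cl T ` edges T \<Longrightarrow> coords n (T, l) A = 0"
proof -
  assume "A \<notin> cl T ` edges T"
  then have "{e. e \<in> edges T \<and> cl T e = A} = {}" by blast
  then show ?thesis unfolding coords_def by (simp only: prod.case sum.empty)
qed

lemma supp_coords:
  assumes T: "stable_tree n w T"
  shows "supp (coords n (T, l)) = cl T ` (edges T - {e \<in> edges T. l e = 0})"
proof (intro set_eqI iffI)
  fix A assume "A \<in> supp (coords n (T, l))"
  then have nz: "coords n (T, l) A \<noteq> 0" by (simp add: supp_def)
  then have "A \<in> cl T ` edges T" using coords_outside by blast
  then obtain e where "e \<in> edges T" "A = cl T e" by blast
  then show "A \<in> cl T ` (edges T - {e \<in> edges T. l e = 0})" using nz coords_cl[OF T, of e l] by auto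
next
  fix A assume "A \<in> cl T ` (edges T - {e \<in> edges T. l e = 0})"
  then obtain e where "e \<in> edges T" "l e \<noteq> 0" "A = cl T e" by blast
  then show "A \<in> supp (coords n (T, l))" using coords_cl[OF T, of e l] by (simp add: supp_def)
qed

lemma coords_in_realization:
  assumes "(T, l) \<in> topspace Z"
  shows "coords n (T, l) \<in> realization K"
proof (rule realizationI)
  have T: "stable_tree n w T" and l: "\<forall>e\<in>edges T. 0 \<le> l e" "sum l (edges T) = 1"
    using assms unfolding in_Z topspace_length_simplex by blast+
  show "finite (cl T ` edges T)" using finite_edges[OF T] by simp
  show "supp (coords n (T, l)) \<subseteq> cl T ` edges T" unfolding supp_coords[OF T] by blast
  show "supp (coords n (T, l)) \<in> K" unfolding supp_coords[OF T] by (rule clusters_laminar[OF T]) blast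
  show "0 \<le> coords n (T, l) A" for A using l(1) unfolding coords_def prod.case by (intro sum_nonneg) blast
  have "sum (coords n (T, l)) (cl T ` edges T) = sum (coords n (T, l) \<circ> cl T) (edges T)"
    by (rule sum.reindex[OF cl_inj[OF T]])
  also have "\<dots> = sum l (edges T)" by (rule sum.cong) (simp_all add: coords_cl[OF T])
  finally show "sum (coords n (T, l)) (cl T ` edges T) = 1" using l(2) by simp
qed

text \<open>Contracted edges have length 0, and the other edges keep their length and, by
  \<open>contraction_cluster\<close>, their cluster.\<close>

lemma coords_length_contraction:
  assumes T: "stable_tree n w T" and c: "length_contraction n (T, l) (T', l')"
  shows "coords n (T', l') = coords n (T, l)"
proof
  fix A
  obtain F f where F: "contraction n F f T T'" "\<forall>e\<in>F. l e = 0" "\<forall>e\<in>edges T - F. l' (f ` e) = l e"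
    using c by (auto simp: length_contraction_def)
  have tree: "finite_tree (verts T) (edges T)" using T by (simp add: stable_tree_def)
  have E': "edges T' = (`) f ` (edges T - F)" using F(1) by (simp add: contraction_def)
  let ?S = "{e \<in> edges T - F. cl T e = A}"
  have cl': "cl T' (f ` e) = cl T e" if "e \<in> edges T - F" for e
    by (rule contraction_cluster[OF T F(1) that two_in])
  have eq: "{e'. e' \<in> edges T' \<and> cl T' e' = A} = (`) f ` ?S"
    unfolding E' using cl' by blast
  have "coords n (T', l') A = sum l' ((`) f ` ?S)"
    unfolding coords_def prod.case eq ..
  also have "\<dots> = sum (l' \<circ> (`) f) ?S"
    by (rule sum.reindex[OF inj_on_subset[OF contraction_inj_edges[OF tree F(1)]]]) blast
  also have "\<dots> = sum l ?S"
    by (rule sum.cong) (use F(3) in simp_all)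
  also have "\<dots> = sum l {e. e \<in> edges T \<and> cl T e = A}"
  proof (rule sum.mono_neutral_left)
    show "finite {e. e \<in> edges T \<and> cl T e = A}" using finite_edges[OF T] by simp
    show "\<forall>e\<in>{e. e \<in> edges T \<and> cl T e = A} - ?S. l e = 0" using F(2) by blast
  qed blast
  also have "\<dots> = coords n (T, l) A" by (simp add: coords_def)
  finally show "coords n (T', l') A = coords n (T, l) A" .
qed

lemma coords_glue_rel:
  assumes "(a, b) \<in> glue_rel Z (length_contraction n)"
  shows "coords n a = coords n b"
proof -
  have eq: "coords n x = coords n y"
    if "x \<in> topspace Z" "length_contraction n x y" for x y
  proof -
    obtain T l where x: "x = (T, l)" by (cases x)
    obtain T' l' where y: "y = (T', l')" by (cases y)
    have "stable_tree n w T" using that(1) unfolding x in_Z by blast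
    then show ?thesis using coords_length_contraction that(2) unfolding x y by metis
  qed
  have "equivclp (\<lambda>x y. x \<in> topspace Z \<and> y \<in> topspace Z \<and> length_contraction n x y) a b"
    using assms by (simp add: glue_rel_def)
  then show ?thesis
  proof (induction rule: equivclp_induct)
    case (step y z)
    then show ?case using eq by metis
  qed simp
qed

lemma edges_laminar_tree: "edges (laminar_tree n \<sigma>) = tree_edge n \<sigma> ` \<sigma>"
  by (simp add: laminar_tree_def)

lemma laminar_point_in_Z:
  assumes \<sigma>: "\<sigma> \<in> K" and x: "x \<in> realization K" "supp x \<subseteq> \<sigma>"
  shows "laminar_point n \<sigma> x \<in> topspace Z"
proof -
  let ?T = "laminar_tree n \<sigma>"
  interpret laminar n \<sigma> by (rule laminarI[OF \<sigma>])
  have "(\<Sum>e\<in>edges ?T. x (cl ?T e)) = (\<Sum>A\<in>\<sigma>. x (cl ?T (tree_edge n \<sigma> A)))"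
    unfolding edges_laminar_tree by (subst sum.reindex[OF inj_on_tree_edge]) simp
  also have "\<dots> = sum x \<sigma>" by (rule sum.cong) (simp_all add: cl_laminar_tree[OF \<sigma>])
  also have "\<dots> = 1" using sum_supp[OF finite_\<sigma> x(2)] realizationD(3)[OF x(1)] by simp
  finally have "(\<Sum>e\<in>edges ?T. x (cl ?T e)) = 1" .
  then show ?thesis
    unfolding laminar_point_def in_Z topspace_length_simplex
    using stable_laminar_tree[OF \<sigma>] realizationD(2)[OF x(1)] by simp
qed

lemma coords_laminar_point:
  assumes \<sigma>: "\<sigma> \<in> K" and x: "supp x \<subseteq> \<sigma>"
  shows "coords n (laminar_point n \<sigma> x) = x"
proof
  fix A
  let ?T = "laminar_tree n \<sigma>"
  note T = stable_laminar_tree[OF \<sigma>]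
  show "coords n (laminar_point n \<sigma> x) A = x A"
  proof (cases "A \<in> \<sigma>")
    case True
    then have e: "tree_edge n \<sigma> A \<in> edges ?T" by (simp add: edges_laminar_tree)
    show ?thesis
      using coords_cl[OF T e] cl_laminar_tree[OF \<sigma> True] e unfolding laminar_point_def by simp
  next
    case False
    then have "A \<notin> cl ?T ` edges ?T"
      using cl_laminar_tree[OF \<sigma>] by (auto simp: edges_laminar_tree)
    moreover have "x A = 0" using False x by (auto simp: supp_def)
    ultimately show ?thesis unfolding laminar_point_def using coords_outside by simp
  qed
qed

text \<open>Contracting exactly the edges of length 0 brings a point into a normal form that depends
  only on its coordinates; so points with equal coordinates are glued.\<close>

lemma glue_rel_laminar_point:
  assumes a: "a \<in> topspace Z"
  shows "(a, laminar_point n (supp (coords n a)) (coords n a)) \<in> glue_rel Z (length_contraction n)"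
proof -
  obtain T l where a_eq: "a = (T, l)" by (cases a)
  have T: "stable_tree n w T" using a unfolding a_eq in_Z by blast
  let ?x = "coords n a"
  define F where "F = {e \<in> edges T. l e = 0}"
  define \<sigma> where "\<sigma> = cl T ` (edges T - F)"
  have \<sigma>: "supp ?x = \<sigma>" unfolding a_eq supp_coords[OF T] \<sigma>_def F_def ..
  have xK: "?x \<in> realization K" using coords_in_realization a unfolding a_eq by blast
  have \<sigma>K: "\<sigma> \<in> K" using realizationD(1)[OF xK] \<sigma> by simp
  let ?T = "laminar_tree n \<sigma>"
  obtain f where c: "contraction n F f T ?T"
    using contraction_laminar_tree[OF T, of F] unfolding \<sigma>_def F_def by blast
  have "length_contraction n a (laminar_point n \<sigma> ?x)"
  proof -
    have "snd (laminar_point n \<sigma> ?x) (f ` e) = l e" if e: "e \<in> edges T - F" for e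
    proof -
      have "f ` e \<in> edges ?T" using c e by (auto simp: contraction_def)
      then have "snd (laminar_point n \<sigma> ?x) (f ` e) = ?x (cl ?T (f ` e))"
        by (simp add: laminar_point_def)
      also have "cl ?T (f ` e) = cl T e" by (rule contraction_cluster[OF T c e two_in])
      also have "?x (cl T e) = l e" unfolding a_eq using coords_cl[OF T] e by blast
      finally show ?thesis .
    qed
    then show ?thesis
      unfolding length_contraction_def a_eq laminar_point_def prod.case
      using c by (intro exI[of _ F] exI[of _ f] conjI) (auto simp: F_def)
  qed
  moreover have "laminar_point n \<sigma> ?x \<in> topspace Z"
    by (rule laminar_point_in_Z[OF \<sigma>K xK]) (simp add: \<sigma>)
  ultimately show ?thesis
    unfolding glue_rel_def \<sigma> using a by (simp add: r_into_equivclp)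
qed

lemma class_eq_iff:
  assumes "a \<in> topspace Z" "b \<in> topspace Z"
  shows "glue_rel Z (length_contraction n) `` {a} = glue_rel Z (length_contraction n) `` {b} \<longleftrightarrow>
     coords n a = coords n b"
  unfolding eq_equiv_class_iff[OF equiv_glue_rel UNIV_I UNIV_I]
proof
  assume eq: "coords n a = coords n b"
  have "(laminar_point n (supp (coords n b)) (coords n b), b) \<in> glue_rel Z (length_contraction n)"
    using glue_rel_laminar_point[OF assms(2)] equiv_glue_rel by (meson equivE symD)
  then show "(a, b) \<in> glue_rel Z (length_contraction n)"
    using glue_rel_laminar_point[OF assms(1)] unfolding eq by (meson equiv_glue_rel equivE transD)
qed (rule coords_glue_rel)

lemma continuous_map_coords: "continuous_map Z (top_of_set (realization K)) (coords n)"
proof (rule continuous_map_from_sum_topology)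
  fix T assume "T \<in> {T. stable_tree n w T}"
  then have T: "stable_tree n w T" by simp
  have "continuous_map (length_simplex T) euclideanreal (\<lambda>l. coords n (T, l) A)" for A
    unfolding coords_def prod.case
  proof (rule continuous_map_sum)
    fix e assume "e \<in> {e. e \<in> edges T \<and> cl T e = A}"
    then show "continuous_map (length_simplex T) euclideanreal (\<lambda>l. l e)"
      unfolding length_simplex_def
      by (intro continuous_map_from_subtopology continuous_map_product_projection) simp
  qed (use finite_edges[OF T] in simp)
  then have "continuous_map (length_simplex T) (powertop_real UNIV) (\<lambda>l. coords n (T, l))"
    by (simp add: continuous_map_componentwise_UNIV)
  then show "continuous_map (length_simplex T) (top_of_set (realization K)) (\<lambda>l. coords n (T, l))"
    unfolding euclidean_product_topology continuous_map_in_subtopology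
    using coords_in_realization T by auto
qed

text \<open>Coordinates descend from the sum of the simplices by the quotient property. The inverse
  is pasted from the finitely many closed faces of \<open>K\<close>, over each of which the tree is
  constant.\<close>

lemma Delta0_homeomorphic_realization: "Delta0 n w homeomorphic_space top_of_set (realization K)"
proof -
  let ?D = "Delta0 n w" and ?X = "top_of_set (realization K)"
  define cls where "cls = (\<lambda>a. glue_rel Z (length_contraction n) `` {a})"
  have quot: "quotient_map Z ?D cls"
    unfolding cls_def Delta0_def by (rule quotient_map_glue)
  have cls_eq: "cls a = cls b \<longleftrightarrow> coords n a = coords n b" if "a \<in> topspace Z" "b \<in> topspace Z" for a b
    unfolding cls_def by (rule class_eq_iff[OF that])
  have wd: "coords n a = coords n b" if "a \<in> topspace Z" "b \<in> topspace Z" "cls a = cls b" for a b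
    using cls_eq that by blast
  obtain g where g: "continuous_map ?D ?X g" "g ` topspace ?D = coords n ` topspace Z"
    "\<And>a. a \<in> topspace Z \<Longrightarrow> g (cls a) = coords n a"
    by (rule quotient_map_lift_exists[OF quot continuous_map_coords wd]) (assumption | rule that)+
  define k where "k = (\<lambda>x. cls (laminar_point n (supp x) x))"
  have k_eq: "k x = cls (laminar_point n \<sigma> x)"
    if \<sigma>: "\<sigma> \<in> K" and x: "x \<in> realization K" "supp x \<subseteq> \<sigma>" for \<sigma> x
  proof -
    have sx: "supp x \<in> K" using realizationD(1)[OF x(1)] .
    show ?thesis
      unfolding k_def
      using cls_eq[OF laminar_point_in_Z[OF sx x(1)] laminar_point_in_Z[OF \<sigma> x]]
        coords_laminar_point[OF sx, of x] coords_laminar_point[OF \<sigma> x(2)] by simp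
  qed
  have k_cont: "continuous_map ?X ?D k"
  proof (rule pasting_lemma_closed[where I = K and T = "\<lambda>\<sigma>. {x \<in> realization K. supp x \<subseteq> \<sigma>}"
        and f = "\<lambda>\<sigma> x. cls (laminar_point n \<sigma> x)"])
    show "finite K"
      using simplicial_complexD(1)[OF simplicial_complex_laminar_families[OF finite_Vs]] .
    show "closedin ?X {x \<in> realization K. supp x \<subseteq> \<sigma>}" for \<sigma>
      by (rule closedin_realization_face)
    fix \<sigma> assume \<sigma>: "\<sigma> \<in> K"
    let ?F = "{x \<in> realization K. supp x \<subseteq> \<sigma>}" and ?T = "laminar_tree n \<sigma>"
    have sub: "subtopology ?X ?F = top_of_set ?F"
      by (simp add: subtopology_subtopology Int_absorb1)
    have "continuous_map (top_of_set ?F) (length_simplex ?T) (\<lambda>x. snd (laminar_point n \<sigma> x))"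
      unfolding length_simplex_def continuous_map_in_subtopology continuous_map_componentwise
    proof (intro conjI ballI)
      show "(\<lambda>x. snd (laminar_point n \<sigma> x)) ` topspace (top_of_set ?F) \<subseteq> extensional (edges ?T)"
        by (auto simp: laminar_point_def)
      show "continuous_map (top_of_set ?F) euclideanreal (\<lambda>x. snd (laminar_point n \<sigma> x) e)"
        if "e \<in> edges ?T" for e
        using that by (simp add: laminar_point_def continuous_on_coordinate)
      have "snd (laminar_point n \<sigma> x) \<in> topspace (length_simplex ?T)" if "x \<in> ?F" for x
        using laminar_point_in_Z[OF \<sigma>, of x] that by (simp add: laminar_point_def)
      then show "(\<lambda>x. snd (laminar_point n \<sigma> x)) \<in> topspace (top_of_set ?F) \<rightarrow>
          {l. (\<forall>e\<in>edges ?T. 0 \<le> l e) \<and> sum l (edges ?T) = 1}"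
        unfolding topspace_length_simplex by auto
    qed
    moreover have "continuous_map (length_simplex ?T) Z (\<lambda>l. (?T, l))"
      by (rule continuous_map_component_injection) (simp add: stable_laminar_tree[OF \<sigma>])
    ultimately have "continuous_map (top_of_set ?F) ?D
        (cls \<circ> ((\<lambda>l. (?T, l)) \<circ> (\<lambda>x. snd (laminar_point n \<sigma> x))))"
      by (intro continuous_map_compose[OF _ quotient_imp_continuous_map[OF quot]] continuous_map_compose)
    then show "continuous_map (subtopology ?X ?F) ?D (\<lambda>x. cls (laminar_point n \<sigma> x))"
      unfolding sub by (simp add: o_def laminar_point_def)
  next
    show "cls (laminar_point n \<sigma> x) = cls (laminar_point n \<tau> x)"
      if "\<sigma> \<in> K" "\<tau> \<in> K" "x \<in> topspace ?X \<inter> {x \<in> realization K. supp x \<subseteq> \<sigma>} \<inter> {x \<in> realization K. supp x \<subseteq> \<tau>}" for \<sigma> \<tau> x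
      using k_eq[OF that(1), of x] k_eq[OF that(2), of x] that(3) by simp
    show "\<exists>\<sigma>. \<sigma> \<in> K \<and> x \<in> {x \<in> realization K. supp x \<subseteq> \<sigma>} \<and> k x = cls (laminar_point n \<sigma> x)"
      if "x \<in> topspace ?X" for x
      using that realizationD(1)[of x K] by (intro exI[of _ "supp x"]) (simp add: k_def)
  qed
  have "homeomorphic_maps ?D ?X g k"
    unfolding homeomorphic_maps_def
  proof (intro conjI ballI g(1) k_cont)
    fix c assume "c \<in> topspace ?D"
    then obtain a where a: "a \<in> topspace Z" "c = cls a"
      using quotient_imp_surjective_map[OF quot] by blast
    have "k (coords n a) = cls a"
      unfolding k_def cls_def using glue_rel_laminar_point[OF a(1)] equiv_class_eq[OF equiv_glue_rel]
      by metis
    then show "k (g c) = c" using g(3)[OF a(1)] a(2) by simp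
  next
    fix x assume "x \<in> topspace ?X"
    then have x: "x \<in> realization K" by simp
    have "laminar_point n (supp x) x \<in> topspace Z"
      by (rule laminar_point_in_Z[OF realizationD(1)[OF x] x]) simp
    then show "g (k x) = x"
      unfolding k_def using g(3) coords_laminar_point[OF realizationD(1)[OF x]] by simp
  qed
  then show ?thesis unfolding homeomorphic_space_def by blast
qed

end

section \<open>Assembling the theorem\<close>

lemma blocks_mark_blocks: "blocks (mark_blocks n)"
  by (auto simp: blocks_def mark_blocks_def disjoint_def)

lemma card_mark_blocks: "2 \<le> n \<Longrightarrow> card (mark_blocks n) = n - 1"
  unfolding mark_blocks_def by (subst card_image) (auto simp: inj_on_def)

lemma wedge_of_empty_sphere: "wedge_of_spheres [-1] = trivial_topology"
proof -
  have "topspace (wedge_of_spheres [-1]) = {}"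
    by (auto simp: wedge_of_spheres_def wedge_sum_def topspace_glue std_sphere_def quotient_def)
  then show ?thesis by (simp add: null_topspace_iff_trivial)
qed

theorem theoremA:
  fixes n :: nat and w :: "nat \<Rightarrow> real"
  assumes "n \<ge> 3"
    and "\<forall>i\<in>{1..n}. 0 < w i \<and> w i \<le> 1"
    and "w 1 = 1" and "w 2 = 1"
  shows "\<exists>ds :: int list.
           (\<forall>d\<in>set ds. 0 \<le> d \<and> d \<le> int n - 4) \<and>
           Delta0 n w homotopy_equivalent_space wedge_of_spheres ((int n - 4) # ds)"
proof -
  interpret heavy_marks n w using assms by unfold_locales
  have D: "Delta0 n w homotopy_equivalent_space top_of_set (realization K)"
    by (rule homeomorphic_imp_homotopy_equivalent_space[OF Delta0_homeomorphic_realization])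
  have scK: "simplicial_complex K" by (rule simplicial_complex_laminar_families[OF finite_Vs])
  have card: "card (mark_blocks n) = n - 1" using n3 by (intro card_mark_blocks) simp
  have "\<exists>C X. near_collapsible K C X \<and> (\<forall>\<sigma>\<in>X. card \<sigma> \<le> card (mark_blocks n) - 2) \<and>
      (\<exists>\<sigma>\<in>X. card \<sigma> = card (mark_blocks n) - 2) \<and> (3 \<le> card (mark_blocks n) \<longrightarrow> C \<noteq> {})"
  proof (rule near_collapsible_clusters[OF blocks_mark_blocks])
    show "\<forall>i\<in>\<Union>(mark_blocks n). 0 < w i" using w_bounds by (auto simp: Union_mark_blocks)
    show "{1} \<in> mark_blocks n" using n3 by (simp add: mark_blocks_def)
    show "1 \<le> sum w {1}" using w1 by simp
    show "2 \<le> card (mark_blocks n)" using card n3 by simp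
  qed
  then obtain C X \<sigma>0 where nc: "near_collapsible K C X" and le: "\<And>\<sigma>. \<sigma> \<in> X \<Longrightarrow> card \<sigma> \<le> n - 3"
    and \<sigma>0: "\<sigma>0 \<in> X" "card \<sigma>0 = n - 3" and C: "4 \<le> n \<Longrightarrow> C \<noteq> {}"
  proof -
    have "n - 1 - 2 = n - 3" "3 \<le> n - 1 \<longleftrightarrow> 4 \<le> n" by linarith+
    with \<open>\<exists>C X. _\<close> that show ?thesis unfolding card by metis
  qed
  show ?thesis
  \<comment> \<open>For \<open>n = 3\<close> there are no clusters and no points: both spaces are
    empty and are compared directly.\<close>
  proof (cases "n = 3")
    case True
    have "realization K = {}"
    proof (rule equals0I)
      fix x assume x: "x \<in> realization K"
      have "A \<notin> Vs" for A
      proof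
        assume "A \<in> Vs"
        then have A: "A \<subseteq> {1, 3}" "A \<noteq> {1, 3}" "1 < sum w A"
          using in_Vs[of A] True by (auto simp: atLeastAtMost_insertL numeral_eq_Suc atLeastAtMostSuc_conv)
        then have "A = {} \<or> A = {1} \<or> A = {3}" by blast
        moreover have "w 3 \<le> 1" using w_bounds n3 by simp
        ultimately show False using A(3) w1 by (elim disjE) simp_all
      qed
      then have "supp x = {}" using realizationD(1)[OF x] by (auto simp: laminar_families_def)
      then show False using realizationD(3)[OF x] by simp
    qed
    then have "top_of_set (realization K) = trivial_topology" by simp
    then have "Delta0 n w homeomorphic_space wedge_of_spheres [-1]"
      using Delta0_homeomorphic_realization unfolding wedge_of_empty_sphere
      by (metis homeomorphic_empty_space_eq homeomorphic_space_sym)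
    then show ?thesis
      using True by (intro exI[of _ "[]"]) (simp add: homeomorphic_imp_homotopy_equivalent_space)
  next
    case False
    then have n4: "4 \<le> n" using n3 by simp
    have finX: "finite X" using simplicial_complexD(1)[OF scK] nc by (auto simp: near_collapsible_def)
    then obtain xs where xs: "set xs = X - {\<sigma>0}" "distinct xs"
      using finite_distinct_list[of "X - {\<sigma>0}"] by auto
    let ?dim = "\<lambda>\<sigma>. int (card \<sigma>) - 1"
    \<comment> \<open>The empty face lies in \<open>C\<close>, so every cell has a vertex and no
      sphere of dimension -1 occurs among the summands.\<close>
    have dims: "0 \<le> ?dim \<sigma> \<and> ?dim \<sigma> \<le> int n - 4" if \<sigma>: "\<sigma> \<in> X" for \<sigma>
    proof -
      have "collapsible C" "\<sigma> \<in> K" "\<sigma> \<notin> C" using nc \<sigma> unfolding near_collapsible_def by auto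
      moreover have "{} \<in> C"
        using C[OF n4] simplicial_complexD(3)[OF collapsible_imp_simplicial_complex[OF \<open>collapsible C\<close>]] by blast
      ultimately have "card \<sigma> \<noteq> 0" using simplicial_complexD(2)[OF scK] by auto
      then show ?thesis using le[OF \<sigma>] n4 by linarith
    qed
    have W: "top_of_set (realization K) homotopy_equivalent_space wedge_of_spheres (map ?dim (\<sigma>0 # xs))"
      by (rule near_collapsible_homotopy_equivalent_wedge[OF scK nc C[OF n4]]) (use xs \<sigma>0 in auto)
    have "?dim \<sigma>0 = int n - 4" using \<sigma>0(2) n4 by simp
    then have "map ?dim (\<sigma>0 # xs) = (int n - 4) # map ?dim xs" by simp
    with homotopy_eqv_trans[OF D W]
    have "Delta0 n w homotopy_equivalent_space wedge_of_spheres ((int n - 4) # map ?dim xs)"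
      by (simp only:)
    moreover have "\<forall>d\<in>set (map ?dim xs). 0 \<le> d \<and> d \<le> int n - 4" using dims xs(1) by auto
    ultimately show ?thesis by blast
  qed
qed

end
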